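(* Let $\mathbf J$ be a non-empty subset of $\mathring{\mathbf I}$. The assignment $(\mathbf K,u,y)\mapsto\nabla_{\mathbf J}(\mathbf K,u,y):=\Delta^{\mathbf K}_{\mathbf J}(u,-)\amalg u\Phi_{\mathbf K}(y)$ defines a bijective mapping from $\widetilde{\boldsymbol{\mathcal P}}_{\mathbf J}$ to $\mathfrak B_{\mathbf J}\amalg\mathfrak B^\infty_{\mathbf J}$, which maps $\boldsymbol{\mathcal P}_{\mathbf J}$ onto $\mathfrak B^\infty_{\mathbf J}$.
   Context: Setting. Let $l\ge1$, $\mathbf I=\{0,1,\dots,l\}$, $\mathring{\mathbf I}=\{1,\dots,l\}$, and let $A=(a_{ij})_{i,j\in\mathbf I}$ be a generalized Cartan matrix of untwisted affine type $X_l^{(1)}$ ($X=A,B,\dots,G$) such that $(a_{ij})_{i,j\in\mathring{\mathbf I}}$ is the Cartan matrix of finite type $X_l$. Let $\mathfrak g$ be the associated affine Kac-Moody Lie algebra over $\mathbb R$ with Cartan subalgebra $\mathfrak h$, $\Delta\subset\mathfrak h^*\setminus\{0\}$ its root system, $\Pi=\{\alpha_i\mid i\in\mathbf I\}$ the root basis, $\Delta_\pm$ the positive/negative roots, $W=\langle s_i\mid i\in\mathbf I\rangle\subset GL(\mathfrak h^* )$ the Weyl group. Put $\mathring\Pi=\{\alpha_i\mid i\in\mathring{\mathbf I}\}$, $\mathring W=\langle s_i\mid i\in\mathring{\mathbf I}\rangle$, $\mathring\Delta=\mathring W(\mathring\Pi)$ (finite root system of type $X_l$), $\mathring\Delta_\pm=\mathring\Delta\cap\Delta_\pm$,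 $\theta$ its highest root, $\delta=\alpha_0+\theta$. Then $\Delta^{re}=\{m\delta+\varepsilon\mid m\in\mathbb Z,\varepsilon\in\mathring\Delta\}$, $\Delta^{im}=\{m\delta\mid m\in\mathbb Z\setminus\{0\}\}$, $\Delta^{re}_+=\Delta^{re}\cap\Delta_+$, $\Delta^{im}_+=\Delta^{im}\cap\Delta_+$. For $\alpha\in\Delta^{re}$, $s_\alpha$ is the reflection in $\alpha$. For $\mathbf K\subset\mathbf J\subset\mathring{\mathbf I}$: $\mathring\Pi_{\mathbf J}=\{\alpha_j\mid j\in\mathbf J\}$, $\mathring W_{\mathbf J}=\langle s_j\mid j\in\mathbf J\rangle$, $\mathring\Delta_{\mathbf J}=\mathring W_{\mathbf J}(\mathring\Pi_{\mathbf J})$, $\mathring\Delta^{\mathbf K}_{\mathbf J\pm}=(\mathring\Delta_{\mathbf J}\setminus\mathring\Delta_{\mathbf K})\cap\mathring\Delta_\pm$, $\mathring W^{\mathbf K}_{\mathbf J}=\{w\in\mathring W_{\mathbf J}\mid w(\alpha_k)\in\Delta_+\ \forall k\in\mathbf K\}$. For $P\subset\mathring\Delta$, $\langle P\rangle=\{m\delta+\varepsilon\mid m\in\mathbb Z_{\ge0},\varepsilon\in P\}\cap\Delta^{re}_+$. Put $\Delta^{re}_{\mathbf J+}=\langle\mathring\Delta_{\mathbf J}\rangle$, $\Delta_{\mathbf J+}=\Delta^{re}_{\mathbf J+}\amalg\Delta^{im}_+$, $\Delta^{\mathbf K}_{\mathbf J}(w,\pm)=\langle w\mathring\Delta^{\mathbf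 K}_{\mathbf J\pm}\rangle$ for $w\in\mathring W_{\mathbf J}$. For $\mathbf K\neq\emptyset$ let $\mathring\Delta_{\mathbf K}=\coprod_c\mathring\Delta_{\mathbf K_c}$ be the decomposition into irreducible components, $\theta_{\mathbf K_c}$ the highest root of $\mathring\Delta_{\mathbf K_c}$ relative to $\mathring\Pi_{\mathbf K_c}$, and $W_{\mathbf K}\subset W$ the subgroup generated by the reflections $s_\alpha$, $\alpha\in\coprod_c(\mathring\Pi_{\mathbf K_c}\amalg\{\delta-\theta_{\mathbf K_c}\})$; $W_\emptyset=\{1\}$. For $y\in W_{\mathbf K}$, $\Phi_{\mathbf K}(y)=\{\beta\in\Delta_{\mathbf K+}\mid y^{-1}(\beta)\in\Delta_-\}$. A subset $B\subset\Delta_{\mathbf J+}$ is biconvex in $\Delta_{\mathbf J+}$ if for $C=B$ and for $C=\Delta_{\mathbf J+}\setminus B$: $\beta,\gamma\in C$ and $\beta+\gamma\in\Delta_{\mathbf J+}$ imply $\beta+\gamma\in C$. $\mathfrak B_{\mathbf J}$ is the set of all finite biconvex sets in $\Delta_{\mathbf J+}$; $\mathfrak B^\infty_{\mathbf J}$ is the set of all infinite biconvex sets $B$ in $\Delta_{\mathbf J+}$ with $B\subset\Delta^{re}_+$. $\widetilde{\boldsymbol{\mathcal P}}_{\mathbf J}=\{(\mathbf K,u,y)\mid\mathbf K\subset\mathbf J,\ u\in\mathring W^{\mathbf K}_{\mathbf J},\ y\in W_{\mathbf K}\}$ and $\boldsymbol{\mathcal P}_{\mathbf J}=\{(\mathbf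 K,u,y)\in\widetilde{\boldsymbol{\mathcal P}}_{\mathbf J}\mid\mathbf K\subsetneq\mathbf J\}$. *)

theory Defs
  imports "HOL-Analysis.Analysis"
begin

section \<open>Generalized Cartan matrices\<close>

definition gen_cartan_matrix :: "nat set \<Rightarrow> (nat \<Rightarrow> nat \<Rightarrow> int) \<Rightarrow> bool" where
  "gen_cartan_matrix I A \<longleftrightarrow>
     (\<forall>i\<in>I. A i i = 2) \<and>
     (\<forall>i\<in>I. \<forall>j\<in>I. i \<noteq> j \<longrightarrow> A i j \<le> 0 \<and> (A i j = 0 \<longleftrightarrow> A j i = 0))"

definition indecomposable :: "nat set \<Rightarrow> (nat \<Rightarrow> nat \<Rightarrow> int) \<Rightarrow> bool" where
  "indecomposable I A \<longleftrightarrow> I \<noteq> {} \<and>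
     (\<forall>D. D \<noteq> {} \<and> D \<subset> I \<longrightarrow> (\<exists>i\<in>D. \<exists>j\<in>I - D. A i j \<noteq> 0))"

definition symmetrizer :: "nat set \<Rightarrow> (nat \<Rightarrow> nat \<Rightarrow> int) \<Rightarrow> (nat \<Rightarrow> real) \<Rightarrow> bool" where
  "symmetrizer I A d \<longleftrightarrow> (\<forall>i\<in>I. d i > 0) \<and>
     (\<forall>i\<in>I. \<forall>j\<in>I. d i * of_int (A i j) = d j * of_int (A j i))"

definition symmetrizable :: "nat set \<Rightarrow> (nat \<Rightarrow> nat \<Rightarrow> int) \<Rightarrow> bool" where
  "symmetrizable I A \<longleftrightarrow> (\<exists>d. symmetrizer I A d)"

definition cartan_matrix_finite_type :: "nat set \<Rightarrow> (nat \<Rightarrow> nat \<Rightarrow> int) \<Rightarrow> bool" where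
  "cartan_matrix_finite_type I A \<longleftrightarrow> gen_cartan_matrix I A \<and>
     (\<exists>d. symmetrizer I A d \<and>
        (\<forall>x :: nat \<Rightarrow> real. (\<exists>i\<in>I. x i \<noteq> 0) \<longrightarrow>
           (\<Sum>i\<in>I. \<Sum>j\<in>I. d i * of_int (A i j) * x i * x j) > 0))"

text \<open>
  The irreducible components of the finite root system spanned by \<open>K\<close> are the ones spanned by the
  connected components of the Dynkin diagram of \<open>K\<close>.
\<close>

definition irreducible_components :: "(nat \<Rightarrow> nat \<Rightarrow> int) \<Rightarrow> nat set \<Rightarrow> nat set set" where
  "irreducible_components A K =
     {C. C \<subseteq> K \<and> indecomposable C A \<and> (\<forall>i\<in>C. \<forall>j\<in>K - C. A i j = 0)}"

inductive_set gen_group :: "('v \<Rightarrow> 'v) set \<Rightarrow> ('v \<Rightarrow> 'v) set" for S :: "('v \<Rightarrow> 'v) set" where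
  gen_id: "id \<in> gen_group S"
| gen_mult: "g \<in> S \<Longrightarrow> w \<in> gen_group S \<Longrightarrow> g \<circ> w \<in> gen_group S"
| gen_inv: "g \<in> S \<Longrightarrow> w \<in> gen_group S \<Longrightarrow> inv g \<circ> w \<in> gen_group S"

section \<open>Realizations and Weyl groups\<close>

text \<open>
  The type \<open>'v\<close> is the dual \<open>\<hh>\<^sup>*\<close> of the Cartan subalgebra. The Cartan subalgebra itself is the
  dual space of \<open>'v\<close>, so the simple coroots \<open>\<alpha>v i\<close> are linear functionals on \<open>'v\<close>. The matrix has
  size \<open>l + 1\<close> and, for affine type, corank 1; hence a realization has dimension
  \<open>2 (l + 1) - l = l + 2\<close>.
\<close>

locale cartan_realization =
  fixes l :: nat
    and A :: "nat \<Rightarrow> nat \<Rightarrow> int"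
    and \<alpha> :: "nat \<Rightarrow> 'v::real_vector"
    and \<alpha>v :: "nat \<Rightarrow> 'v \<Rightarrow> real"
  assumes l_pos: "l \<ge> 1"
    and gcm: "gen_cartan_matrix {0..l} A"
    and dim_space: "dim (UNIV :: 'v set) = l + 2"
    and coroots_linear: "\<And>i. i \<in> {0..l} \<Longrightarrow> linear (\<alpha>v i)"
    and roots_independent: "inj_on \<alpha> {0..l}" "independent (\<alpha> ` {0..l})"
    and coroots_independent:
      "\<And>x :: nat \<Rightarrow> real. (\<And>v. (\<Sum>i\<in>{0..l}. x i * \<alpha>v i v) = 0) \<Longrightarrow> (\<forall>i\<in>{0..l}. x i = 0)"
    and pairing: "\<And>i j. i \<in> {0..l} \<Longrightarrow> j \<in> {0..l} \<Longrightarrow> \<alpha>v i (\<alpha> j) = of_int (A i j)"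
begin

definition simple_reflection :: "nat \<Rightarrow> 'v \<Rightarrow> 'v" where
  "simple_reflection i v = v - \<alpha>v i v *\<^sub>R \<alpha> i"

definition weyl_group :: "('v \<Rightarrow> 'v) set" where
  "weyl_group = gen_group (simple_reflection ` {0..l})"

text \<open>The reflection in a real root \<open>w \<alpha>\<^sub>i\<close> is \<open>w s\<^sub>i w\<^sup>-\<^sup>1\<close>, independently of the choice of
  \<open>w\<close> and \<open>i\<close>.\<close>

definition reflection :: "'v \<Rightarrow> 'v \<Rightarrow> 'v" where
  "reflection \<beta> = (THE s. \<exists>w\<in>weyl_group. \<exists>i\<in>{0..l}.
     w (\<alpha> i) = \<beta> \<and> s = w \<circ> simple_reflection i \<circ> inv w)"

definition Qplus :: "nat set \<Rightarrow> 'v set" where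
  "Qplus J = {(\<Sum>j\<in>J. of_nat (n j) *\<^sub>R \<alpha> j) | n :: nat \<Rightarrow> nat. True}"

definition fin_weyl :: "nat set \<Rightarrow> ('v \<Rightarrow> 'v) set" where
  "fin_weyl J = gen_group (simple_reflection ` J)"

definition fin_roots :: "nat set \<Rightarrow> 'v set" where
  "fin_roots J = {w (\<alpha> j) | w j. w \<in> fin_weyl J \<and> j \<in> J}"

definition highest_root :: "nat set \<Rightarrow> 'v" where
  "highest_root J = (THE \<theta>. \<theta> \<in> fin_roots J \<and> (\<forall>\<beta>\<in>fin_roots J. \<theta> - \<beta> \<in> Qplus J))"

definition delta :: "'v" where
  "delta = \<alpha> 0 + highest_root {1..l}"

end

section \<open>Untwisted affine type\<close>

text \<open>
  The matrix is of type \<open>X\<^sub>l\<^sup>(\<^sup>1\<^sup>)\<close> if \<open>(a\<^sub>i\<^sub>j)\<close> with \<open>i, j \<ge> 1\<close> is an indecomposable Cartan matrix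
  of finite type \<open>X\<^sub>l\<close> and the node \<open>0\<close> is attached as the affine node of the extended Dynkin
  diagram. The latter is expressed by saying that \<open>\<delta> = \<alpha>\<^sub>0 + \<theta>\<close> is annihilated by all simple
  coroots: this gives \<open>a\<^sub>i\<^sub>0 = - \<langle>\<theta>, \<alpha>\<^sub>i\<^sup>\<or>\<rangle>\<close> for \<open>i \<ge> 1\<close>, and by symmetrizability
  \<open>a\<^sub>0\<^sub>j = - \<langle>\<alpha>\<^sub>j, \<theta>\<^sup>\<or>\<rangle>\<close>. The twisted affine types do not satisfy it.
\<close>

locale untwisted_affine = cartan_realization l A \<alpha> \<alpha>v
  for l :: nat
    and A :: "nat \<Rightarrow> nat \<Rightarrow> int"
    and \<alpha> :: "nat \<Rightarrow> 'v::real_vector"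
    and \<alpha>v :: "nat \<Rightarrow> 'v \<Rightarrow> real" +
  assumes affine_symmetrizable: "symmetrizable {0..l} A"
    and fin_indecomposable: "indecomposable {1..l} A"
    and fin_type: "cartan_matrix_finite_type {1..l} A"
    and delta_null: "\<And>i. i \<in> {0..l} \<Longrightarrow> \<alpha>v i delta = 0"
begin

text \<open>
  The root system of the untwisted affine Kac-Moody algebra with this realization, by its explicit
  description through the finite root system and \<open>\<delta>\<close>. Positivity is with respect to the root basis.
\<close>

definition real_roots :: "'v set" where
  "real_roots = {of_int m *\<^sub>R delta + \<epsilon> | (m :: int) \<epsilon>. \<epsilon> \<in> fin_roots {1..l}}"

definition imag_roots :: "'v set" where
  "imag_roots = {of_int m *\<^sub>R delta | m :: int. m \<noteq> 0}"

definition roots :: "'v set" where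
  "roots = real_roots \<union> imag_roots"

definition pos_roots :: "'v set" where
  "pos_roots = roots \<inter> Qplus {0..l}"

definition neg_roots :: "'v set" where
  "neg_roots = roots \<inter> uminus ` Qplus {0..l}"

definition pos_real_roots :: "'v set" where
  "pos_real_roots = real_roots \<inter> pos_roots"

definition pos_imag_roots :: "'v set" where
  "pos_imag_roots = imag_roots \<inter> pos_roots"

definition fin_neg_roots :: "'v set" where
  "fin_neg_roots = fin_roots {1..l} \<inter> neg_roots"

text \<open>The set \<open>\<langle>P\<rangle>\<close>.\<close>

definition affinize :: "'v set \<Rightarrow> 'v set" where
  "affinize P = {of_nat m *\<^sub>R delta + \<epsilon> | (m :: nat) \<epsilon>. \<epsilon> \<in> P} \<inter> pos_real_roots"

definition pos_roots_sub :: "nat set \<Rightarrow> 'v set" where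
  "pos_roots_sub J = affinize (fin_roots J) \<union> pos_imag_roots"

definition fin_neg_roots_rel :: "nat set \<Rightarrow> nat set \<Rightarrow> 'v set" where
  "fin_neg_roots_rel J K = (fin_roots J - fin_roots K) \<inter> fin_neg_roots"

definition Delta_minus :: "nat set \<Rightarrow> nat set \<Rightarrow> ('v \<Rightarrow> 'v) \<Rightarrow> 'v set" where
  "Delta_minus J K w = affinize (w ` fin_neg_roots_rel J K)"

definition fin_weyl_rel :: "nat set \<Rightarrow> nat set \<Rightarrow> ('v \<Rightarrow> 'v) set" where
  "fin_weyl_rel J K = {w \<in> fin_weyl J. \<forall>k\<in>K. w (\<alpha> k) \<in> pos_roots}"

text \<open>The group \<open>W\<^sub>K\<close>; for \<open>K = {}\<close> there are no generators and it is trivial.\<close>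

definition aff_weyl :: "nat set \<Rightarrow> ('v \<Rightarrow> 'v) set" where
  "aff_weyl K = gen_group (reflection `
     (\<Union>C\<in>irreducible_components A K. \<alpha> ` C \<union> {delta - highest_root C}))"

definition Phi :: "nat set \<Rightarrow> ('v \<Rightarrow> 'v) \<Rightarrow> 'v set" where
  "Phi K y = {\<beta> \<in> pos_roots_sub K. inv y \<beta> \<in> neg_roots}"

definition biconvex :: "nat set \<Rightarrow> 'v set \<Rightarrow> bool" where
  "biconvex J B \<longleftrightarrow> B \<subseteq> pos_roots_sub J \<and>
     (\<forall>C\<in>{B, pos_roots_sub J - B}. \<forall>\<beta>\<in>C. \<forall>\<gamma>\<in>C.
        \<beta> + \<gamma> \<in> pos_roots_sub J \<longrightarrow> \<beta> + \<gamma> \<in> C)"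

definition fin_biconvex_sets :: "nat set \<Rightarrow> 'v set set" where
  "fin_biconvex_sets J = {B. biconvex J B \<and> finite B}"

definition inf_biconvex_sets :: "nat set \<Rightarrow> 'v set set" where
  "inf_biconvex_sets J = {B. biconvex J B \<and> infinite B \<and> B \<subseteq> pos_real_roots}"

definition params_all :: "nat set \<Rightarrow> (nat set \<times> ('v \<Rightarrow> 'v) \<times> ('v \<Rightarrow> 'v)) set" where
  "params_all J = {(K, u, y). K \<subseteq> J \<and> u \<in> fin_weyl_rel J K \<and> y \<in> aff_weyl K}"

definition params :: "nat set \<Rightarrow> (nat set \<times> ('v \<Rightarrow> 'v) \<times> ('v \<Rightarrow> 'v)) set" where
  "params J = {(K, u, y). (K, u, y) \<in> params_all J \<and> K \<subset> J}"

definition nabla :: "nat set \<Rightarrow> nat set \<times> ('v \<Rightarrow> 'v) \<times> ('v \<Rightarrow> 'v) \<Rightarrow> 'v set" where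
  "nabla J = (\<lambda>(K, u, y). Delta_minus J K u \<union> u ` Phi K y)"

end

end

theory Submission
  imports Defs
begin

text \<open>
  For an infinite biconvex set \<open>B\<close> of real roots, the finite parts \<open>\<epsilon>\<close> such that some
  \<open>m \<delta> + \<epsilon>\<close> with \<open>m > 0\<close> is missing from \<open>B\<close> form a parabolic subset of the finite root system, hence
  \<open>u (\<Delta>\<^sub>+ \<union> \<Delta>\<^sub>K)\<close> for a unique \<open>K\<close> and a unique minimal coset representative \<open>u\<close>. On the complementary
  finite parts \<open>B\<close> contains every positive root, and what remains of \<open>B\<close> is the image under \<open>u\<close> of a finite
  biconvex set in the affine root system of \<open>K\<close>. Such a set is empty or contains a simple root, and
  reflecting in that root removes it; by induction it is the inversion set of an
  element \<open>y\<close> of the affine Weyl group, unique by the exchange property.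

  Positivity of roots is needed throughout and has a short proof in finite type: a root of mixed
  sign would violate an integrality and parity estimate for the invariant form (\<open>fin_roots_sign\<close>).
\<close>

text \<open>The exchange argument is abstract because it serves two systems: the finite system of
  \<open>J\<close>, for uniqueness of \<open>u\<close>, and the affine system of \<open>K\<close>,
  for finite biconvex sets. The affine one resists the usual Coxeter description. If
  \<open>K\<close> is disconnected, its components share a single \<open>delta\<close>, so the
  simple roots, with one affine node per component, are linearly dependent and positivity cannot be
  read off from coordinates in them. It is inherited from the ambient simple roots instead, and
  descent uses the ambient height together with the fact that a non-simple positive root, real or
  imaginary, is a sum of two positive ones. The parabolic subset is defined by what is missing from
  \<open>B\<close> because imaginary roots are missing too: a direction once missed stays missed at
  higher levels, and of two opposite directions one is always missed, as their roots add up to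
  imaginary ones. The realization is one dimension larger than the span of the simple roots. The
  form is symmetric on that span only, whereas group elements are compared as maps of the whole
  space.\<close>

section \<open>Abstract reflection systems\<close>

text \<open>The proof methods \<open>rule\<close> and \<open>induction\<close> \<open>\<eta>\<close>-expand \<open>id\<close> and \<open>\<circ>\<close> when they occur as
  arguments of a schematic predicate; \<open>id_apply\<close> and \<open>o_apply\<close> would then unfold them.\<close>

lemma gen_group_base: "g \<in> S \<Longrightarrow> g \<in> gen_group S"
  using gen_mult[OF _ gen_id] by force

lemma gen_group_comp:
  assumes "g \<in> gen_group S" "h \<in> gen_group S"
  shows "g \<circ> h \<in> gen_group S"
  using assms(1)
proof (induction rule: gen_group.induct)
  case (gen_inv g w)
  then show ?case unfolding comp_assoc by (intro gen_group.gen_inv)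
qed (use assms in \<open>auto simp: comp_assoc simp del: id_apply o_apply intro: gen_mult\<close>)

lemma gen_group_involutions_induct [consumes 2, case_names id comp]:
  assumes "w \<in> gen_group S" "\<forall>g\<in>S. g \<circ> g = id"
    and "Q id" "\<And>g w. g \<in> S \<Longrightarrow> w \<in> gen_group S \<Longrightarrow> Q w \<Longrightarrow> Q (g \<circ> w)"
  shows "Q w"
  using assms(1)
proof (induction rule: gen_group.induct)
  case (gen_inv g w)
  have "inv g = g" using assms(2) gen_inv(1) by (simp add: inv_unique_comp)
  then show ?case using assms(4)[OF gen_inv] by (simp del: o_apply)
qed (use assms in \<open>auto simp del: id_apply o_apply\<close>)

lemma gen_group_bij:
  assumes "w \<in> gen_group S" and inv: "\<forall>g\<in>S. g \<circ> g = id"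
  shows "bij w"
  using assms
proof (induction rule: gen_group_involutions_induct)
  case (comp g w)
  then show ?case using inv by (metis bij_comp o_bij)
qed (rule bij_id)

lemma gen_group_inv:
  assumes "w \<in> gen_group S" and inv: "\<forall>g\<in>S. g \<circ> g = id"
  shows "inv w \<in> gen_group S"
  using assms
proof (induction rule: gen_group_involutions_induct)
  case id
  then show ?case by (simp add: gen_id del: id_apply)
next
  case (comp g w)
  have g: "bij g" "inv g = g" using comp inv by (auto intro: o_bij inv_unique_comp)
  have "inv (g \<circ> w) = inv w \<circ> g"
    using g gen_group_bij[OF comp(2) inv] by (simp add: o_inv_distrib)
  then show ?case using comp gen_group_comp gen_group_base by metis
qed

text \<open>\<open>s_perm\<close> is the combinatorial core. \<open>ht\<close> separates
  \<open>P\<close> from its negatives, and \<open>s_conj\<close> carries a simple reflection past a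
  group element as an identity of maps on the whole space. Linearly dependent simple roots are
  allowed.\<close>

locale reflection_system =
  fixes S P :: "'v::real_vector set" and s :: "'v \<Rightarrow> 'v \<Rightarrow> 'v" and ht :: "'v \<Rightarrow> real"
  assumes s_linear: "b \<in> S \<Longrightarrow> linear (s b)"
    and s_invol: "b \<in> S \<Longrightarrow> s b (s b v) = v"
    and s_self: "b \<in> S \<Longrightarrow> s b b = - b"
    and simple_pos: "S \<subseteq> P"
    and s_perm: "b \<in> S \<Longrightarrow> x \<in> P \<Longrightarrow> x \<noteq> b \<Longrightarrow> s b x \<in> P"
    and ht_linear: "linear ht"
    and ht_pos: "x \<in> P \<Longrightarrow> ht x > 0"
    and s_conj: "g \<in> gen_group (s ` S) \<Longrightarrow> b \<in> S \<Longrightarrow> b' \<in> S \<Longrightarrow> g b = b' \<Longrightarrow> g \<circ> s b = s b' \<circ> g"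
begin

abbreviation W :: "('v \<Rightarrow> 'v) set" where "W \<equiv> gen_group (s ` S)"

lemma s_s: "\<forall>g\<in>s ` S. g \<circ> g = id"
  using s_invol by (auto simp: fun_eq_iff)

lemma W_induct [consumes 1, case_names id comp]:
  assumes "w \<in> W" "Q id" "\<And>b w. b \<in> S \<Longrightarrow> w \<in> W \<Longrightarrow> Q w \<Longrightarrow> Q (s b \<circ> w)"
  shows "Q w"
  using assms(1) s_s by (induction rule: gen_group_involutions_induct) (use assms in \<open>auto simp del: id_apply o_apply\<close>)

lemma W_bij: "w \<in> W \<Longrightarrow> bij w" and W_inv: "w \<in> W \<Longrightarrow> inv w \<in> W"
  using gen_group_bij gen_group_inv s_s by blast+

lemma W_inv_left [simp]: "w \<in> W \<Longrightarrow> inv w (w x) = x"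
  using W_bij by (simp add: bij_is_inj)

lemma W_inv_right [simp]: "w \<in> W \<Longrightarrow> w (inv w x) = x"
  using W_bij by (simp add: bij_is_surj surj_f_inv_f)

lemma W_linear: "w \<in> W \<Longrightarrow> linear w"
  by (induction rule: W_induct) (use linear_compose s_linear linear_id in blast)+

lemma uminus_notin: "x \<in> P \<Longrightarrow> - x \<notin> P"
  using ht_pos[of x] ht_pos[of "- x"] linear_neg[OF ht_linear, of x] by auto

definition R :: "'v set" where "R = P \<union> uminus ` P"

lemma uminus_R: "x \<in> R \<Longrightarrow> - x \<in> R"
  unfolding R_def by auto

lemma R_cases: "x \<in> R \<Longrightarrow> x \<in> P \<or> - x \<in> P"
  unfolding R_def by auto

lemma s_R: "b \<in> S \<Longrightarrow> x \<in> R \<Longrightarrow> s b x \<in> R"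
proof -
  have P: "s b x \<in> R" if "b \<in> S" "x \<in> P" for x
    using that s_self s_perm simple_pos unfolding R_def by (cases "x = b") auto
  assume "b \<in> S" "x \<in> R"
  then show ?thesis using P[of x] P[of "- x"] R_cases[of x] uminus_R[of "s b (- x)"]
    by (auto simp: linear_neg[OF s_linear])
qed

lemma W_R: "w \<in> W \<Longrightarrow> x \<in> R \<Longrightarrow> w x \<in> R"
  by (induction rule: W_induct) (auto intro: s_R)

section \<open>Words in simple reflections and the exchange property\<close>

primrec word :: "'v list \<Rightarrow> 'v \<Rightarrow> 'v" where
  "word [] = id"
| "word (b # bs) = s b \<circ> word bs"

lemma word_snoc: "word (bs @ [b]) = word bs \<circ> s b"
  by (induction bs) (auto simp: comp_assoc)

lemma word_W: "set bs \<subseteq> S \<Longrightarrow> word bs \<in> W"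
  by (induction bs) (auto intro: gen_id gen_mult)

lemma W_word: "w \<in> W \<Longrightarrow> \<exists>bs. set bs \<subseteq> S \<and> w = word bs"
proof (induction rule: W_induct)
  case id
  show ?case by (rule exI[of _ "[]"]) simp
next
  case (comp b w)
  then obtain bs where "b \<in> S" "set bs \<subseteq> S" "w = word bs" by auto
  then show ?case by (intro exI[of _ "b # bs"]) simp
qed

text \<open>Applying the word letter by letter from the right, the image of \<open>b\<close> leaves
  \<open>P\<close> at some letter \<open>c\<close>. A simple reflection can do this only to its own
  root, so the letters to the right of \<open>c\<close> carry \<open>b\<close> to \<open>c\<close>;
  conjugating by them turns \<open>s b\<close> into \<open>s c\<close>, which cancels the
  letter.\<close>

lemma exchange:
  assumes "set bs \<subseteq> S" "b \<in> S" "word bs b \<notin> P"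
  shows "\<exists>cs. set cs \<subseteq> S \<and> length cs < length bs \<and> word bs \<circ> s b = word cs"
  using assms
proof (induction bs)
  case Nil
  then show ?case using simple_pos by auto
next
  case (Cons c bs)
  show ?case
  proof (cases "word bs b \<in> P")
    case True
    then have "word bs b = c" using s_perm[of c "word bs b"] Cons.prems by auto
    then have "word bs \<circ> s b = s c \<circ> word bs"
      using s_conj[of "word bs" b c] word_W Cons.prems by auto
    then have "word (c # bs) \<circ> s b = word bs"
      using s_invol[of c] Cons.prems by (fastforce simp: fun_eq_iff)
    then show ?thesis using Cons.prems by (intro exI[of _ bs] conjI) (simp_all del: o_apply)
  next
    case False
    then obtain cs where "set cs \<subseteq> S" "length cs < length bs" "word bs \<circ> s b = word cs"
      using Cons.IH Cons.prems by (meson list.set_intros(2) list.set_intros(1) subset_code(1))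
    then show ?thesis using Cons.prems
      by (intro exI[of _ "c # cs"]) (simp del: o_apply add: comp_assoc)
  qed
qed

text \<open>A nonempty such word is never reduced: dropping its last letter \<open>b\<close> changes
  the sign of the image of \<open>b\<close>, which thereby falls outside \<open>P\<close>, and the
  exchange property yields a shorter word for the same map.\<close>

lemma word_trivial:
  assumes "set bs \<subseteq> S" "\<And>b. b \<in> S \<Longrightarrow> word bs b \<in> P"
  shows "word bs = id"
  using assms
proof (induction "length bs" arbitrary: bs rule: less_induct)
  case less
  show ?case
  proof (cases bs rule: rev_cases)
    case (snoc cs b)
    then have b: "b \<in> S" "set cs \<subseteq> S" using less.prems by auto
    have "word bs b = - word cs b"
      using snoc b s_self W_linear[OF word_W[OF b(2)]] by (simp add: word_snoc linear_neg)
    then have "word cs b \<notin> P" using less.prems(2)[OF b(1)] uminus_notin by fastforce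
    then obtain ds where "set ds \<subseteq> S" "length ds < length cs" "word cs \<circ> s b = word ds"
      using exchange b by blast
    then show ?thesis using less.hyps[of ds] less.prems snoc by (auto simp: word_snoc)
  qed auto
qed

theorem W_faithful: "w \<in> W \<Longrightarrow> (\<And>b. b \<in> S \<Longrightarrow> w b \<in> P) \<Longrightarrow> w = id"
  using W_word word_trivial by metis

section \<open>Inversion sets\<close>

definition inversions :: "('v \<Rightarrow> 'v) \<Rightarrow> 'v set" where
  "inversions w = {x \<in> P. - inv w x \<in> P}"

text \<open>If \<open>inv w (w' b)\<close> were not positive for a simple \<open>b\<close>, then
  \<open>w' b\<close> or its negative, whichever is positive, would be an inversion of exactly one
  of \<open>w\<close> and \<open>w'\<close>. Hence \<open>inv w \<circ> w'\<close> keeps simple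
  roots positive and is the identity by \<open>W_faithful\<close>.\<close>

lemma inversions_inj:
  assumes "w \<in> W" "w' \<in> W" "inversions w = inversions w'"
  shows "w = w'"
proof -
  have lin: "linear (inv w)" "linear (inv w')" using assms W_inv W_linear by auto
  have "inv w (w' b) \<in> P" if "b \<in> S" for b
  proof (rule ccontr)
    assume n: "inv w (w' b) \<notin> P"
    have b: "b \<in> P" using that simple_pos by auto
    have R: "w' b \<in> R" using W_R[OF assms(2)] b by (simp add: R_def)
    then have "- inv w (w' b) \<in> P" using n W_R[OF W_inv[OF assms(1)] R] R_cases by blast
    then have "w' b \<in> inversions w" if "w' b \<in> P" using that by (simp add: inversions_def)
    moreover have "w' b \<notin> inversions w'" using assms(2) uminus_notin[OF b] by (simp add: inversions_def)
    ultimately have "w' b \<notin> P" using assms(3) by blast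
    then have neg: "- w' b \<in> P" using R_cases[OF R] by blast
    then have "- w' b \<in> inversions w'" using b assms(2) by (simp add: inversions_def linear_neg[OF lin(2)])
    then have "- w' b \<in> inversions w" using assms(3) by blast
    then have "inv w (w' b) \<in> P" by (simp add: inversions_def linear_neg[OF lin(1)])
    then show False using n by simp
  qed
  then have "inv w \<circ> w' = id"
    using W_faithful[OF gen_group_comp[OF W_inv[OF assms(1)] assms(2)]] by auto
  then show ?thesis using W_inv_right[OF assms(1)] by (metis comp_apply ext id_apply)
qed

text \<open>Away from \<open>b\<close> the reflection merely permutes positive roots;
  \<open>b\<close> itself changes sign and so switches between inversion and non-inversion.\<close>

lemma inversions_s:
  assumes "b \<in> S" "w \<in> W"
  shows "inversions (s b \<circ> w) - {b} = s b ` (inversions w - {b})"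
    and "b \<in> inversions (s b \<circ> w) \<longleftrightarrow> b \<notin> inversions w"
proof -
  have "inv (s b \<circ> w) = inv w \<circ> inv (s b)"
    using o_inv_distrib W_bij[OF assms(2)] W_bij[OF gen_group_base, of "s b"] assms(1) by blast
  moreover have "inv (s b) = s b" using s_s assms(1) by (simp add: inv_unique_comp)
  ultimately have inv: "inv (s b \<circ> w) x = inv w (s b x)" for x by simp
  have lin: "linear (inv w)" using W_inv W_linear assms by auto
  have b: "b \<in> P" using simple_pos assms by auto
  have self: "s b b = - b" using s_self assms by auto
  have inv_b: "s b x \<noteq> b" if "x \<in> P" for x
    using that s_invol[OF assms(1), of x] self uminus_notin[OF b] by metis
  show "inversions (s b \<circ> w) - {b} = s b ` (inversions w - {b})"
  proof (intro equalityI subsetI)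
    fix x assume x: "x \<in> inversions (s b \<circ> w) - {b}"
    then have "s b x \<in> inversions w - {b}"
      using inv s_perm[OF assms(1), of x] inv_b by (auto simp: inversions_def)
    then show "x \<in> s b ` (inversions w - {b})" using s_invol[OF assms(1), of x]
      by (metis imageI)
  next
    fix x assume "x \<in> s b ` (inversions w - {b})"
    then show "x \<in> inversions (s b \<circ> w) - {b}"
      using inv s_perm[OF assms(1)] inv_b s_invol[OF assms(1)] by (auto simp: inversions_def)
  qed
  have "inv w b \<in> R" using W_R[OF W_inv[OF assms(2)]] b by (auto simp: R_def)
  then show "b \<in> inversions (s b \<circ> w) \<longleftrightarrow> b \<notin> inversions w"
    using b inv self R_cases uminus_notin by (auto simp: inversions_def linear_neg[OF lin])
qed

lemma finite_inversions: "w \<in> W \<Longrightarrow> finite (inversions w)"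
proof (induction rule: W_induct)
  case id
  have "inversions id = {}" using uminus_notin by (auto simp: inversions_def)
  then show ?case by (metis finite.emptyI)
next
  case (comp b w)
  then have "finite (inversions (s b \<circ> w) - {b})" using inversions_s(1)[of b w] by simp
  then show ?case by (metis finite_Diff_insert finite.emptyI Diff_empty)
qed

lemma W_image_pos: "w \<in> W \<Longrightarrow> x \<in> P \<Longrightarrow> w x \<notin> P \<Longrightarrow> - w x \<in> P"
  using W_R[of w x] R_cases[of "w x"] by (auto simp: R_def)

end

text \<open>\<open>I\<close> plays the role of the positive imaginary roots.\<close>

locale affine_reflection_system = reflection_system +
  fixes I :: "'a set"
  assumes s_imag: "b \<in> S \<Longrightarrow> x \<in> I \<Longrightarrow> s b x = x"
    and ht_ge_1: "x \<in> P \<union> I \<Longrightarrow> ht x \<ge> 1"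
    and disjoint: "P \<inter> I = {}"
    and decompose: "P \<noteq> {} \<Longrightarrow> x \<in> P \<union> I \<Longrightarrow> x \<notin> S \<Longrightarrow> \<exists>y\<in>P \<union> I. \<exists>z\<in>P \<union> I. x = y + z"
begin

text \<open>Closure is tested among real and imaginary roots together although \<open>B\<close> is
  real. In particular no two members of \<open>B\<close> have an imaginary sum, and the imaginary
  roots take part in the clause on the complement.\<close>

definition biconvex_real :: "'a set \<Rightarrow> bool" where
  "biconvex_real B \<longleftrightarrow> B \<subseteq> P \<and>
     (\<forall>x\<in>B. \<forall>y\<in>B. x + y \<in> P \<union> I \<longrightarrow> x + y \<in> B) \<and>
     (\<forall>x\<in>P \<union> I - B. \<forall>y\<in>P \<union> I - B. x + y \<notin> B)"

lemma biconvex_realI: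
  assumes "B \<subseteq> P" "\<And>x y. x \<in> B \<Longrightarrow> y \<in> B \<Longrightarrow> x + y \<in> P \<union> I \<Longrightarrow> x + y \<in> B"
    and "\<And>x y. x \<in> P \<union> I - B \<Longrightarrow> y \<in> P \<union> I - B \<Longrightarrow> x + y \<in> B \<Longrightarrow> False"
  shows "biconvex_real B"
  unfolding biconvex_real_def by (intro conjI ballI impI notI) (fact assms(1) | erule (2) assms)+

text \<open>If \<open>B\<close> missed all simple roots, induction on the height would empty it: a
  non-simple root splits into two summands, of smaller height because heights are at least 1, and
  both lie in the complement, which is closed.\<close>

lemma contains_simple:
  assumes "biconvex_real B" "B \<noteq> {}"
  shows "B \<inter> S \<noteq> {}"
proof
  assume S: "B \<inter> S = {}"
  have P: "P \<noteq> {}" using assms by (auto simp: biconvex_real_def)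
  have "x \<notin> B" if "x \<in> P \<union> I" "ht x \<le> real n" for n x
    using that
  proof (induction n arbitrary: x)
    case 0
    then show ?case using ht_ge_1[of x] by auto
  next
    case (Suc n)
    show ?case
    proof (cases "x \<in> S")
      case False
      then obtain y z where yz: "y \<in> P \<union> I" "z \<in> P \<union> I" "x = y + z"
        using decompose[OF P] Suc by blast
      have "ht y \<le> real n" "ht z \<le> real n"
        using ht_ge_1[OF yz(1)] ht_ge_1[OF yz(2)] Suc.prems yz(3) linear_add[OF ht_linear, of y z] by auto
      then have "y \<notin> B" "z \<notin> B" using Suc.IH yz by auto
      then show ?thesis using assms yz unfolding biconvex_real_def by blast
    qed (use S in auto)
  qed
  moreover have "\<exists>n. ht x \<le> real n" for x using real_arch_simple by blast
  moreover obtain x where "x \<in> B" "x \<in> P" using assms by (auto simp: biconvex_real_def)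
  ultimately show False by blast
qed

lemma s_closed: "b \<in> S \<Longrightarrow> x \<in> P \<union> I \<Longrightarrow> x \<noteq> b \<Longrightarrow> s b x \<in> P \<union> I"
  using s_perm s_imag by fastforce

lemma uminus_notin_all: "x \<in> P \<union> I \<Longrightarrow> - x \<notin> P \<union> I"
  using ht_ge_1[of x] ht_ge_1[of "- x"] linear_neg[OF ht_linear, of x] by fastforce

text \<open>The reflection is an additive bijection of the positive roots other than
  \<open>b\<close>, so closure transfers except for sums involving \<open>b\<close>. These are
  settled by the height, or by adding \<open>b\<close>, which lies in \<open>B\<close>.\<close>

lemma biconvex_real_reflect:
  assumes "biconvex_real B" "b \<in> B" "b \<in> S"
  shows "biconvex_real (s b ` (B - {b}))"
proof -
  note lin = s_linear[OF assms(3)]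
  note invol = s_invol[OF assms(3)]
  note self = s_self[OF assms(3)]
  have B: "B \<subseteq> P" using assms(1) by (simp add: biconvex_real_def)
  have mem: "x \<in> s b ` (B - {b}) \<longleftrightarrow> s b x \<in> B - {b}" for x
    using invol by (metis (no_types, opaque_lifting) image_iff)
  have b: "b \<in> P" "- b \<notin> P \<union> I" using simple_pos assms uminus_notin_all[of b] by auto
  have nb: "s b x \<noteq> b" if "x \<in> P \<union> I" for x
    using that invol[of x] self b(2) by metis
  show ?thesis
  proof (rule biconvex_realI)
    show "s b ` (B - {b}) \<subseteq> P" using B s_perm[OF assms(3)] by auto
    show "x + y \<in> s b ` (B - {b})"
      if "x \<in> s b ` (B - {b})" "y \<in> s b ` (B - {b})" "x + y \<in> P \<union> I" for x y
    proof -
      have xy: "s b x \<in> B" "s b y \<in> B" using that mem by auto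
      have sum: "s b (x + y) = s b x + s b y" using lin by (simp add: linear_add)
      \<comment> \<open>Otherwise the positive roots \<open>s b x\<close> and \<open>s b y\<close>
        would add up to \<open>- b\<close>.\<close>
      have "x + y \<noteq> b"
      proof
        assume "x + y = b"
        then have "- b = s b x + s b y" using sum self by simp
        then have "- ht b = ht (s b x) + ht (s b y)"
          by (metis ht_linear linear_add linear_neg)
        moreover have "s b x \<in> P" "s b y \<in> P" using xy B by auto
        ultimately show False using ht_pos[of "s b x"] ht_pos[of "s b y"] ht_pos[OF b(1)] by auto
      qed
      then have "s b (x + y) \<in> P \<union> I" using s_closed[OF assms(3) that(3)] by simp
      then have "s b (x + y) \<in> B" using sum xy assms(1) unfolding biconvex_real_def by auto
      then show ?thesis using mem nb[OF that(3)] by auto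
    qed
    show False
      if x: "x \<in> P \<union> I - s b ` (B - {b})" and y: "y \<in> P \<union> I - s b ` (B - {b})"
        and xy: "x + y \<in> s b ` (B - {b})" for x y
    proof -
      have sxy: "s b x + s b y \<in> B - {b}" using xy mem lin by (simp add: linear_add)
      \<comment> \<open>A summand \<open>b\<close> is reflected to \<open>- b\<close>; adding back
        \<open>b\<close>, a member of \<open>B\<close>, would put \<open>s b y\<close> into
        \<open>B\<close>. The subcase \<open>y = b\<close> would put twice \<open>- b\<close> into
        \<open>B\<close>.\<close>
      have simple: False if "x = b" "y \<in> P \<union> I - s b ` (B - {b})" "s b x + s b y \<in> B - {b}" for x y
      proof (cases "y = b")
        case True
        then have "- ht b + - ht b > 0"
          using that self B ht_pos[of "- b + - b"] linear_diff[OF ht_linear, of "- b" b]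
            linear_neg[OF ht_linear, of b] by auto
        then show False using ht_pos b by fastforce
      next
        case False
        then have s: "s b y \<in> P \<union> I" using s_closed[OF assms(3)] that by auto
        have "b + (s b x + s b y) = s b y" using that(1) self by simp
        then have "s b y \<in> B" using that(3) assms(1,2) s unfolding biconvex_real_def by (metis DiffD1)
        then show False using that(2) mem nb[of y] by auto
      qed
      show False
      proof (cases "x = b \<or> y = b")
        case True
        then show False using simple[of x y] simple[of y x] x y sxy by (auto simp: add.commute)
      next
        case False
        then have "s b x \<in> P \<union> I - B" "s b y \<in> P \<union> I - B"
          using x y mem nb s_closed[OF assms(3)] by auto
        then show False using sxy assms(1) unfolding biconvex_real_def by blast
      qed
    qed
  qed
qed

theorem finite_biconvex_inversions:
  assumes "finite B" "biconvex_real B"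
  shows "\<exists>w\<in>W. B = inversions w"
  using assms
proof (induction "card B" arbitrary: B rule: less_induct)
  case less
  show ?case
  proof (cases "B = {}")
    case True
    then show ?thesis using gen_id uminus_notin
      by (intro bexI[of _ id]) (auto simp: inversions_def)
  next
    case False
    then obtain b where b: "b \<in> B" "b \<in> S" using contains_simple less.prems by blast
    let ?B = "s b ` (B - {b})"
    have B: "B \<subseteq> P" using less.prems by (simp add: biconvex_real_def)
    have "card ?B < card B"
      using less.prems b by (meson card_Diff1_less card_image_le finite_Diff le_less_trans)
    then obtain w where w: "w \<in> W" "?B = inversions w"
      using less.hyps biconvex_real_reflect b less.prems by blast
    \<comment> \<open>Ensures that \<open>s b \<circ> w\<close> gains the inversion \<open>b\<close>
      instead of losing it.\<close>
    have nb: "b \<notin> ?B"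
    proof
      assume "b \<in> ?B"
      then obtain x where x: "x \<in> B" "b = s b x" by blast
      then have "x = - b" using s_invol[OF b(2)] s_self[OF b(2)] by metis
      then show False using B b x(1) uminus_notin by auto
    qed
    have "s b ` ?B = B - {b}" using s_invol[OF b(2)] by (auto simp: image_image)
    then have "inversions (s b \<circ> w) = B"
      using inversions_s[OF b(2) w(1)] nb w(2) b(1) by auto
    moreover have "s b \<circ> w \<in> W" using w(1) b(2) by (simp add: gen_mult)
    ultimately show ?thesis by blast
  qed
qed

text \<open>After applying \<open>inv w\<close>, inversions have negative height, and all other
  positive roots, the fixed imaginary ones included, have positive height. Both closure conditions
  become sign rules for sums.\<close>

lemma biconvex_real_inversions:
  assumes "w \<in> W"
  shows "biconvex_real (inversions w)"
proof -
  have lin: "linear (inv w)" using W_linear W_inv assms by blast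
  have imag: "v x = x" if "v \<in> W" "x \<in> I" for v x
    using that by (induction rule: W_induct) (auto simp: s_imag)
  have sum: "x + y \<in> P" if "x \<in> P" "y \<in> P" "x + y \<in> R" for x y
    using R_cases[OF that(3)] ht_pos[OF that(1)] ht_pos[OF that(2)] ht_pos[of "- (x + y)"]
      linear_neg[OF ht_linear, of "x + y"] linear_add[OF ht_linear, of x y] by auto
  \<comment> \<open>The imaginary sum would be fixed by \<open>inv w\<close> and yet acquire
    negative height.\<close>
  have real: "x + y \<notin> I" if "x \<in> inversions w" "y \<in> inversions w" for x y
  proof
    assume "x + y \<in> I"
    then have "inv w x + inv w y = x + y"
      using imag[OF W_inv[OF assms]] linear_add[OF lin] by metis
    then have "ht (- inv w x) + ht (- inv w y) = - (ht x + ht y)"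
      using linear_neg[OF ht_linear] linear_add[OF ht_linear] by (metis add.commute minus_add)
    then show False using that ht_pos[of x] ht_pos[of y] ht_pos[of "- inv w x"] ht_pos[of "- inv w y"]
      by (auto simp: inversions_def)
  qed
  show ?thesis
  proof (rule biconvex_realI)
    show "inversions w \<subseteq> P" by (auto simp: inversions_def)
    show "x + y \<in> inversions w"
      if "x \<in> inversions w" "y \<in> inversions w" "x + y \<in> P \<union> I" for x y
    proof -
      have p: "x + y \<in> P" using that real by auto
      then have "- inv w (x + y) \<in> R" using W_R[OF W_inv[OF assms], of "x + y"] uminus_R by (simp add: R_def)
      moreover have "- inv w (x + y) = - inv w x + - inv w y" using linear_add[OF lin] by simp
      ultimately show ?thesis using sum[of "- inv w x" "- inv w y"] that p by (auto simp: inversions_def)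
    qed
    show False
      if x: "x \<in> P \<union> I - inversions w" and y: "y \<in> P \<union> I - inversions w" and xy: "x + y \<in> inversions w" for x y
    proof -
      have pos: "ht (inv w z) > 0" if "z \<in> P \<union> I - inversions w" for z
      proof (cases "z \<in> I")
        case True
        then show ?thesis using imag[OF W_inv[OF assms] True] ht_ge_1[of z] by auto
      next
        case False
        then have "inv w z \<in> P" using that W_image_pos[OF W_inv[OF assms]] by (auto simp: inversions_def)
        then show ?thesis by (rule ht_pos)
      qed
      have "ht (- inv w (x + y)) > 0" using xy ht_pos by (simp add: inversions_def)
      moreover have "ht (- inv w (x + y)) = - (ht (inv w x) + ht (inv w y))"
        using linear_neg[OF ht_linear] linear_add[OF ht_linear] linear_add[OF lin] by metis
      ultimately show False using pos[OF x] pos[OF y] by simp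
    qed
  qed
qed

end

text \<open>Off-diagonal entries come in equal pairs. This supplies the parity in
  \<open>even_form\<close>.\<close>

lemma even_sum_symmetric:
  fixes M :: "'i \<Rightarrow> 'i \<Rightarrow> int"
  assumes "finite I" "\<And>i j. i \<in> I \<Longrightarrow> j \<in> I \<Longrightarrow> M i j = M j i" "\<And>i. i \<in> I \<Longrightarrow> even (M i i)"
  shows "even (\<Sum>i\<in>I. \<Sum>j\<in>I. M i j)"
  using assms
proof (induction I rule: finite_induct)
  case (insert a I)
  have "(\<Sum>i\<in>I. M i a) = (\<Sum>j\<in>I. M a j)"
    using insert.prems(1) by (intro sum.cong) auto
  then have "(\<Sum>i\<in>insert a I. \<Sum>j\<in>insert a I. M i j)
      = M a a + 2 * (\<Sum>j\<in>I. M a j) + (\<Sum>i\<in>I. \<Sum>j\<in>I. M i j)"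
    using insert.hyps by (simp add: sum.distrib)
  then show ?case using insert by simp
qed simp

context untwisted_affine
begin

section \<open>The invariant form\<close>

text \<open>Affine symmetrizability and definiteness of the finite part come with two unrelated
  symmetrizers. Across a nonzero matrix entry their ratio is unchanged, so on the indecomposable
  finite part they are proportional, and the affine one inherits definiteness there.\<close>

lemma ex_symmetrizer:
  "\<exists>d. symmetrizer {0..l} A d \<and> (\<forall>x::nat \<Rightarrow> real. (\<exists>i\<in>{1..l}. x i \<noteq> 0) \<longrightarrow>
     (\<Sum>i\<in>{1..l}. \<Sum>j\<in>{1..l}. d i * of_int (A i j) * x i * x j) > 0)"
proof -
  obtain d where d: "symmetrizer {0..l} A d"
    using affine_symmetrizable by (auto simp: symmetrizable_def)
  obtain e where e: "symmetrizer {1..l} A e"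
    and pos: "\<And>x::nat \<Rightarrow> real. (\<exists>i\<in>{1..l}. x i \<noteq> 0) \<Longrightarrow>
        (\<Sum>i\<in>{1..l}. \<Sum>j\<in>{1..l}. e i * of_int (A i j) * x i * x j) > 0"
    using fin_type by (auto simp: cartan_matrix_finite_type_def)
  define c where "c = d 1 / e 1"
  define D where "D = {i\<in>{1..l}. d i = c * e i}"
  have pos1: "d i > 0" "e i > 0" if "i \<in> {1..l}" for i
    using d e that by (auto simp: symmetrizer_def)
  have one: "1 \<in> {1..l}" using l_pos by simp
  have c: "c > 0" using pos1[OF one] by (simp add: c_def)
  have "D = {1..l}"
  proof (rule ccontr)
    assume "D \<noteq> {1..l}"
    moreover have "1 \<in> D" using pos1[OF one] one by (simp add: D_def c_def)
    ultimately have "D \<noteq> {} \<and> D \<subset> {1..l}" by (auto simp: D_def)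
    then obtain i j where ij: "i \<in> D" "j \<in> {1..l} - D" "A i j \<noteq> 0"
      using fin_indecomposable unfolding indecomposable_def by blast
    have i: "i \<in> {1..l}" and j: "j \<in> {1..l}" using ij by (auto simp: D_def)
    have "d i * of_int (A i j) = d j * of_int (A j i)" "e i * of_int (A i j) = e j * of_int (A j i)"
      using d e i j by (auto simp: symmetrizer_def)
    moreover have "d i = c * e i" using ij by (simp add: D_def)
    ultimately have "d j * of_int (A j i) = c * e j * of_int (A j i)"
      by (metis mult.assoc)
    moreover have "A j i \<noteq> 0"
      using ij gcm i j by (cases "i = j") (auto simp: gen_cartan_matrix_def)
    ultimately show False using ij by (auto simp: D_def)
  qed
  then have eq: "d i = c * e i" if "i \<in> {1..l}" for i using that unfolding D_def by blast
  have "(\<Sum>i\<in>{1..l}. \<Sum>j\<in>{1..l}. d i * of_int (A i j) * x i * x j) > 0"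
    if "\<exists>i\<in>{1..l}. x i \<noteq> 0" for x :: "nat \<Rightarrow> real"
  proof -
    have "(\<Sum>i\<in>{1..l}. \<Sum>j\<in>{1..l}. d i * of_int (A i j) * x i * x j)
      = c * (\<Sum>i\<in>{1..l}. \<Sum>j\<in>{1..l}. e i * of_int (A i j) * x i * x j)"
      unfolding sum_distrib_left by (intro sum.cong refl) (simp add: eq)
    then show ?thesis using c pos[OF that] by simp
  qed
  then show ?thesis using d by blast
qed

definition d :: "nat \<Rightarrow> real" where
  "d = (SOME d. symmetrizer {0..l} A d \<and> (\<forall>x::nat \<Rightarrow> real. (\<exists>i\<in>{1..l}. x i \<noteq> 0) \<longrightarrow>
     (\<Sum>i\<in>{1..l}. \<Sum>j\<in>{1..l}. d i * of_int (A i j) * x i * x j) > 0))"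

lemma d_pos: "i \<le> l \<Longrightarrow> d i > 0"
  and d_sym: "i \<le> l \<Longrightarrow> j \<le> l \<Longrightarrow> d i * of_int (A i j) = d j * of_int (A j i)"
  and d_posdef: "\<exists>i\<in>{1..l}. x i \<noteq> 0 \<Longrightarrow>
     (\<Sum>i\<in>{1..l}. \<Sum>j\<in>{1..l}. d i * of_int (A i j) * x i * x j) > (0::real)"
  using someI_ex[OF ex_symmetrizer, folded d_def] by (auto simp: symmetrizer_def)

lemma A_diag: "i \<le> l \<Longrightarrow> A i i = 2"
  and A_nonpos: "i \<le> l \<Longrightarrow> j \<le> l \<Longrightarrow> i \<noteq> j \<Longrightarrow> A i j \<le> 0"
  and A_zero: "i \<le> l \<Longrightarrow> j \<le> l \<Longrightarrow> A i j = 0 \<longleftrightarrow> A j i = 0"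
  using gcm by (auto simp: gen_cartan_matrix_def) (metis atLeastAtMost_iff le0)+

text \<open>A linear extension of the coordinate with respect to \<open>\<alpha> i\<close>; its values outside the span of
  the simple roots play no role.\<close>

definition coef :: "nat \<Rightarrow> 'v \<Rightarrow> real" where
  "coef i = (SOME g. linear g \<and> (\<forall>j\<in>{0..l}. g (\<alpha> j) = (if j = i then 1 else 0)))"

lemma coef: "linear (coef i) \<and> (\<forall>j\<in>{0..l}. coef i (\<alpha> j) = (if j = i then 1 else 0))"
proof -
  define f :: "'v \<Rightarrow> real" where "f x = (if inv_into {0..l} \<alpha> x = i then 1 else 0)" for x
  obtain g where g: "linear g" "\<forall>x\<in>\<alpha> ` {0..l}. g x = f x"
    using linear_independent_extend[OF roots_independent(2), of f] by blast
  have "g (\<alpha> j) = (if j = i then 1 else 0)" if "j \<in> {0..l}" for j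
  proof -
    have "g (\<alpha> j) = f (\<alpha> j)" using g(2) that by blast
    then show ?thesis unfolding f_def inv_into_f_f[OF roots_independent(1) that] .
  qed
  with g(1) have "\<exists>g. linear g \<and> (\<forall>j\<in>{0..l}. g (\<alpha> j) = (if j = i then 1 else 0 :: real))"
    by blast
  then show ?thesis unfolding coef_def by (rule someI_ex)
qed

lemma coef_linear: "linear (coef i)"
  and coef_\<alpha>: "j \<le> l \<Longrightarrow> coef i (\<alpha> j) = (if j = i then 1 else 0)"
  using coef by auto

lemmas coef_simps [simp] = linear_add[OF coef_linear] linear_diff[OF coef_linear]
  linear_neg[OF coef_linear] linear_cmul[OF coef_linear] linear_0[OF coef_linear] coef_\<alpha>

text \<open>The space has dimension \<open>l + 2\<close>, so this is a hyperplane. The form is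
  symmetric on it but need not be beyond.\<close>

abbreviation U :: "'v set" where "U \<equiv> span (\<alpha> ` {0..l})"

lemma \<alpha>_U: "i \<le> l \<Longrightarrow> \<alpha> i \<in> U"
  by (auto intro: span_base)

lemma U_expand:
  assumes "x \<in> U" shows "(\<Sum>i\<in>{0..l}. coef i x *\<^sub>R \<alpha> i) = x"
proof -
  have "linear (\<lambda>x. \<Sum>i\<in>{0..l}. coef i x *\<^sub>R \<alpha> i)"
    by (intro linear_compose_sum ballI linear_scaleR_left linear_compose[OF coef_linear, unfolded o_def])
  moreover have "(\<Sum>i\<in>{0..l}. coef i (\<alpha> j) *\<^sub>R \<alpha> i) = \<alpha> j" if "j \<le> l" for j
  proof -
    have "(\<Sum>i\<in>{0..l}. coef i (\<alpha> j) *\<^sub>R \<alpha> i) = (\<Sum>i\<in>{0..l}. if i = j then \<alpha> j else 0)"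
      using that by (intro sum.cong) auto
    then show ?thesis using that by simp
  qed
  ultimately have "(\<Sum>i\<in>{0..l}. coef i x *\<^sub>R \<alpha> i) = id x"
    by (intro linear_eq_on_span[OF _ linear_id _ assms]) (auto simp del: coef_simps)
  then show ?thesis by simp
qed

lemma U_eqI: "x \<in> U \<Longrightarrow> y \<in> U \<Longrightarrow> (\<And>i. i \<le> l \<Longrightarrow> coef i x = coef i y) \<Longrightarrow> x = y"
  using U_expand[of x] U_expand[of y] by (metis (no_types, lifting) atLeastAtMost_iff sum.cong)

lemma coef_sum: "(\<And>j. j \<in> S \<Longrightarrow> j \<le> l) \<Longrightarrow> finite S \<Longrightarrow> coef i (\<Sum>j\<in>S. c j *\<^sub>R \<alpha> j) = (if i \<in> S then c i else 0)"
  by (simp add: linear_sum[OF coef_linear] sum.delta' if_distrib cong: if_cong)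

lemma sum_U: "(\<And>j. j \<in> S \<Longrightarrow> j \<le> l) \<Longrightarrow> (\<Sum>j\<in>S. c j *\<^sub>R \<alpha> j) \<in> U"
  by (intro span_sum span_scale \<alpha>_U)

lemma Qplus_iff:
  assumes "K \<subseteq> {0..l}"
  shows "x \<in> Qplus K \<longleftrightarrow> x \<in> U \<and> (\<forall>i\<le>l. coef i x \<in> \<int> \<and> coef i x \<ge> 0 \<and> (i \<notin> K \<longrightarrow> coef i x = 0))"
proof
  have K: "finite K" using assms finite_subset by blast
  assume "x \<in> Qplus K"
  then obtain n :: "nat \<Rightarrow> nat" where x: "x = (\<Sum>j\<in>K. of_nat (n j) *\<^sub>R \<alpha> j)"
    unfolding Qplus_def by blast
  have "coef i x = (if i \<in> K then of_nat (n i) else 0)" for i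
    unfolding x using K assms by (intro coef_sum) auto
  moreover have "x \<in> U" unfolding x using assms by (intro sum_U) auto
  ultimately show "x \<in> U \<and> (\<forall>i\<le>l. coef i x \<in> \<int> \<and> coef i x \<ge> 0 \<and> (i \<notin> K \<longrightarrow> coef i x = 0))"
    by auto
next
  assume x: "x \<in> U \<and> (\<forall>i\<le>l. coef i x \<in> \<int> \<and> coef i x \<ge> 0 \<and> (i \<notin> K \<longrightarrow> coef i x = 0))"
  have "of_nat (nat \<lfloor>coef i x\<rfloor>) = coef i x" if "i \<le> l" for i
    using x that by (metis Ints_cases floor_of_int of_int_0_le_iff of_nat_nat of_int_of_nat_eq)
  then have "x = (\<Sum>i\<in>{0..l}. of_nat (nat \<lfloor>coef i x\<rfloor>) *\<^sub>R \<alpha> i)"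
    using U_expand[of x] x by simp
  also have "\<dots> = (\<Sum>i\<in>K. of_nat (nat \<lfloor>coef i x\<rfloor>) *\<^sub>R \<alpha> i)"
    using assms x by (intro sum.mono_neutral_right) auto
  finally show "x \<in> Qplus K" unfolding Qplus_def
    by (intro CollectI exI[of _ "\<lambda>i. nat \<lfloor>coef i x\<rfloor>"] conjI TrueI)
qed

text \<open>The invariant form, encoded asymmetrically: coordinates on the left, coroots on the
  right. As \<open>form (\<alpha> i)\<close> is a multiple of the coroot everywhere,
  \<open>refl (\<alpha> i)\<close> agrees with the simple reflection on the whole space and not just
  on \<open>U\<close>.\<close>

definition form :: "'v \<Rightarrow> 'v \<Rightarrow> real" where
  "form x v = (\<Sum>i\<in>{0..l}. d i * coef i x * \<alpha>v i v)"

lemma form_add_left [simp]: "form (x + y) v = form x v + form y v"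
  and form_diff_left [simp]: "form (x - y) v = form x v - form y v"
  and form_minus_left [simp]: "form (- x) v = - form x v"
  and form_scale_left [simp]: "form (c *\<^sub>R x) v = c * form x v"
  and form_zero_left [simp]: "form 0 v = 0"
  by (simp_all add: form_def algebra_simps sum.distrib sum_subtractf sum_negf sum_distrib_left)

lemma form_linear_right: "linear (form x)"
proof -
  have "linear (\<lambda>v. d i * coef i x * \<alpha>v i v)" if "i \<in> {0..l}" for i
    using linear_compose_scale_right[OF coroots_linear[OF that], of "d i * coef i x"] by simp
  then show ?thesis unfolding form_def by (intro linear_compose_sum) auto
qed

lemmas form_right [simp] = linear_add[OF form_linear_right] linear_diff[OF form_linear_right]
  linear_neg[OF form_linear_right] linear_cmul[OF form_linear_right] linear_0[OF form_linear_right]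

lemma form_\<alpha>: "i \<le> l \<Longrightarrow> form (\<alpha> i) v = d i * \<alpha>v i v"
proof -
  assume i: "i \<le> l"
  have "form (\<alpha> i) v = (\<Sum>j\<in>{0..l}. if j = i then d i * \<alpha>v i v else 0)"
    unfolding form_def using i by (intro sum.cong) auto
  then show ?thesis using i by simp
qed

lemma form_\<alpha>_\<alpha>: "i \<le> l \<Longrightarrow> j \<le> l \<Longrightarrow> form (\<alpha> i) (\<alpha> j) = d i * of_int (A i j)"
  by (simp add: form_\<alpha> pairing)

lemma form_expand: "y \<in> U \<Longrightarrow> form x y = (\<Sum>i\<in>{0..l}. coef i y * form x (\<alpha> i))"
  using U_expand[of y] linear_sum[OF form_linear_right, of x "\<lambda>i. coef i y *\<^sub>R \<alpha> i" "{0..l}"] by simp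

lemma form_expand_left: "form x v = (\<Sum>i\<in>{0..l}. coef i x * form (\<alpha> i) v)"
  unfolding form_def[of x] by (auto simp: form_\<alpha> intro!: sum.cong)

lemma form_sym: "x \<in> U \<Longrightarrow> y \<in> U \<Longrightarrow> form x y = form y x"
proof -
  assume x: "x \<in> U" and y: "y \<in> U"
  have "form x (\<alpha> i) = form (\<alpha> i) x" if "i \<le> l" for i
    unfolding form_expand[OF x] using that
    by (subst form_expand_left) (auto simp: form_\<alpha>_\<alpha> d_sym intro!: sum.cong)
  then show ?thesis unfolding form_expand[OF y] by (subst form_expand_left) (auto intro!: sum.cong)
qed

lemma form_delta_right [simp]: "form x delta = 0"
  by (simp add: form_def delta_null)

lemma form_pos:
  assumes "x \<in> U" "coef 0 x = 0" "x \<noteq> 0"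
  shows "form x x > 0"
proof -
  have "\<exists>i\<le>l. coef i x \<noteq> 0" using U_eqI[OF assms(1) span_zero] assms(3) by auto
  then have ex: "\<exists>i\<in>{1..l}. coef i x \<noteq> 0" using assms(2)
    by (metis atLeastAtMost_iff less_one not_le)
  have "form x x = (\<Sum>i\<in>{0..l}. \<Sum>j\<in>{0..l}. coef i x * coef j x * form (\<alpha> i) (\<alpha> j))"
    by (subst form_expand_left) (simp add: form_expand[OF assms(1), of "\<alpha> _"] sum_distrib_left mult_ac)
  also have "{0..l} = insert 0 {1..l}" by auto
  also have "(\<Sum>i\<in>insert 0 {1..l}. \<Sum>j\<in>insert 0 {1..l}. coef i x * coef j x * form (\<alpha> i) (\<alpha> j))
    = (\<Sum>i\<in>{1..l}. \<Sum>j\<in>{1..l}. coef i x * coef j x * form (\<alpha> i) (\<alpha> j))"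
    using assms(2) by simp
  also have "\<dots> = (\<Sum>i\<in>{1..l}. \<Sum>j\<in>{1..l}. d i * of_int (A i j) * coef i x * coef j x)"
    by (intro sum.cong refl) (auto simp: form_\<alpha>_\<alpha>)
  finally show ?thesis using d_posdef[OF ex] by simp
qed

text \<open>A closed formula to work with in place of the definite description
  \<open>reflection\<close>; \<open>reflection_eq\<close> identifies the two on Weyl conjugates of
  simple roots.\<close>

definition refl :: "'v \<Rightarrow> 'v \<Rightarrow> 'v" where
  "refl b v = v - (2 * form b v / form b b) *\<^sub>R b"

lemma refl_linear: "linear (refl b)"
  by (rule linearI) (simp_all add: refl_def algebra_simps add_divide_distrib)

lemmas refl_simps = linear_add[OF refl_linear] linear_diff[OF refl_linear]
  linear_neg[OF refl_linear] linear_cmul[OF refl_linear]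

lemma refl_\<alpha>: "i \<le> l \<Longrightarrow> refl (\<alpha> i) = simple_reflection i"
  using d_pos[of i] A_diag[of i] by (auto simp: fun_eq_iff refl_def simple_reflection_def form_\<alpha> pairing)

lemma refl_self: "form b b \<noteq> 0 \<Longrightarrow> refl b b = - b"
  by (simp add: refl_def scaleR_2)

lemma refl_refl: "form b b \<noteq> 0 \<Longrightarrow> refl b (refl b v) = v"
  using refl_self[of b] by (simp add: refl_def[of b v] refl_simps refl_def)

lemma refl_U: "b \<in> U \<Longrightarrow> x \<in> U \<Longrightarrow> refl b x \<in> U"
  by (simp add: refl_def span_diff span_scale)

lemma refl_delta: "refl b delta = delta"
  by (simp add: refl_def)

lemma form_refl:
  assumes "b \<in> U" "x \<in> U" "form b b \<noteq> 0"
  shows "form (refl b x) (refl b v) = form x v"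
  using assms form_sym[of b x] by (simp add: refl_def field_simps)

text \<open>The second argument of the form is unrestricted, which makes
  \<open>isometry_conj\<close> an identity of maps and not only of their restrictions to
  \<open>U\<close>.\<close>

definition isometry :: "('v \<Rightarrow> 'v) \<Rightarrow> bool" where
  "isometry g \<longleftrightarrow> linear g \<and> (\<forall>x\<in>U. g x \<in> U \<and> (\<forall>v. form (g x) (g v) = form x v))"

lemma isometryD:
  assumes "isometry g"
  shows "linear g" "x \<in> U \<Longrightarrow> g x \<in> U" "x \<in> U \<Longrightarrow> form (g x) (g v) = form x v"
  using assms by (auto simp: isometry_def)

lemma isometry_id: "isometry id" and isometry_comp: "isometry g \<Longrightarrow> isometry h \<Longrightarrow> isometry (g \<circ> h)"
  by (auto simp: isometry_def linear_id intro: linear_compose)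

lemma isometry_refl: "b \<in> U \<Longrightarrow> form b b \<noteq> 0 \<Longrightarrow> isometry (refl b)"
  by (simp add: isometry_def refl_linear refl_U form_refl)

lemma isometry_gen_group:
  assumes "g \<in> gen_group (refl ` S)" "\<forall>b\<in>S. b \<in> U \<and> form b b \<noteq> 0"
  shows "isometry g"
proof -
  have "\<forall>g\<in>refl ` S. g \<circ> g = id" using assms(2) refl_refl by (auto simp: fun_eq_iff)
  with assms(1) show ?thesis
  proof (induction rule: gen_group_involutions_induct)
    case id
    show ?case by (rule isometry_id)
  next
    case (comp g w)
    then show ?case using assms(2) isometry_refl by (intro isometry_comp) auto
  qed
qed

lemma isometry_conj: "isometry g \<Longrightarrow> b \<in> U \<Longrightarrow> g \<circ> refl b = refl (g b) \<circ> g"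
  by (auto simp: fun_eq_iff refl_def isometryD linear_diff linear_cmul)

lemma simple_refl_image: "K \<subseteq> {0..l} \<Longrightarrow> simple_reflection ` K = refl ` \<alpha> ` K"
  unfolding image_image by (intro image_cong refl) (auto simp: refl_\<alpha>)

lemma \<alpha>_nondegenerate: "i \<le> l \<Longrightarrow> \<alpha> i \<in> U \<and> form (\<alpha> i) (\<alpha> i) \<noteq> 0"
  using d_pos[of i] A_diag[of i] by (simp add: \<alpha>_U form_\<alpha>_\<alpha>)

lemma weyl_group_eq: "weyl_group = gen_group (refl ` \<alpha> ` {0..l})"
  by (simp add: weyl_group_def simple_refl_image)

lemma isometry_weyl: "w \<in> weyl_group \<Longrightarrow> isometry w"
  unfolding weyl_group_eq by (erule isometry_gen_group) (auto simp: \<alpha>_nondegenerate)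

lemma involutions_refl: "\<forall>b\<in>S. form b b \<noteq> 0 \<Longrightarrow> \<forall>g\<in>refl ` S. g \<circ> g = id"
  using refl_refl by (auto simp: fun_eq_iff)

text \<open>Every candidate \<open>v \<circ> simple_reflection j \<circ> inv v\<close> is the
  formula reflection in \<open>v (\<alpha> j)\<close>. It depends on the root only, so the definite
  description is determined.\<close>

lemma reflection_eq:
  assumes "w \<in> weyl_group" "i \<le> l"
  shows "reflection (w (\<alpha> i)) = refl (w (\<alpha> i))"
proof -
  have *: "v \<circ> simple_reflection j \<circ> inv v = refl (v (\<alpha> j))" if "v \<in> weyl_group" "j \<le> l" for v j
  proof -
    have "bij v" using that(1) unfolding weyl_group_eq
      by (rule gen_group_bij) (rule involutions_refl, auto simp: \<alpha>_nondegenerate)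
    then have "v \<circ> inv v = id" by (auto simp: fun_eq_iff bij_is_surj surj_f_inv_f)
    moreover have "v \<circ> simple_reflection j = refl (v (\<alpha> j)) \<circ> v"
      using isometry_conj[OF isometry_weyl[OF that(1)] \<alpha>_U[OF that(2)]] by (simp add: refl_\<alpha> that)
    ultimately show ?thesis by (simp add: comp_assoc)
  qed
  show ?thesis unfolding reflection_def
  proof (rule the_equality)
    show "\<exists>v\<in>weyl_group. \<exists>j\<in>{0..l}. v (\<alpha> j) = w (\<alpha> i) \<and>
        refl (w (\<alpha> i)) = v \<circ> simple_reflection j \<circ> inv v"
      using assms *[OF assms] by (intro bexI[of _ w] bexI[of _ i]) auto
  qed (use * in auto)
qed

section \<open>Finite root systems\<close>

lemma fin_weyl_eq: "K \<subseteq> {1..l} \<Longrightarrow> fin_weyl K = gen_group (refl ` \<alpha> ` K)"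
  unfolding fin_weyl_def by (subst simple_refl_image) auto

lemma fin_involutions: "K \<subseteq> {1..l} \<Longrightarrow> \<forall>g\<in>refl ` \<alpha> ` K. g \<circ> g = id"
  by (rule involutions_refl) (auto simp: subset_iff dest: \<alpha>_nondegenerate)

lemma fin_weyl_induct [consumes 2, case_names id comp]:
  assumes "w \<in> fin_weyl K" "K \<subseteq> {1..l}" "Q id"
    and "\<And>k w. k \<in> K \<Longrightarrow> w \<in> fin_weyl K \<Longrightarrow> Q w \<Longrightarrow> Q (refl (\<alpha> k) \<circ> w)"
  shows "Q w"
  using assms(1) fin_involutions[OF assms(2)] unfolding fin_weyl_eq[OF assms(2)]
proof (induction rule: gen_group_involutions_induct)
  case (comp g w)
  then show ?case using assms(4) fin_weyl_eq[OF assms(2)] by blast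
qed (rule assms(3))

context
  fixes K :: "nat set"
  assumes K: "K \<subseteq> {1..l}"
begin

lemma K_le: "k \<in> K \<Longrightarrow> k \<le> l" and K_pos: "k \<in> K \<Longrightarrow> k \<noteq> 0"
  using K by auto

lemma finite_K: "finite K"
  using K finite_subset by blast

lemma fin_weyl_simple: "k \<in> K \<Longrightarrow> refl (\<alpha> k) \<in> fin_weyl K"
  unfolding fin_weyl_eq[OF K] by (auto intro: gen_group_base)

lemma fin_weyl_id: "id \<in> fin_weyl K"
  unfolding fin_weyl_def by (rule gen_id)

lemma fin_weyl_comp: "v \<in> fin_weyl K \<Longrightarrow> w \<in> fin_weyl K \<Longrightarrow> v \<circ> w \<in> fin_weyl K"
  unfolding fin_weyl_def by (rule gen_group_comp)

lemma fin_weyl_inv: "w \<in> fin_weyl K \<Longrightarrow> inv w \<in> fin_weyl K"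
  using gen_group_inv fin_involutions[OF K] unfolding fin_weyl_eq[OF K] by blast

lemma fin_weyl_bij: "w \<in> fin_weyl K \<Longrightarrow> bij w"
  using gen_group_bij fin_involutions[OF K] unfolding fin_weyl_eq[OF K] by blast

lemma fin_weyl_inv_left: "w \<in> fin_weyl K \<Longrightarrow> inv w (w x) = x"
  and fin_weyl_inv_right: "w \<in> fin_weyl K \<Longrightarrow> w (inv w x) = x"
  using fin_weyl_bij by (simp_all add: bij_is_inj bij_is_surj surj_f_inv_f)

lemma fin_weyl_isometry: "w \<in> fin_weyl K \<Longrightarrow> isometry w"
  unfolding fin_weyl_eq[OF K] by (erule isometry_gen_group) (auto simp: \<alpha>_nondegenerate K_le)

lemma fin_weyl_linear: "w \<in> fin_weyl K \<Longrightarrow> linear w"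
  using fin_weyl_isometry isometryD(1) by blast

lemma fin_weyl_delta: assumes "w \<in> fin_weyl K" shows "w delta = delta"
  using assms K by (induction rule: fin_weyl_induct) (auto simp: refl_delta)

lemma fin_roots_simple: "k \<in> K \<Longrightarrow> \<alpha> k \<in> fin_roots K"
  unfolding fin_roots_def using fin_weyl_id by (metis (mono_tags, lifting) id_apply mem_Collect_eq)

lemma fin_weyl_roots: "w \<in> fin_weyl K \<Longrightarrow> x \<in> fin_roots K \<Longrightarrow> w x \<in> fin_roots K"
proof -
  assume w: "w \<in> fin_weyl K" and "x \<in> fin_roots K"
  then obtain v k where "v \<in> fin_weyl K" "k \<in> K" "x = v (\<alpha> k)" unfolding fin_roots_def by blast
  then have "w \<circ> v \<in> fin_weyl K" "w x = (w \<circ> v) (\<alpha> k)" using fin_weyl_comp w by auto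
  with \<open>k \<in> K\<close> show ?thesis unfolding fin_roots_def by blast
qed

lemma fin_roots_induct [consumes 1, case_names simple refl]:
  assumes "x \<in> fin_roots K" "\<And>k. k \<in> K \<Longrightarrow> Q (\<alpha> k)"
    and "\<And>k x. k \<in> K \<Longrightarrow> x \<in> fin_roots K \<Longrightarrow> Q x \<Longrightarrow> Q (refl (\<alpha> k) x)"
  shows "Q x"
proof -
  obtain w k where w: "w \<in> fin_weyl K" and k: "k \<in> K" "x = w (\<alpha> k)"
    using assms(1) unfolding fin_roots_def by blast
  have "Q (w (\<alpha> k))" using w K
  proof (induction rule: fin_weyl_induct)
    case id
    then show ?case using assms(2) k by simp
  next
    case (comp j w)
    then show ?case using assms(3) fin_weyl_roots fin_roots_simple k by simp
  qed
  then show ?thesis using k by simp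
qed

lemma fin_roots_uminus: "x \<in> fin_roots K \<Longrightarrow> - x \<in> fin_roots K"
proof -
  assume "x \<in> fin_roots K"
  then obtain w k where w: "w \<in> fin_weyl K" and k: "k \<in> K" "x = w (\<alpha> k)"
    unfolding fin_roots_def by blast
  have "- x = w (refl (\<alpha> k) (\<alpha> k))"
    using k refl_self[of "\<alpha> k"] \<alpha>_nondegenerate K_le linear_neg[OF fin_weyl_linear[OF w]] by simp
  then show ?thesis using fin_weyl_roots w k fin_weyl_simple fin_roots_simple by simp
qed

lemma \<alpha>v_expand: "x \<in> U \<Longrightarrow> i \<le> l \<Longrightarrow> \<alpha>v i x = (\<Sum>j\<in>{0..l}. coef j x * of_int (A i j))"
proof -
  assume x: "x \<in> U" and i: "i \<le> l"
  then have lin: "linear (\<alpha>v i)" using coroots_linear by simp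
  have "\<alpha>v i x = \<alpha>v i (\<Sum>j\<in>{0..l}. coef j x *\<^sub>R \<alpha> j)" using U_expand[OF x] by simp
  also have "\<dots> = (\<Sum>j\<in>{0..l}. coef j x * of_int (A i j))"
    unfolding linear_sum[OF lin] using i by (intro sum.cong) (auto simp: linear_cmul[OF lin] pairing)
  finally show ?thesis .
qed

text \<open>The last clause says that the coroot of \<open>x\<close> is an integral combination of simple coroots.\<close>

lemma fin_roots_integral:
  assumes "x \<in> fin_roots K"
  shows "x \<in> U \<and> form x x > 0 \<and> (\<forall>i\<le>l. coef i x \<in> \<int> \<and> (i \<notin> K \<longrightarrow> coef i x = 0) \<and>
    2 * d i * coef i x / form x x \<in> \<int>)"
  using assms
proof (induction rule: fin_roots_induct)
  case (simple k)
  then show ?case using K_le[OF simple] d_pos[of k] A_diag[of k] by (auto simp: \<alpha>_U form_\<alpha>_\<alpha>)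
next
  case (refl k x)
  have k: "k \<le> l" "\<alpha> k \<in> U" "form (\<alpha> k) (\<alpha> k) \<noteq> 0" using K_le[OF refl(1)] \<alpha>_nondegenerate by auto
  have x: "x \<in> U" and pos: "form x x > 0" using refl by auto
  define y where "y = refl (\<alpha> k) x"
  have y: "y = x - \<alpha>v k x *\<^sub>R \<alpha> k" unfolding y_def by (simp add: k refl_\<alpha> simple_reflection_def)
  have form: "form y y = form x x" unfolding y_def using form_refl k x by blast
  have int: "\<alpha>v k x \<in> \<int>" unfolding \<alpha>v_expand[OF x k(1)] using refl by (intro Ints_sum Ints_mult) auto
  \<comment> \<open>The coroot of \<open>x\<close> changes by its pairing with
    \<open>\<alpha> k\<close>; expanded along the simple coroots, this is an integral combination of
    the entries \<open>A i k\<close>.\<close>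
  have "2 * d k * \<alpha>v k x / form x x = 2 * form x (\<alpha> k) / form x x"
    using form_sym[OF x k(2)] form_\<alpha>[OF k(1)] by simp
  also have "\<dots> = (\<Sum>i\<in>{0..l}. 2 * d i * coef i x / form x x * of_int (A i k))"
    using k by (subst (1) form_expand_left) (simp add: sum_divide_distrib sum_distrib_left form_\<alpha>_\<alpha> mult_ac)
  also have "\<dots> \<in> \<int>" using refl by (intro Ints_sum Ints_mult) auto
  finally have int': "2 * d k * \<alpha>v k x / form x x \<in> \<int>" .
  have "2 * d i * coef i y / form y y = 2 * d i * coef i x / form x x -
      (if i = k then 2 * d k * \<alpha>v k x / form x x else 0)" if "i \<le> l" for i
    unfolding form using k by (simp add: y right_diff_distrib diff_divide_distrib)
  then have "2 * d i * coef i y / form y y \<in> \<int>" if "i \<le> l" for i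
    using that refl int' by auto
  moreover have "coef i y \<in> \<int> \<and> (i \<notin> K \<longrightarrow> coef i y = 0)" if "i \<le> l" for i
    using that refl int k by (auto simp: y)
  moreover have "y \<in> U" using refl_U k x y_def by blast
  ultimately show ?case using form pos unfolding y_def by simp
qed

lemma fin_roots_U: "x \<in> fin_roots K \<Longrightarrow> x \<in> U"
  and fin_roots_form: "x \<in> fin_roots K \<Longrightarrow> form x x > 0"
  and fin_roots_coef: "x \<in> fin_roots K \<Longrightarrow> i \<le> l \<Longrightarrow> coef i x \<in> \<int>"
  and fin_roots_support: "x \<in> fin_roots K \<Longrightarrow> i \<le> l \<Longrightarrow> i \<notin> K \<Longrightarrow> coef i x = 0"
  and fin_roots_cocoef: "x \<in> fin_roots K \<Longrightarrow> i \<le> l \<Longrightarrow> 2 * d i * coef i x / form x x \<in> \<int>"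
  using fin_roots_integral by blast+

lemma fin_roots_coef_0: "x \<in> fin_roots K \<Longrightarrow> coef 0 x = 0"
  using fin_roots_support[of x 0] K_pos[of 0] by auto

lemma fin_roots_nonzero: "x \<in> fin_roots K \<Longrightarrow> x \<noteq> 0"
  using fin_roots_form by fastforce

end

text \<open>Here \<open>p\<close> gives the root coordinates of \<open>x\<close>, and
  \<open>q\<close> the coordinates of \<open>2 x / b\<close> in simple coroots. Hence
  \<open>2 form x x / b\<close> is the sum of all \<open>q i * p j * A i j\<close>, a symmetric
  array whose diagonal is even because \<open>A i i = 2\<close>. The scalar \<open>b\<close> is free
  since \<open>x\<close> will be only one part of a root of norm \<open>b\<close>.\<close>

lemma even_form:
  fixes p q :: "nat \<Rightarrow> int" and b :: real
  assumes b: "b > 0" and pq: "\<And>i. i \<le> l \<Longrightarrow> 2 * d i * p i = b * q i"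
    and x: "x = (\<Sum>i\<in>{0..l}. of_int (p i) *\<^sub>R \<alpha> i)"
  shows "\<exists>m. even m \<and> 2 * form x x = b * of_int m"
proof -
  define M where "M i j = q i * p j * A i j" for i j
  have coef: "coef i x = p i" if "i \<le> l" for i
    unfolding x using that by (subst coef_sum) auto
  have xU: "x \<in> U" unfolding x by (rule sum_U) auto
  have M: "b * M i j = 2 * d i * p i * p j * A i j" if "i \<le> l" for i j
    using pq[OF that] by (simp add: M_def)
  have "M i j = M j i" if "i \<le> l" "j \<le> l" for i j
  proof -
    have "b * M i j = 2 * p i * p j * (d i * A i j)" using M[OF that(1)] by (simp add: mult_ac)
    also have "\<dots> = b * M j i" unfolding d_sym[OF that] using M[OF that(2)] by (simp add: mult_ac)
    finally have "b * M i j = b * M j i" .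
    then show ?thesis using b by simp
  qed
  then have "even (\<Sum>i\<in>{0..l}. \<Sum>j\<in>{0..l}. M i j)"
    by (intro even_sum_symmetric) (auto simp: M_def A_diag)
  moreover have "2 * form x x = b * of_int (\<Sum>i\<in>{0..l}. \<Sum>j\<in>{0..l}. M i j)"
  proof -
    have "form x x = (\<Sum>i\<in>{0..l}. \<Sum>j\<in>{0..l}. coef i x * coef j x * form (\<alpha> i) (\<alpha> j))"
      by (subst form_expand_left) (simp add: form_expand[OF xU, of "\<alpha> _"] sum_distrib_left mult_ac)
    then have "2 * form x x = (\<Sum>i\<in>{0..l}. \<Sum>j\<in>{0..l}. 2 * (coef i x * coef j x * form (\<alpha> i) (\<alpha> j)))"
      by (simp add: sum_distrib_left)
    also have "\<dots> = (\<Sum>i\<in>{0..l}. \<Sum>j\<in>{0..l}. b * M i j)"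
      using M by (intro sum.cong refl) (simp add: coef form_\<alpha>_\<alpha> mult_ac)
    finally show ?thesis by (simp add: sum_distrib_left)
  qed
  ultimately show ?thesis by blast
qed

text \<open>Write a root as \<open>x = p - n\<close> with \<open>p\<close>, \<open>n\<close> positive of disjoint support and put
  \<open>b = (x, x)\<close>. By integrality of the coroot, \<open>2 (p, p) / b\<close> and \<open>2 (n, n) / b\<close> are even integers.
  If both are nonzero then \<open>2 = 2 (x, x) / b \<ge> 2 + 2 - 4 (p, n) / b \<ge> 4\<close>.\<close>

lemma fin_roots_sign:
  assumes K: "K \<subseteq> {1..l}" and x: "x \<in> fin_roots K"
  shows "(\<forall>i\<le>l. coef i x \<ge> 0) \<or> (\<forall>i\<le>l. coef i x \<le> 0)"
proof (rule ccontr)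
  assume mixed: "\<not> ?thesis"
  define b where "b = form x x"
  have b: "b > 0" unfolding b_def using fin_roots_form K x by blast
  define c e where "c i = \<lfloor>coef i x\<rfloor>" and "e i = \<lfloor>2 * d i * coef i x / b\<rfloor>" for i
  have c: "of_int (c i) = coef i x" if "i \<le> l" for i
    using fin_roots_coef[OF K x that] unfolding c_def by (metis Ints_cases floor_of_int)
  have e: "of_int (e i) = 2 * d i * coef i x / b" if "i \<le> l" for i
    using fin_roots_cocoef[OF K x that] unfolding e_def b_def by (metis Ints_cases floor_of_int)
  define p n where "p = (\<Sum>i\<in>{0..l}. of_int (max (c i) 0) *\<^sub>R \<alpha> i)"
    and "n = (\<Sum>i\<in>{0..l}. of_int (max (- c i) 0) *\<^sub>R \<alpha> i)"
  have coef_p: "coef i p = max (coef i x) 0" and coef_n: "coef i n = max (- coef i x) 0" if "i \<le> l" for i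
    unfolding p_def n_def using that by (subst coef_sum; simp add: c[symmetric])+
  have U: "p \<in> U" "n \<in> U" unfolding p_def n_def by (intro sum_U; simp)+
  have xpn: "x = p - n"
    using U fin_roots_U[OF K x] by (intro U_eqI) (auto simp: coef_p coef_n span_diff)
  have ce: "2 * d i * of_int (c i) = b * of_int (e i)" if "i \<le> l" for i
    using c[OF that] e[OF that] b by (simp add: field_simps)
  \<comment> \<open>Root and coroot coordinates differ by positive factors, so truncating both at
    zero is compatible and preserves the hypothesis of \<open>even_form\<close>.\<close>
  have sgn: "c i \<ge> 0 \<longleftrightarrow> e i \<ge> 0" "c i \<le> 0 \<longleftrightarrow> e i \<le> 0" if "i \<le> l" for i
  proof -
    have "of_int (c i) = b / (2 * d i) * of_int (e i)"
      using ce[OF that] d_pos[OF that] by (simp add: field_simps)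
    moreover have "b / (2 * d i) > 0" using b d_pos[OF that] by simp
    ultimately show "c i \<ge> 0 \<longleftrightarrow> e i \<ge> 0" "c i \<le> 0 \<longleftrightarrow> e i \<le> 0"
      by (metis of_int_0_le_iff zero_le_mult_iff less_le_not_le linorder_not_le)
         (metis \<open>of_int (c i) = b / (2 * d i) * of_int (e i)\<close> \<open>b / (2 * d i) > 0\<close> of_int_le_0_iff
           mult_le_0_iff less_le_not_le linorder_not_le)
  qed
  have "2 * d i * of_int (max (c i) 0) = b * of_int (max (e i) 0)"
    "2 * d i * of_int (max (- c i) 0) = b * of_int (max (- e i) 0)" if "i \<le> l" for i
    using ce[OF that] sgn[OF that] by (auto simp: max_def)
  then obtain m m' where m: "even m" "2 * form p p = b * of_int m"
    and m': "even m'" "2 * form n n = b * of_int m'"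
    using even_form[OF b _ p_def] even_form[OF b _ n_def] by meson
  have z: "coef 0 p = 0" "coef 0 n = 0" using fin_roots_coef_0[OF K x] coef_p coef_n by simp_all
  have "p \<noteq> 0"
  proof
    assume "p = 0"
    then have "coef i x \<le> 0" if "i \<le> l" for i using coef_p[OF that] by simp
    then show False using mixed by blast
  qed
  then have pp: "form p p > 0" using form_pos U z by blast
  have "n \<noteq> 0"
  proof
    assume "n = 0"
    then have "coef i x \<ge> 0" if "i \<le> l" for i using coef_n[OF that] by simp
    then show False using mixed by blast
  qed
  then have nn: "form n n > 0" using form_pos U z by blast
  have "m \<ge> 2" "m' \<ge> 2" using m m' pp nn b
    by (smt (verit) even_iff_mod_2_eq_zero mult_nonneg_nonpos of_int_le_0_iff zmod_trivial_iff)+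
  then have "2 * form p p \<ge> b * 2" "2 * form n n \<ge> b * 2" using m m' b by simp_all
  moreover have "form p n \<le> 0"
  proof -
    have "form p n = (\<Sum>i\<in>{0..l}. \<Sum>j\<in>{0..l}. coef i p * coef j n * form (\<alpha> i) (\<alpha> j))"
      by (subst form_expand_left) (simp add: form_expand[OF U(2), of "\<alpha> _"] sum_distrib_left mult_ac)
    also have "\<dots> \<le> 0"
    proof (intro sum_nonpos)
      fix i j assume "i \<in> {0..l}" "j \<in> {0..l}"
      then have ij: "i \<le> l" "j \<le> l" by auto
      show "coef i p * coef j n * form (\<alpha> i) (\<alpha> j) \<le> 0"
      proof (cases "i = j")
        case True
        then show ?thesis using coef_p[OF ij(1)] coef_n[OF ij(2)] by (simp add: max_def)
      next
        case False
        have "form (\<alpha> i) (\<alpha> j) \<le> 0"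
          using A_nonpos[OF ij False] d_pos[OF ij(1)] ij by (simp add: form_\<alpha>_\<alpha> mult_nonneg_nonpos)
        then show ?thesis using coef_p[OF ij(1)] coef_n[OF ij(2)] by (simp add: mult_nonneg_nonpos)
      qed
    qed
    finally show ?thesis .
  qed
  moreover have "b = form p p + form n n - 2 * form p n"
    using form_sym[OF U] unfolding b_def xpn by simp
  ultimately show False using b by simp
qed

section \<open>Positive roots, heights and pairs of roots in the finite case\<close>

definition fpos :: "nat set \<Rightarrow> 'v set" where
  "fpos K = {x \<in> fin_roots K. \<forall>i\<le>l. coef i x \<ge> 0}"

definition ht :: "'v \<Rightarrow> real" where
  "ht x = (\<Sum>i\<in>{0..l}. coef i x)"

lemma ht_linear: "linear ht"
  unfolding ht_def by (intro linear_compose_sum ballI coef_linear)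

lemma ht_ge_1:
  assumes "x \<in> U" "\<And>i. i \<le> l \<Longrightarrow> coef i x \<in> \<int> \<and> coef i x \<ge> 0" "x \<noteq> 0"
  shows "ht x \<ge> 1"
proof -
  obtain i where i: "i \<le> l" "coef i x \<noteq> 0"
    using U_eqI[OF assms(1) span_zero] assms(3) by auto
  then have "coef i x \<ge> 1" using assms(2)[OF i(1)] by (auto elim!: Ints_cases)
  also have "coef i x \<le> ht x" unfolding ht_def
    using i assms(2) by (intro member_le_sum) auto
  finally show ?thesis .
qed

lemma cauchy_schwarz:
  assumes "x \<in> U" "y \<in> U" "coef 0 x = 0" "coef 0 y = 0"
  shows "(form x y)\<^sup>2 \<le> form x x * form y y"
proof (cases "y = 0")
  case False
  then have y: "form y y > 0" using form_pos assms by blast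
  define z where "z = form y y *\<^sub>R x - form x y *\<^sub>R y"
  have "form z z \<ge> 0"
  proof (cases "z = 0")
    case False
    have "z \<in> U" unfolding z_def by (intro span_diff span_scale assms)
    then show ?thesis using form_pos[of z] False assms by (simp add: z_def)
  qed simp
  also have "form z z = form y y * (form x x * form y y - (form x y)\<^sup>2)"
    using form_sym[OF assms(1,2)] by (simp add: z_def power2_eq_square algebra_simps)
  finally show ?thesis using y by (simp add: zero_le_mult_iff)
qed simp

lemma fin_weyl_mono: "K \<subseteq> J \<Longrightarrow> fin_weyl K \<subseteq> fin_weyl J"
proof
  fix w assume K: "K \<subseteq> J" and w: "w \<in> fin_weyl K"
  show "w \<in> fin_weyl J" using w unfolding fin_weyl_def
  proof (induction rule: gen_group.induct)
    case (gen_mult g w)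
    then show ?case using K by (intro gen_group.gen_mult) auto
  next
    case (gen_inv g w)
    then show ?case using K by (intro gen_group.gen_inv) auto
  qed (rule gen_id)
qed

lemma fin_roots_mono: "K \<subseteq> J \<Longrightarrow> fin_roots K \<subseteq> fin_roots J"
  unfolding fin_roots_def using fin_weyl_mono by blast

context
  fixes K :: "nat set"
  assumes K: "K \<subseteq> {1..l}"
begin

lemma fpos_roots: "x \<in> fpos K \<Longrightarrow> x \<in> fin_roots K"
  and fpos_coef: "x \<in> fpos K \<Longrightarrow> i \<le> l \<Longrightarrow> coef i x \<ge> 0"
  by (auto simp: fpos_def)

lemma fpos_cases: "x \<in> fin_roots K \<Longrightarrow> x \<in> fpos K \<or> - x \<in> fpos K"
  using fin_roots_sign[OF K] fin_roots_uminus[OF K] by (auto simp: fpos_def)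

lemma fpos_Qplus: "x \<in> fin_roots K \<Longrightarrow> K \<subseteq> L \<Longrightarrow> L \<subseteq> {0..l} \<Longrightarrow> x \<in> Qplus L \<longleftrightarrow> x \<in> fpos K"
  using fin_roots_integral[OF K, of x] by (auto simp: Qplus_iff fpos_def)

lemma fpos_simple: "k \<in> K \<Longrightarrow> \<alpha> k \<in> fpos K"
  using fin_roots_simple[OF K] K by (auto simp: fpos_def)

lemma fpos_ht: "x \<in> fpos K \<Longrightarrow> ht x \<ge> 1"
  using fin_roots_integral[OF K, of x] fin_roots_nonzero[OF K, of x]
  by (intro ht_ge_1) (auto simp: fpos_def)

lemma fpos_uminus: "x \<in> fpos K \<Longrightarrow> - x \<notin> fpos K"
  using fpos_ht[of x] fpos_ht[of "- x"] linear_neg[OF ht_linear, of x] by auto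

lemma refl_fin_weyl: "x \<in> fin_roots K \<Longrightarrow> refl x \<in> fin_weyl K"
proof -
  assume "x \<in> fin_roots K"
  then obtain w k where w: "w \<in> fin_weyl K" and k: "k \<in> K" "x = w (\<alpha> k)"
    unfolding fin_roots_def by blast
  have "w \<circ> refl (\<alpha> k) = refl x \<circ> w"
    using isometry_conj[OF fin_weyl_isometry[OF K w]] \<alpha>_U[of k] K_le[OF K k(1)] k by simp
  then have "refl x = (w \<circ> refl (\<alpha> k)) \<circ> inv w"
    using fin_weyl_inv_right[OF K w] by (auto simp: fun_eq_iff)
  then show ?thesis
    using fin_weyl_comp[OF K] fin_weyl_inv[OF K] fin_weyl_simple[OF K] w k by metis
qed

lemma refl_roots: "x \<in> fin_roots K \<Longrightarrow> y \<in> fin_roots K \<Longrightarrow> refl x y \<in> fin_roots K"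
  using refl_fin_weyl fin_weyl_roots[OF K] by blast

lemma pairing_integral:
  assumes "x \<in> fin_roots K" "y \<in> fin_roots K"
  shows "2 * form x y / form x x \<in> \<int>"
proof -
  obtain w k where w: "w \<in> fin_weyl K" and k: "k \<in> K" "x = w (\<alpha> k)"
    using assms(1) unfolding fin_roots_def by blast
  let ?y = "inv w y"
  have k': "k \<le> l" "\<alpha> k \<in> U" using K_le[OF K k(1)] \<alpha>_U by auto
  have y: "?y \<in> fin_roots K" using fin_weyl_roots[OF K fin_weyl_inv[OF K w]] assms by blast
  have yU: "?y \<in> U" using fin_roots_U[OF K y] .
  note iso = isometryD(3)[OF fin_weyl_isometry[OF K w] k'(2)]
  have "form x y = form (\<alpha> k) ?y" "form x x = form (\<alpha> k) (\<alpha> k)"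
    using iso[of ?y] iso[of "\<alpha> k"] fin_weyl_inv_right[OF K w] k by simp_all
  then have "2 * form x y / form x x = \<alpha>v k ?y"
    using d_pos[OF k'(1)] k' A_diag[OF k'(1)] by (simp add: form_\<alpha> pairing)
  also have "\<dots> \<in> \<int>" unfolding \<alpha>v_expand[OF K yU k'(1)]
    using fin_roots_coef[OF K y] by (intro Ints_sum Ints_mult) auto
  finally show ?thesis .
qed

lemma roots_cauchy_schwarz:
  "x \<in> fin_roots K \<Longrightarrow> y \<in> fin_roots K \<Longrightarrow> (form x y)\<^sup>2 \<le> form x x * form y y"
  using cauchy_schwarz fin_roots_U[OF K] fin_roots_coef_0[OF K] by blast

text \<open>The product of the two Cartan integers is four times the squared cosine of the angle
  between the roots.\<close>

lemma pairing_product: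
  assumes x: "x \<in> fin_roots K" and y: "y \<in> fin_roots K"
  shows "\<exists>m n. 2 * form x y = of_int m * form x x \<and> 2 * form x y = of_int n * form y y \<and>
    0 \<le> m * n \<and> m * n \<le> (4 :: int)"
proof -
  have U: "x \<in> U" "y \<in> U" using fin_roots_U[OF K] x y by auto
  have sym: "form y x = form x y" using form_sym U by blast
  have fx: "form x x > 0" and fy: "form y y > 0" using fin_roots_form[OF K] x y by auto
  then have f: "form x x * form y y > 0" by simp
  obtain m where m: "2 * form x y / form x x = of_int m"
    using pairing_integral[OF x y] by (rule Ints_cases)
  obtain n where n: "2 * form y x / form y y = of_int n"
    using pairing_integral[OF y x] by (rule Ints_cases)
  have m': "of_int m * form x x = 2 * form x y" and n': "of_int n * form y y = 2 * form x y"
    using m n fx fy sym by (simp_all add: field_simps)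
  have "of_int (m * n) * (form x x * form y y) = (of_int m * form x x) * (of_int n * form y y)"
    by simp
  also have "\<dots> = 4 * (form x y)\<^sup>2" unfolding m' n' by (simp add: power2_eq_square)
  finally have eq: "of_int (m * n) * (form x x * form y y) = 4 * (form x y)\<^sup>2" .
  then have "of_int (m * n) * (form x x * form y y) \<ge> 0" by simp
  then have "real_of_int (m * n) \<ge> 0" using f by (simp add: zero_le_mult_iff)
  moreover have "of_int (m * n) * (form x x * form y y) \<le> 4 * (form x x * form y y)"
    unfolding eq using roots_cauchy_schwarz[OF x y] by simp
  then have "real_of_int (m * n) \<le> 4" using f by (simp only: mult_le_cancel_right)
  ultimately have "0 \<le> m * n" "m * n \<le> 4" by linarith+
  then show ?thesis using m'[symmetric] n'[symmetric] by blast
qed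

text \<open>Two positive Cartan integers with product at most 4 include a 1, unless both are 2. In
  the first case a reflection produces \<open>x - y\<close> up to sign; in the second
  \<open>x - y\<close> would have norm 0.\<close>

lemma diff_root:
  assumes x: "x \<in> fin_roots K" and y: "y \<in> fin_roots K" and pos: "form x y > 0" and "x \<noteq> y"
  shows "x - y \<in> fin_roots K"
proof -
  have U: "x \<in> U" "y \<in> U" using fin_roots_U[OF K] x y by auto
  have sym: "form y x = form x y" using form_sym U by blast
  have fx: "form x x > 0" and fy: "form y y > 0" using fin_roots_form[OF K] x y by auto
  obtain m n :: int where m: "2 * form x y = m * form x x" and n: "2 * form x y = n * form y y"
    and mn4: "m * n \<le> 4"
    using pairing_product[OF x y] by blast
  have "of_int m * form x x > 0" "of_int n * form y y > 0" using m n pos by simp_all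
  then have mn: "m > 0" "n > 0" using fx fy by (simp_all add: zero_less_mult_iff)
  have "m = 1 \<or> n = 1 \<or> (m = 2 \<and> n = 2)"
  proof (rule ccontr)
    assume c: "\<not> ?thesis"
    then have "m \<ge> 2" "n \<ge> 2" using mn by auto
    then have "m \<ge> 3 \<or> n \<ge> 3" using c by auto
    then have "m * n \<ge> 6" using \<open>m \<ge> 2\<close> \<open>n \<ge> 2\<close> mult_mono[of 3 m 2 n] mult_mono[of 2 m 3 n] by auto
    then show False using mn4 by simp
  qed
  then consider "m = 1" | "n = 1" | "m = 2" "n = 2" by blast
  then show ?thesis
  proof cases
    case 1
    then have "refl x y = - (x - y)" using m fx by (simp add: refl_def)
    then show ?thesis using refl_roots[OF x y] fin_roots_uminus[OF K] by fastforce
  next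
    case 2
    then have "refl y x = x - y" using n sym fy by (simp add: refl_def)
    then show ?thesis using refl_roots[OF y x] by simp
  next
    case 3
    then have "form (x - y) (x - y) = 0" using m n sym by simp
    moreover have "x - y \<in> U" "coef 0 (x - y) = 0"
      using U fin_roots_coef_0[OF K] x y by (simp_all add: span_diff)
    ultimately show ?thesis using form_pos[of "x - y"] assms(4) by fastforce
  qed
qed

lemma sum_root:
  assumes "x \<in> fin_roots K" "y \<in> fin_roots K" "form x y < 0" "x \<noteq> - y"
  shows "x + y \<in> fin_roots K"
  using diff_root[of x "- y"] assms fin_roots_uminus[OF K] by simp

text \<open>The pairings with the simple roots of \<open>K\<close> are integers in a bounded range,
  and they determine the root, since a difference of roots with zero pairings has norm 0.\<close>

lemma finite_fin_roots: "finite (fin_roots K)"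
proof -
  define f where "f x = (\<lambda>k\<in>K. 2 * form (\<alpha> k) x / form (\<alpha> k) (\<alpha> k))" for x
  have "f ` fin_roots K \<subseteq> (\<Pi>\<^sub>E k\<in>K. of_int ` {-4..4})"
  proof (intro subsetI PiE_I)
    fix g k assume "g \<in> f ` fin_roots K" and k: "k \<in> K"
    then obtain x where x: "x \<in> fin_roots K" "g = f x" by blast
    have a: "\<alpha> k \<in> fin_roots K" using fin_roots_simple[OF K k] .
    have f: "form (\<alpha> k) (\<alpha> k) > 0" "form x x > 0" using fin_roots_form[OF K] a x by auto
    obtain m n :: int where m: "2 * form (\<alpha> k) x = m * form (\<alpha> k) (\<alpha> k)"
      and n: "2 * form (\<alpha> k) x = n * form x x" and mn: "0 \<le> m * n" "m * n \<le> 4"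
      using pairing_product[OF a x(1)] by blast
    have "\<bar>m\<bar> \<le> 4"
    proof (cases "n = 0")
      case True
      then show ?thesis using m n f by simp
    next
      case False
      then have "\<bar>m\<bar> * 1 \<le> \<bar>m\<bar> * \<bar>n\<bar>" by (intro mult_left_mono) auto
      then show ?thesis using mn by (simp flip: abs_mult)
    qed
    then have "m \<in> {-4..4}" by auto
    then show "g k \<in> of_int ` {-4..4}" using x(2) k m f by (simp add: f_def)
  next
    fix g k assume "g \<in> f ` fin_roots K" "k \<notin> K"
    then show "g k = undefined" by (auto simp: f_def)
  qed
  moreover have "finite (\<Pi>\<^sub>E k\<in>K. of_int ` {-4..4::int} :: real set)"
    using finite_K[OF K] by (intro finite_PiE) auto
  moreover have "inj_on f (fin_roots K)"
  proof (rule inj_onI)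
    fix x y assume x: "x \<in> fin_roots K" and y: "y \<in> fin_roots K" and eq: "f x = f y"
    let ?z = "x - y"
    have z: "?z \<in> U" using fin_roots_U[OF K] x y by (simp add: span_diff)
    have "coef k ?z * form ?z (\<alpha> k) = 0" if "k \<le> l" for k
    proof (cases "k \<in> K")
      case True
      have "f x k = f y k" using eq by simp
      then have "form (\<alpha> k) ?z = 0" using True \<alpha>_nondegenerate[OF that] by (simp add: f_def)
      then show ?thesis using form_sym[OF z \<alpha>_U[OF that]] by simp
    next
      case False
      then show ?thesis using fin_roots_support[OF K] x y that by simp
    qed
    then have "form ?z ?z = 0" unfolding form_expand[OF z, of ?z] by (intro sum.neutral) auto
    then show "x = y" using form_pos[OF z] fin_roots_coef_0[OF K] x y by fastforce
  qed
  ultimately show ?thesis by (meson finite_imageD finite_subset)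
qed

text \<open>This is where reducedness enters: \<open>c \<alpha>\<^sub>k\<close> has coroot \<open>\<alpha>\<^sub>k\<^sup>\<or> / c\<close>.\<close>

lemma fpos_other_coef:
  assumes "k \<in> K" "x \<in> fpos K" "x \<noteq> \<alpha> k"
  shows "\<exists>j\<le>l. j \<noteq> k \<and> coef j x > 0"
proof (rule ccontr)
  assume "\<not> ?thesis"
  then have z: "coef j x = 0" if "j \<le> l" "j \<noteq> k" for j
    using that fpos_coef[OF assms(2)] by fastforce
  have k: "k \<le> l" using assms K by auto
  have x: "x \<in> fin_roots K" using assms fpos_roots by blast
  define c where "c = coef k x"
  have eq: "x = c *\<^sub>R \<alpha> k" using fin_roots_U[OF K x] \<alpha>_U[OF k] z
    by (intro U_eqI) (auto simp: c_def span_scale k)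
  have c: "c > 0" using fpos_coef[OF assms(2) k] fin_roots_nonzero[OF K x] eq unfolding c_def
    by (metis less_eq_real_def scale_eq_0_iff)
  have "c \<in> \<int>" using fin_roots_coef[OF K x k] by (simp add: c_def)
  then obtain m where m: "c = of_int m" by (rule Ints_cases)
  have "2 * d k * c / form x x = 1 / c"
    using c d_pos[OF k] A_diag[OF k] by (simp add: eq form_\<alpha>_\<alpha> k)
  then have "1 / c \<in> \<int>" using fin_roots_cocoef[OF K x k] by (simp add: c_def)
  then obtain n where "1 / c = of_int n" by (rule Ints_cases)
  then have "m * n = 1" using m c by (simp add: field_simps flip: of_int_mult)
  then have "m = 1" using m c by (auto simp: zmult_eq_1_iff)
  then show False using assms(3) eq m by simp
qed

lemma fpos_of_coef: "x \<in> fin_roots K \<Longrightarrow> j \<le> l \<Longrightarrow> coef j x > 0 \<Longrightarrow> x \<in> fpos K"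
  using fin_roots_sign[OF K, of x] by (fastforce simp: fpos_def)

text \<open>The reflection alters the \<open>k\<close>-th coordinate only. Another coordinate is
  positive by \<open>fpos_other_coef\<close>, and its sign decides.\<close>

lemma fpos_perm:
  assumes "k \<in> K" "x \<in> fpos K" "x \<noteq> \<alpha> k"
  shows "refl (\<alpha> k) x \<in> fpos K"
proof -
  obtain j where j: "j \<le> l" "j \<noteq> k" "coef j x > 0" using fpos_other_coef assms by blast
  have "k \<le> l" using assms K by auto
  then have "coef j (refl (\<alpha> k) x) = coef j x" using j by (simp add: refl_def)
  moreover have "refl (\<alpha> k) x \<in> fin_roots K"
    using refl_roots fin_roots_simple[OF K] assms fpos_roots by blast
  ultimately show ?thesis using j fpos_of_coef by metis
qed

lemma fin_reflection_system: "reflection_system (\<alpha> ` K) (fpos K) refl ht"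
proof (rule reflection_system.intro)
  have nz: "b \<in> U \<and> form b b \<noteq> 0" if "b \<in> \<alpha> ` K" for b
    using that \<alpha>_nondegenerate K_le[OF K] by blast
  show "g \<circ> refl b = refl b' \<circ> g"
    if "g \<in> gen_group (refl ` \<alpha> ` K)" "b \<in> \<alpha> ` K" "b' \<in> \<alpha> ` K" "g b = b'" for g b b'
    using isometry_conj[of g b] fin_weyl_isometry[OF K] fin_weyl_eq[OF K] nz that by blast
  show "refl b (refl b v) = v" "refl b b = - b" if "b \<in> \<alpha> ` K" for b v
    using nz[OF that] refl_refl refl_self by blast+
  show "refl b x \<in> fpos K" if "b \<in> \<alpha> ` K" "x \<in> fpos K" "x \<noteq> b" for b x
    using that fpos_perm by blast
  show "ht x > 0" if "x \<in> fpos K" for x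
    using fpos_ht[OF that] by simp
  show "\<alpha> ` K \<subseteq> fpos K" using fpos_simple by blast
qed (rule refl_linear ht_linear)+

text \<open>Expanding \<open>form x x > 0\<close> along the simple roots exhibits some
  \<open>k\<close> with positive coordinate and positive pairing. Then \<open>x - \<alpha> k\<close>
  is a root, and a coordinate other than the \<open>k\<close>-th keeps it positive.\<close>

lemma fpos_decompose:
  assumes "x \<in> fpos K" "x \<notin> \<alpha> ` K"
  shows "\<exists>k\<in>K. form x (\<alpha> k) > 0 \<and> x - \<alpha> k \<in> fpos K"
proof -
  have x: "x \<in> fin_roots K" "x \<in> U" using fpos_roots[OF assms(1)] fin_roots_U[OF K] by auto
  have "(\<Sum>i\<in>{0..l}. coef i x * form x (\<alpha> i)) > 0"
    using form_expand[OF x(2), of x] fin_roots_form[OF K x(1)] by simp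
  then obtain k where k: "k \<le> l" "coef k x * form x (\<alpha> k) > 0"
    using sum_nonpos[of "{0..l}" "\<lambda>i. coef i x * form x (\<alpha> i)"] by (auto simp: not_le[symmetric])
  then have kK: "k \<in> K" using fin_roots_support[OF K x(1) k(1)] by fastforce
  have pos: "form x (\<alpha> k) > 0" using k fpos_coef[OF assms(1) k(1)]
    by (metis less_eq_real_def mult_zero_left not_less_iff_gr_or_eq zero_less_mult_pos)
  have ne: "x \<noteq> \<alpha> k" using assms(2) kK by auto
  then have "x - \<alpha> k \<in> fin_roots K" using diff_root x fin_roots_simple[OF K kK] pos by blast
  moreover obtain j where "j \<le> l" "j \<noteq> k" "coef j x > 0" using fpos_other_coef[OF kK assms(1) ne] by blast
  ultimately have "x - \<alpha> k \<in> fpos K" using fpos_of_coef[of "x - \<alpha> k" j] k by simp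
  then show ?thesis using pos kK by blast
qed

lemma fpos_induct [consumes 1, case_names simple add]:
  assumes "x \<in> fpos K" and simple: "\<And>k. k \<in> K \<Longrightarrow> Q (\<alpha> k)"
    and add: "\<And>x k. x \<in> fpos K \<Longrightarrow> k \<in> K \<Longrightarrow> x + \<alpha> k \<in> fpos K \<Longrightarrow> Q x \<Longrightarrow> Q (x + \<alpha> k)"
  shows "Q x"
proof -
  have "x \<in> fpos K \<Longrightarrow> ht x \<le> real n \<Longrightarrow> Q x" for n
  proof (induction n arbitrary: x)
    case 0
    then show ?case using fpos_ht by fastforce
  next
    case (Suc n)
    show ?case
    proof (cases "x \<in> \<alpha> ` K")
      case False
      then obtain k where k: "k \<in> K" "x - \<alpha> k \<in> fpos K" using fpos_decompose Suc by blast
      have "ht (x - \<alpha> k) \<le> real n"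
        using Suc.prems fpos_ht[OF fpos_simple[OF k(1)]] by (simp add: linear_diff[OF ht_linear])
      then show ?thesis using Suc.IH[OF k(2)] add[OF k(2,1)] Suc.prems by simp
    qed (use simple in auto)
  qed
  then show ?thesis using assms(1) real_arch_simple by blast
qed

text \<open>Being a root of \<open>L\<close> means lying in a Weyl orbit, which the support alone
  does not show. Descent on the height provides it: the simple reflection chosen to lower the height
  belongs to a node in the support, so it lies in the Weyl group of \<open>L\<close>.\<close>

lemma fin_roots_of_support:
  assumes "L \<subseteq> K" "x \<in> fin_roots K" "\<And>i. i \<le> l \<Longrightarrow> i \<notin> L \<Longrightarrow> coef i x = 0"
  shows "x \<in> fin_roots L"
proof -
  have L: "L \<subseteq> {1..l}" using assms K by auto
  have *: "x \<in> fpos K \<Longrightarrow> (\<And>i. i \<le> l \<Longrightarrow> i \<notin> L \<Longrightarrow> coef i x = 0) \<Longrightarrow> ht x \<le> real n \<Longrightarrow> x \<in> fin_roots L" for n x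
  proof (induction n arbitrary: x)
    case 0
    then show ?case using fpos_ht by fastforce
  next
    case (Suc n)
    show ?case
    proof (cases "x \<in> \<alpha> ` K")
      case True
      then obtain k where k: "k \<in> K" "x = \<alpha> k" by blast
      then have "k \<in> L" using Suc.prems(2)[of k] K_le[OF K k(1)] by auto
      then show ?thesis using fin_roots_simple[OF L] k by simp
    next
      case False
      then obtain k where k: "k \<in> K" "form x (\<alpha> k) > 0" "x - \<alpha> k \<in> fpos K" using fpos_decompose Suc by blast
      have kl: "k \<le> l" using K_le[OF K k(1)] .
      have x: "x \<in> U" using fin_roots_U[OF K fpos_roots[OF Suc.prems(1)]] .
      have "coef k x > 0" using fpos_coef[OF k(3) kl] kl by simp
      then have kL: "k \<in> L" using Suc.prems(2)[OF kl] by force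
      have a: "\<alpha> k \<in> fin_roots L" using fin_roots_simple[OF L kL] .
      let ?y = "refl (\<alpha> k) x"
      define c where "c = 2 * form (\<alpha> k) x / form (\<alpha> k) (\<alpha> k)"
      have y: "?y = x - c *\<^sub>R \<alpha> k" by (simp add: refl_def c_def)
      have "c > 0" using k form_sym[OF x \<alpha>_U[OF kl]] fin_roots_form[OF L a] by (simp add: c_def)
      moreover have "c \<in> \<int>" unfolding c_def
        using pairing_integral fin_roots_simple[OF K k(1)] fpos_roots[OF Suc.prems(1)] by blast
      ultimately have c: "c \<ge> 1" by (auto elim!: Ints_cases)
      have hk: "ht (\<alpha> k) \<ge> 1" using fpos_ht fpos_simple k(1) by blast
      have "ht ?y = ht x - c * ht (\<alpha> k)" by (simp add: y linear_diff[OF ht_linear] linear_cmul[OF ht_linear])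
      moreover have "c * ht (\<alpha> k) \<ge> 1" using c hk mult_mono[of 1 c 1 "ht (\<alpha> k)"] by simp
      ultimately have "ht ?y \<le> real n" using Suc.prems by simp
      moreover have "?y \<in> fpos K" using fpos_perm k(1) Suc.prems(1) False by blast
      moreover have "coef i ?y = 0" if "i \<le> l" "i \<notin> L" for i
        using Suc.prems(2)[OF that] kL kl that by (auto simp: y)
      ultimately have "?y \<in> fin_roots L" using Suc.IH by blast
      then have "refl (\<alpha> k) ?y \<in> fin_roots L" using fin_weyl_simple[OF L kL] fin_weyl_roots[OF L] by blast
      then show ?thesis using refl_refl \<alpha>_nondegenerate[OF kl] by simp
    qed
  qed
  obtain n m where nm: "ht x \<le> real n" "ht (- x) \<le> real m" using real_arch_simple by blast
  from fpos_cases[OF assms(2)] show ?thesis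
  proof
    assume "- x \<in> fpos K"
    then have "- x \<in> fin_roots L" using *[of "- x" m] nm assms(3) by simp
    then show ?thesis using fin_roots_uminus[OF L] by fastforce
  qed (use *[of x n] nm assms(3) in simp)
qed

end

section \<open>Highest roots and irreducible components\<close>

lemma diff_Qplus_iff:
  assumes C: "C \<subseteq> {1..l}" and "x \<in> fin_roots C" "y \<in> fin_roots C"
  shows "x - y \<in> Qplus C \<longleftrightarrow> (\<forall>i\<le>l. coef i y \<le> coef i x)"
proof -
  have "C \<subseteq> {0..l}" using C by auto
  then show ?thesis
    using fin_roots_integral[OF C assms(2)] fin_roots_integral[OF C assms(3)]
    by (auto simp: Qplus_iff span_diff)
qed

text \<open>The definite description requires existence. Roots maximal in the coordinate order are
  positive and dominant, and connectedness of the diagram gives them full support. So two of them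
  pair positively; if distinct, their difference would be a root and they would be
  comparable.\<close>

lemma highest_root:
  assumes C: "C \<subseteq> {1..l}" and ind: "indecomposable C A"
  shows "highest_root C \<in> fin_roots C \<and> (\<forall>x\<in>fin_roots C. \<forall>i\<le>l. coef i x \<le> coef i (highest_root C))"
proof -
  define le where "le x y \<longleftrightarrow> (\<forall>i\<le>l. coef i x \<le> coef i y)" for x y
  define maximal where "maximal x \<longleftrightarrow> x \<in> fin_roots C \<and> (\<forall>y\<in>fin_roots C. le x y \<longrightarrow> y = x)" for x
  note rU = fin_roots_U[OF C]
  have antisym: "x = y" if "x \<in> fin_roots C" "y \<in> fin_roots C" "le x y" "ht y \<le> ht x" for x y
  proof -
    have "(\<Sum>i\<in>{0..l}. coef i y - coef i x) = ht y - ht x" by (simp add: ht_def sum_subtractf)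
    moreover have nn: "coef i y - coef i x \<ge> 0" if "i \<in> {0..l}" for i
      using that \<open>le x y\<close> by (simp add: le_def)
    ultimately have "(\<Sum>i\<in>{0..l}. coef i y - coef i x) = 0"
      using that(4) sum_nonneg[of "{0..l}" "\<lambda>i. coef i y - coef i x"] by fastforce
    then have "\<forall>i\<in>{0..l}. coef i y - coef i x = 0" using nn by (subst (asm) sum_nonneg_eq_0_iff) auto
    then show ?thesis using that rU by (intro U_eqI) auto
  qed
  have ex_max: "\<exists>y. maximal y \<and> le x y" if x: "x \<in> fin_roots C" for x
  proof -
    let ?S = "{y \<in> fin_roots C. le x y}"
    have fin: "finite ?S" "?S \<noteq> {}" using finite_fin_roots[OF C] x by (auto simp: le_def)
    have "Max (ht ` ?S) \<in> ht ` ?S" using fin by (intro Max_in) auto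
    then obtain y where y: "y \<in> ?S" and "Max (ht ` ?S) = ht y" by blast
    then have max: "\<forall>z\<in>?S. ht z \<le> ht y"
      using Max_ge[OF finite_imageI[OF fin(1), of ht]] by fastforce
    have "z = y" if z: "z \<in> fin_roots C" "le y z" for z
    proof -
      have "le x z" using y z(2) unfolding le_def by (force intro: order_trans)
      then have "ht z \<le> ht y" using max z by blast
      then show ?thesis using antisym[of y z] y z by auto
    qed
    then show ?thesis using y by (auto simp: maximal_def)
  qed
  have dominant: "form x (\<alpha> i) \<ge> 0" if x: "maximal x" and i: "i \<in> C" for x i
  proof (rule ccontr)
    assume neg: "\<not> form x (\<alpha> i) \<ge> 0"
    have xr: "x \<in> fin_roots C" using x by (simp add: maximal_def)
    have il: "i \<le> l" using i C by auto
    have ar: "\<alpha> i \<in> fin_roots C" using fin_roots_simple[OF C i] .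
    show False
    proof (cases "x = - \<alpha> i")
      case True
      then have "le x (\<alpha> i)" using fpos_coef[OF C fpos_simple[OF C i]] by (fastforce simp: le_def intro: order_trans)
      then have "\<alpha> i = - \<alpha> i" using x ar True by (auto simp: maximal_def)
      then have "coef i (\<alpha> i) = coef i (- \<alpha> i)" by simp
      then show False using il by simp
    next
      case False
      then have "x + \<alpha> i \<in> fin_roots C" using sum_root[OF C xr ar] neg by simp
      moreover have "le x (x + \<alpha> i)" using fpos_coef[OF C fpos_simple[OF C i]] by (simp add: le_def)
      ultimately have "x + \<alpha> i = x" using x unfolding maximal_def by blast
      then show False using fin_roots_nonzero[OF C ar] by simp
    qed
  qed
  have positive: "x \<in> fpos C" if x: "maximal x" for x
  proof (rule ccontr)
    assume "x \<notin> fpos C"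
    moreover have xr: "x \<in> fin_roots C" using x by (simp add: maximal_def)
    ultimately have m: "- x \<in> fpos C" using fpos_cases[OF C] by blast
    then have "le x (- x)" using fpos_coef[OF C m] by (fastforce simp: le_def)
    then have "- x = x" using x m fpos_roots[OF C] by (auto simp: maximal_def)
    then have "x = 0" by (metis add.right_inverse scaleR_2 scale_eq_0_iff zero_neq_numeral)
    then show False using fin_roots_nonzero[OF C xr] by simp
  qed
  \<comment> \<open>Indecomposability links the support \<open>D\<close> to a node \<open>k\<close>
    outside it. All contributions to the pairing with \<open>\<alpha> k\<close> are then nonpositive
    and one is negative, against dominance.\<close>
  have full: "coef i x > 0" if x: "maximal x" and i: "i \<in> C" for x i
  proof (rule ccontr)
    assume "\<not> coef i x > 0"
    define D where "D = {j \<in> C. coef j x > 0}"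
    have xr: "x \<in> fin_roots C" using x by (simp add: maximal_def)
    note pos = fpos_coef[OF C positive[OF x]]
    have "D \<noteq> {}"
    proof
      assume "D = {}"
      have "coef j x = 0" if "j \<le> l" for j
        using pos[OF that] fin_roots_support[OF C xr that] \<open>D = {}\<close> unfolding D_def
        by (cases "j \<in> C") force+
      then have "x = 0" using rU[OF xr] by (intro U_eqI) (auto simp: span_zero)
      then show False using fin_roots_nonzero[OF C xr] by simp
    qed
    moreover have "D \<subset> C" using i \<open>\<not> coef i x > 0\<close> by (auto simp: D_def)
    ultimately obtain j k where jk: "j \<in> D" "k \<in> C - D" "A j k \<noteq> 0"
      using ind unfolding indecomposable_def by blast
    have le: "j \<le> l" "k \<le> l" "j \<noteq> k" "coef j x > 0" using jk C by (auto simp: D_def)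
    have term_le: "coef m x * form (\<alpha> m) (\<alpha> k) \<le> 0" if "m \<le> l" for m
    proof (cases "m = k")
      case True
      then have "\<not> coef m x > 0" using jk by (auto simp: D_def)
      then have "coef m x = 0" using pos[OF that] by simp
      then show ?thesis by simp
    next
      case False
      then have "form (\<alpha> m) (\<alpha> k) \<le> 0"
        using A_nonpos[OF that le(2)] d_pos[OF that] le that by (simp add: form_\<alpha>_\<alpha> mult_nonneg_nonpos)
      then show ?thesis using pos[OF that] by (simp add: mult_nonneg_nonpos)
    qed
    have "A j k < 0" using A_nonpos[OF le(1-3)] jk(3) by simp
    then have "form (\<alpha> j) (\<alpha> k) < 0" using d_pos[OF le(1)] le by (simp add: form_\<alpha>_\<alpha> mult_pos_neg)
    then have "coef j x * form (\<alpha> j) (\<alpha> k) < 0" using le by (simp add: mult_pos_neg)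
    then have "(\<Sum>m\<in>{0..l}. coef m x * form (\<alpha> m) (\<alpha> k)) < (\<Sum>m\<in>{0..l}. 0)"
      using term_le le by (intro sum_strict_mono_ex1) auto
    then have "form x (\<alpha> k) < 0" by (subst form_expand_left) simp
    then show False using dominant[OF x, of k] jk by auto
  qed
  have unique: "x = y" if x: "maximal x" and y: "maximal y" for x y
  proof (rule ccontr)
    assume ne: "x \<noteq> y"
    have xr: "x \<in> fin_roots C" and yr: "y \<in> fin_roots C" using x y by (auto simp: maximal_def)
    have eq: "form x z = (\<Sum>i\<in>{0..l}. coef i z * form x (\<alpha> i))" if "z \<in> U" for z
      using form_expand[OF that] .
    have nn: "coef i z * form x (\<alpha> i) \<ge> 0" if "maximal z" "i \<in> {0..l}" for i z
    proof (cases "i \<in> C")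
      case True
      then show ?thesis using dominant[OF x True] fpos_coef[OF C positive[OF that(1)]] that by simp
    next
      case False
      then show ?thesis using fin_roots_support[OF C _ _ False] that by (auto simp: maximal_def)
    qed
    have "form x y \<noteq> 0"
    proof
      assume "form x y = 0"
      then have "(\<Sum>i\<in>{0..l}. coef i y * form x (\<alpha> i)) = 0"
        using eq[OF rU[OF yr]] by simp
      then have "\<forall>i\<in>{0..l}. coef i y * form x (\<alpha> i) = 0"
        using sum_nonneg_eq_0_iff[of "{0..l}" "\<lambda>i. coef i y * form x (\<alpha> i)"] nn[OF y] by blast
      then have "form x (\<alpha> i) = 0" if "i \<in> C" for i
        using full[OF y that] that C by (metis atLeastAtMost_iff le0 less_irrefl mult_eq_0_iff subsetD)
      then have "coef i x * form x (\<alpha> i) = 0" if "i \<in> {0..l}" for i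
        using fin_roots_support[OF C xr] that by (cases "i \<in> C") auto
      then have "form x x = 0" unfolding eq[OF rU[OF xr]] by (intro sum.neutral) blast
      then show False using fin_roots_form[OF C xr] by simp
    qed
    moreover have "form x y \<ge> 0" unfolding eq[OF rU[OF yr]] using nn[OF y] by (intro sum_nonneg)
    ultimately have "form x y > 0" by simp
    then have diff: "x - y \<in> fin_roots C" using diff_root[OF C xr yr] ne by simp
    from fpos_cases[OF C diff] show False
    proof
      assume "x - y \<in> fpos C"
      then have "le y x" using fpos_coef[OF C] by (fastforce simp: le_def)
      then show False using y xr ne by (auto simp: maximal_def)
    next
      assume "- (x - y) \<in> fpos C"
      then have "le x y" using fpos_coef[OF C] by (fastforce simp: le_def)
      then show False using x yr ne by (auto simp: maximal_def)
    qed
  qed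
  obtain k where "k \<in> C" using ind unfolding indecomposable_def by blast
  then obtain t where t: "maximal t" using ex_max fin_roots_simple[OF C] by blast
  then have tr: "t \<in> fin_roots C" by (simp add: maximal_def)
  have top: "le x t" if "x \<in> fin_roots C" for x
    using ex_max[OF that] unique[OF t] by blast
  have "highest_root C = t" unfolding highest_root_def
  proof (rule the_equality)
    show "t \<in> fin_roots C \<and> (\<forall>x\<in>fin_roots C. t - x \<in> Qplus C)"
      using tr top by (auto simp: diff_Qplus_iff[OF C] le_def)
  next
    fix s assume s: "s \<in> fin_roots C \<and> (\<forall>x\<in>fin_roots C. s - x \<in> Qplus C)"
    then have "le t s" using tr by (auto simp: diff_Qplus_iff[OF C] le_def)
    then show "s = t" using t s by (auto simp: maximal_def)
  qed
  then show ?thesis using tr top by (auto simp: le_def)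
qed

context
  fixes C :: "nat set"
  assumes C: "C \<subseteq> {1..l}" and ind: "indecomposable C A"
begin

lemma highest_root_mem: "highest_root C \<in> fin_roots C"
  and highest_root_coef: "x \<in> fin_roots C \<Longrightarrow> i \<le> l \<Longrightarrow> coef i x \<le> coef i (highest_root C)"
  using highest_root[OF C ind] by auto

lemma highest_root_coef_uminus: "x \<in> fin_roots C \<Longrightarrow> i \<le> l \<Longrightarrow> - coef i x \<le> coef i (highest_root C)"
  using highest_root_coef[OF fin_roots_uminus[OF C], of x i] by simp

lemma highest_root_fpos: "highest_root C \<in> fpos C"
  using highest_root_mem highest_root_coef highest_root_coef_uminus
  unfolding fpos_def by fastforce

lemma highest_root_dominant: "i \<in> C \<Longrightarrow> form (highest_root C) (\<alpha> i) \<ge> 0"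
proof (rule ccontr)
  let ?t = "highest_root C"
  assume i: "i \<in> C" and neg: "\<not> form ?t (\<alpha> i) \<ge> 0"
  have il: "i \<le> l" using i C by auto
  have ar: "\<alpha> i \<in> fin_roots C" using fin_roots_simple[OF C i] .
  have "coef i ?t \<ge> 1" using highest_root_coef[OF ar il] il by simp
  then have "?t \<noteq> - \<alpha> i" using il by auto
  then have "?t + \<alpha> i \<in> fin_roots C" using sum_root[OF C highest_root_mem ar] neg by simp
  then show False using highest_root_coef[of "?t + \<alpha> i" i] il by simp
qed

lemma highest_root_form_fpos: "x \<in> fpos C \<Longrightarrow> form (highest_root C) x \<ge> 0"
proof -
  assume x: "x \<in> fpos C"
  then have xr: "x \<in> fin_roots C" using fpos_roots[OF C] by blast
  have "coef i x * form (highest_root C) (\<alpha> i) \<ge> 0" if "i \<le> l" for i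
    using highest_root_dominant fpos_coef[OF C x that] fin_roots_support[OF C xr that]
    by (cases "i \<in> C") auto
  then show ?thesis unfolding form_expand[OF fin_roots_U[OF C xr]] by (intro sum_nonneg) auto
qed

text \<open>Let \<open>t\<close> be the highest root. For \<open>k \<le> - 2\<close> the root
  \<open>x - k t\<close> is still bounded by \<open>t\<close>, so \<open>x\<close> is at most
  \<open>(1 + k) t\<close> and thus at most \<open>- t\<close>. But \<open>- t\<close> is the lowest
  root.\<close>

lemma highest_root_pairing:
  assumes x: "x \<in> fin_roots C" and "x \<noteq> - highest_root C"
    and k: "2 * form (highest_root C) x / form (highest_root C) (highest_root C) = of_int k"
  shows "k \<ge> - 1"
proof (rule ccontr)
  let ?t = "highest_root C"
  assume "\<not> k \<ge> - 1"
  then have k2: "k \<le> - 2" by simp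
  have y: "refl ?t x = x - of_int k *\<^sub>R ?t" by (simp add: refl_def k)
  have "coef i x = coef i (- ?t)" if i: "i \<le> l" for i
  proof -
    have t0: "coef i ?t \<ge> 0" using fpos_coef[OF C highest_root_fpos i] .
    have "coef i (refl ?t x) \<le> coef i ?t"
      using highest_root_coef refl_roots[OF C highest_root_mem x] i by blast
    then have "coef i x \<le> coef i ?t + of_int k * coef i ?t" unfolding y by simp
    also have "\<dots> \<le> coef i ?t + (- 2) * coef i ?t"
      using k2 t0 by (intro add_left_mono mult_right_mono) auto
    finally show ?thesis using highest_root_coef_uminus[OF x i] by simp
  qed
  then have "x = - ?t"
    using fin_roots_U[OF C] x highest_root_mem by (intro U_eqI) (auto simp: span_neg)
  then show False using assms by simp
qed

end

lemma form_zero_of_support: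
  assumes "x \<in> U" "y \<in> U" "\<And>i j. i \<le> l \<Longrightarrow> j \<le> l \<Longrightarrow> coef i x \<noteq> 0 \<Longrightarrow> coef j y \<noteq> 0 \<Longrightarrow> A i j = 0"
  shows "form x y = 0"
proof -
  have "form x y = (\<Sum>i\<in>{0..l}. \<Sum>j\<in>{0..l}. coef i x * coef j y * form (\<alpha> i) (\<alpha> j))"
    by (subst form_expand_left) (simp add: form_expand[OF assms(2), of "\<alpha> _"] sum_distrib_left mult_ac)
  also have "\<dots> = 0" using assms(3) by (intro sum.neutral ballI) (force simp: form_\<alpha>_\<alpha>)
  finally show ?thesis .
qed

abbreviation components :: "nat set \<Rightarrow> nat set set" where
  "components \<equiv> irreducible_components A"

context
  fixes K :: "nat set"
  assumes K: "K \<subseteq> {1..l}"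
begin

lemma componentD:
  assumes "C \<in> components K"
  shows "C \<subseteq> K" "C \<subseteq> {1..l}" "indecomposable C A" "i \<in> C \<Longrightarrow> j \<in> K - C \<Longrightarrow> A i j = 0"
  using assms K by (auto simp: irreducible_components_def)

lemma isolated_orthogonal:
  assumes "C \<subseteq> K" "\<forall>i\<in>C. \<forall>j\<in>K - C. A i j = 0" "x \<in> fin_roots C" "y \<in> fin_roots (K - C)"
  shows "form x y = 0"
proof -
  have sub: "C \<subseteq> {1..l}" "K - C \<subseteq> {1..l}" using assms K by auto
  show ?thesis
    using fin_roots_U[OF sub(1)] fin_roots_U[OF sub(2)] fin_roots_support[OF sub(1) assms(3)]
      fin_roots_support[OF sub(2) assms(4)] assms(2-4)
    by (intro form_zero_of_support) blast+
qed

text \<open>The two halves are orthogonal, so simple reflections of either half fix the roots of the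
  other. Comparing one part with its complement covers all components without an induction over
  them.\<close>

lemma fin_roots_isolated:
  assumes C: "C \<subseteq> K" and iso: "\<forall>i\<in>C. \<forall>j\<in>K - C. A i j = 0" and x: "x \<in> fin_roots K"
  shows "x \<in> fin_roots C \<or> x \<in> fin_roots (K - C)"
  using x
proof (induction rule: fin_roots_induct[OF K, consumes 1, case_names simple refl])
  case (simple k)
  have sub: "C \<subseteq> {1..l}" "K - C \<subseteq> {1..l}" using C K by auto
  show ?case
    using fin_roots_simple[OF sub(1), of k] fin_roots_simple[OF sub(2), of k] simple by blast
next
  case (refl k x)
  have sub: "C \<subseteq> {1..l}" "K - C \<subseteq> {1..l}" using C K by auto
  have k: "k \<le> l" using K refl(1) by auto
  have fixed: "refl (\<alpha> k) x = x" if "form (\<alpha> k) x = 0" using that by (simp add: refl_def)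
  show ?case
  proof (cases "k \<in> C")
    case True
    then have a: "\<alpha> k \<in> fin_roots C" using fin_roots_simple[OF sub(1)] by blast
    from refl(3) show ?thesis
    proof
      assume "x \<in> fin_roots C"
      then show ?thesis using refl_roots[OF sub(1) a] by blast
    next
      assume "x \<in> fin_roots (K - C)"
      then show ?thesis using fixed isolated_orthogonal[OF C iso a] by simp
    qed
  next
    case False
    then have a: "\<alpha> k \<in> fin_roots (K - C)" using fin_roots_simple[OF sub(2)] refl(1) by blast
    from refl(3) show ?thesis
    proof
      assume "x \<in> fin_roots (K - C)"
      then show ?thesis using refl_roots[OF sub(2) a] by blast
    next
      assume xC: "x \<in> fin_roots C"
      then have "form x (\<alpha> k) = 0" using isolated_orthogonal[OF C iso _ a] by blast
      then have "form (\<alpha> k) x = 0" using form_sym[OF fin_roots_U[OF sub(1) xC] \<alpha>_U[OF k]] by simp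
      then show ?thesis using fixed xC by simp
    qed
  qed
qed

text \<open>The component is a smallest isolated subset containing \<open>j\<close>. A splitting
  without links would leave the half with \<open>j\<close> isolated and smaller; the symmetry of the
  zero pattern lets either half play the part of \<open>D\<close>.\<close>

lemma ex_component:
  assumes "j \<in> K"
  shows "\<exists>C\<in>components K. j \<in> C"
proof -
  let ?Q = "\<lambda>C. j \<in> C \<and> C \<subseteq> K \<and> (\<forall>i\<in>C. \<forall>k\<in>K - C. A i k = 0)"
  have "?Q K" using assms by auto
  from ex_has_least_nat[of ?Q, OF this, of card]
  obtain C where C: "?Q C" and min: "\<And>D. ?Q D \<Longrightarrow> card C \<le> card D" by blast
  have fin: "finite C" using C finite_K[OF K] finite_subset by blast
  have sym: "A i k = 0 \<longleftrightarrow> A k i = 0" if "i \<in> K" "k \<in> K" for i k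
    using that K_le[OF K] A_zero[of i k] by blast
  have "indecomposable C A" unfolding indecomposable_def
  proof (intro conjI allI impI)
    fix D assume D: "D \<noteq> {} \<and> D \<subset> C"
    show "\<exists>i\<in>D. \<exists>k\<in>C - D. A i k \<noteq> 0"
    proof (rule ccontr)
      assume no: "\<not> ?thesis"
      define E where "E = (if j \<in> D then D else C - D)"
      have "j \<in> C" using C by blast
      then have E: "j \<in> E" "E \<subset> C" "E = D \<or> E = C - D" using D by (auto simp: E_def)
      have "A i k = 0" if ik: "i \<in> E" "k \<in> K - E" for i k
      proof (cases "k \<in> C")
        case True
        have "i \<in> K" "k \<in> K" using True ik E(2) C by blast+
        moreover have "A i k = 0 \<or> A k i = 0" using E(3) True ik no D by blast
        ultimately show ?thesis using sym by blast
      next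
        case False
        then show ?thesis using C E ik by blast
      qed
      then have "?Q E" using E C by blast
      then have "card C \<le> card E" using min by blast
      then show False using psubset_card_mono[OF fin E(2)] by simp
    qed
  qed (use C in auto)
  then show ?thesis using C unfolding irreducible_components_def by blast
qed

end

section \<open>The affine root systems of subdiagrams\<close>

abbreviation aff :: "int \<Rightarrow> 'v \<Rightarrow> 'v" where
  "aff m e \<equiv> of_int m *\<^sub>R delta + e"

definition apos :: "nat set \<Rightarrow> 'v set" where
  "apos K = {aff m e | (m::int) e. e \<in> fin_roots K \<and> (m > 0 \<or> m = 0 \<and> e \<in> fpos K)}"

definition aimag :: "'v set" where
  "aimag = {of_int m *\<^sub>R delta | m::int. m > 0}"

abbreviation affpos :: "nat set \<Rightarrow> 'v set" where
  "affpos K \<equiv> apos K \<union> aimag"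

text \<open>One affine node per component. With several components these vectors are linearly
  dependent, since each component together with its affine node has the same \<open>delta\<close> in
  its span.\<close>

definition simples :: "nat set \<Rightarrow> 'v set" where
  "simples K = \<alpha> ` K \<union> (\<lambda>C. delta - highest_root C) ` components K"

abbreviation nodes :: "nat set" where "nodes \<equiv> {1..l}"

lemma nodes_subset: "nodes \<subseteq> nodes" by simp

lemma delta_eq: "delta = \<alpha> 0 + highest_root nodes"
  by (simp add: delta_def)

lemmas theta_mem = highest_root_mem[OF nodes_subset fin_indecomposable]
  and theta_coef_uminus = highest_root_coef_uminus[OF nodes_subset fin_indecomposable]
  and theta_fpos = highest_root_fpos[OF nodes_subset fin_indecomposable]

lemma delta_U: "delta \<in> U"
  unfolding delta_eq using fin_roots_U[OF nodes_subset theta_mem] \<alpha>_U by (intro span_add) auto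

lemma delta_coef_0: "coef 0 delta = 1"
  unfolding delta_eq using fin_roots_coef_0[OF nodes_subset theta_mem] by simp

lemma delta_coef: "0 < i \<Longrightarrow> i \<le> l \<Longrightarrow> coef i delta = coef i (highest_root nodes)"
  unfolding delta_eq by simp

lemma delta_coef_int: "i \<le> l \<Longrightarrow> coef i delta \<in> \<int>"
  unfolding delta_eq using fin_roots_coef[OF nodes_subset theta_mem] by simp

lemma delta_coef_nonneg: "i \<le> l \<Longrightarrow> coef i delta \<ge> 0"
  unfolding delta_eq using fpos_coef[OF nodes_subset theta_fpos] by simp

lemma form_delta_left: "x \<in> U \<Longrightarrow> form delta x = 0"
  using form_sym[OF delta_U] by simp

text \<open>Away from 0 the coordinates of \<open>delta\<close> are those of the highest root, so
  for \<open>m\<close> at least 1 they dominate the coordinates of every \<open>- e\<close>.\<close>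

lemma coef_affine:
  assumes K: "K \<subseteq> nodes" and e: "e \<in> fin_roots K" and m: "m > 0 \<or> m = 0 \<and> e \<in> fpos K" and i: "i \<le> l"
  shows "coef i (aff m e) \<ge> 0"
proof (cases "m = 0")
  case True
  then show ?thesis using m fpos_coef[OF K _ i] by simp
next
  case False
  then have m1: "real_of_int m \<ge> 1" using m by simp
  have et: "e \<in> fin_roots nodes" using fin_roots_mono[OF K] e by blast
  show ?thesis
  proof (cases "i = 0")
    case True
    then show ?thesis using m1 fin_roots_coef_0[OF K e] delta_coef_0 by simp
  next
    case False
    have "1 * coef i delta \<le> of_int m * coef i delta"
      using m1 delta_coef_nonneg[OF i] by (intro mult_right_mono)
    moreover have "- coef i e \<le> coef i delta" using theta_coef_uminus[OF et i] delta_coef False i by simp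
    ultimately show ?thesis by simp
  qed
qed

lemma fpos_inter:
  assumes "K \<subseteq> nodes" shows "fpos K = fin_roots K \<inter> fpos nodes"
  using fin_roots_mono[OF assms] by (auto simp: fpos_def)

lemma affine_Qplus_iff:
  assumes e: "e \<in> fin_roots nodes"
  shows "aff m e \<in> Qplus {0..l} \<longleftrightarrow> m > 0 \<or> m = 0 \<and> e \<in> fpos nodes"
proof
  note e0 = fin_roots_coef_0[OF nodes_subset e]
  assume Q: "aff m e \<in> Qplus {0..l}"
  then have "coef 0 (aff m e) \<ge> 0" by (simp add: Qplus_iff)
  then have "m \<ge> 0" using e0 delta_coef_0 by simp
  moreover have "e \<in> fpos nodes" if "m = 0" using Q that e by (auto simp: Qplus_iff fpos_def)
  ultimately show "m > 0 \<or> m = 0 \<and> e \<in> fpos nodes" by auto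
next
  assume m: "m > 0 \<or> m = 0 \<and> e \<in> fpos nodes"
  have "aff m e \<in> U"
    using delta_U fin_roots_U[OF nodes_subset e] by (intro span_add span_scale)
  moreover have "coef i (aff m e) \<in> \<int>" if "i \<le> l" for i
    using delta_coef_int[OF that] fin_roots_coef[OF nodes_subset e that] by simp
  ultimately show "aff m e \<in> Qplus {0..l}"
    using coef_affine[OF nodes_subset e m] by (simp add: Qplus_iff del: coef_simps)
qed

lemma affine_unique:
  assumes "e \<in> fin_roots nodes" "f \<in> fin_roots nodes"
    and eq: "aff m e = aff n f"
  shows "m = n" "e = f"
proof -
  have "coef 0 (aff m e) = coef 0 (aff n f)" using eq by simp
  then show "m = n" using fin_roots_coef_0[OF nodes_subset] assms(1,2) delta_coef_0 by simp
  then show "e = f" using eq by simp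
qed

lemma affine_not_imag:
  assumes e: "e \<in> fin_roots nodes"
  shows "aff m e \<noteq> of_int n *\<^sub>R delta"
proof
  assume eq: "aff m e = of_int n *\<^sub>R delta"
  then have "coef 0 (aff m e) = coef 0 (of_int n *\<^sub>R delta)" by simp
  then have "m = n" using fin_roots_coef_0[OF nodes_subset e] delta_coef_0 by simp
  then show False using eq fin_roots_nonzero[OF nodes_subset e] by simp
qed

lemma pos_imag_roots_eq: "pos_imag_roots = aimag"
proof -
  have q: "of_int m *\<^sub>R delta \<in> Qplus {0..l} \<longleftrightarrow> m \<ge> 0" for m
  proof
    assume "of_int m *\<^sub>R delta \<in> Qplus {0..l}"
    then have "coef 0 (of_int m *\<^sub>R delta) \<ge> 0" unfolding Qplus_iff[OF order.refl] by blast
    then show "m \<ge> 0" using delta_coef_0 by simp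
  next
    assume "m \<ge> 0"
    then have "coef i (of_int m *\<^sub>R delta) \<in> \<int> \<and> coef i (of_int m *\<^sub>R delta) \<ge> 0" if "i \<le> l" for i
      using delta_coef_int[OF that] delta_coef_nonneg[OF that] by simp
    then show "of_int m *\<^sub>R delta \<in> Qplus {0..l}"
      unfolding Qplus_iff[OF order.refl] using span_scale[OF delta_U] by auto
  qed
  have Q: "m \<noteq> 0 \<and> of_int m *\<^sub>R delta \<in> Qplus {0..l} \<longleftrightarrow> m > 0" for m
    unfolding q by arith
  have "pos_imag_roots = imag_roots \<inter> Qplus {0..l}"
    unfolding pos_imag_roots_def pos_roots_def roots_def by blast
  also have "\<dots> = {of_int m *\<^sub>R delta | m. m \<noteq> 0 \<and> of_int m *\<^sub>R delta \<in> Qplus {0..l}}"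
    unfolding imag_roots_def by blast
  also have "\<dots> = aimag" unfolding Q aimag_def ..
  finally show ?thesis .
qed

lemma real_pos_iff: "x \<in> pos_real_roots \<longleftrightarrow> x \<in> apos nodes"
proof -
  have "x \<in> pos_real_roots \<longleftrightarrow> x \<in> real_roots \<and> x \<in> Qplus {0..l}"
    by (auto simp: pos_real_roots_def pos_roots_def roots_def)
  also have "\<dots> \<longleftrightarrow> x \<in> apos nodes"
    unfolding real_roots_def apos_def using affine_Qplus_iff by blast
  finally show ?thesis .
qed

lemma affinize_eq:
  assumes "P \<subseteq> fin_roots nodes"
  shows "affinize P = {aff m e | (m::int) e. e \<in> P \<and> (m > 0 \<or> m = 0 \<and> e \<in> fpos nodes)}"
proof (intro equalityI subsetI)
  fix x assume "x \<in> affinize P"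
  then obtain m :: nat and e where x: "x = of_nat m *\<^sub>R delta + e" "e \<in> P" "x \<in> apos nodes"
    unfolding affinize_def using real_pos_iff by blast
  obtain n f where nf: "x = aff n f" "f \<in> fin_roots nodes" "n > 0 \<or> n = 0 \<and> f \<in> fpos nodes"
    using x(3) unfolding apos_def by blast
  have "aff (int m) e = aff n f" using x nf by simp
  then have "f = e" using affine_unique(2) x(2) nf(2) assms by blast
  then show "x \<in> {aff m e | (m::int) e. e \<in> P \<and> (m > 0 \<or> m = 0 \<and> e \<in> fpos nodes)}"
    using x nf by blast
next
  fix x assume "x \<in> {aff m e | (m::int) e. e \<in> P \<and> (m > 0 \<or> m = 0 \<and> e \<in> fpos nodes)}"
  then obtain m e where x: "x = aff m e" "e \<in> P" "m > 0 \<or> m = 0 \<and> e \<in> fpos nodes" by blast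
  then have "x \<in> apos nodes" unfolding apos_def using assms by blast
  moreover have "x = of_nat (nat m) *\<^sub>R delta + e" using x by auto
  ultimately show "x \<in> affinize P" unfolding affinize_def using real_pos_iff x(2) by blast
qed

lemma affinize_roots: "K \<subseteq> nodes \<Longrightarrow> affinize (fin_roots K) = apos K"
  using affinize_eq[of "fin_roots K"] fin_roots_mono[of K nodes] fpos_inter[of K] unfolding apos_def by blast

lemma pos_roots_sub_eq: "K \<subseteq> nodes \<Longrightarrow> pos_roots_sub K = affpos K"
  by (simp add: pos_roots_sub_def affinize_roots pos_imag_roots_eq)

lemma apos_mono: "K \<subseteq> J \<Longrightarrow> apos K \<subseteq> apos J"
  unfolding apos_def fpos_def using fin_roots_mono[of K J] by blast

lemma apos_U: "K \<subseteq> nodes \<Longrightarrow> x \<in> apos K \<Longrightarrow> x \<in> U"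
  unfolding apos_def using fin_roots_U[of K] delta_U by (auto intro!: span_add span_scale)

lemma apos_coef:
  assumes K: "K \<subseteq> nodes" and "x \<in> apos K" and i: "i \<le> l"
  shows "coef i x \<in> \<int> \<and> coef i x \<ge> 0"
proof -
  obtain m e where x: "x = aff m e" "e \<in> fin_roots K" "m > 0 \<or> m = 0 \<and> e \<in> fpos K"
    using assms(2) unfolding apos_def by blast
  then show ?thesis
    using coef_affine[OF K x(2,3) i] delta_coef_int[OF i] fin_roots_coef[OF K x(2) i] by simp
qed

lemma affine_ht_ge_1: "K \<subseteq> nodes \<Longrightarrow> x \<in> affpos K \<Longrightarrow> ht x \<ge> 1"
proof -
  assume K: "K \<subseteq> nodes" and x: "x \<in> affpos K"
  show ?thesis
  proof (cases "x \<in> aimag")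
    case True
    then obtain m :: int where m: "m > 0" "x = of_int m *\<^sub>R delta" unfolding aimag_def by blast
    have "coef 0 x \<noteq> 0" using m delta_coef_0 by simp
    then have "x \<noteq> 0" by auto
    then show ?thesis using m delta_coef_int delta_coef_nonneg delta_U
      by (intro ht_ge_1) (auto simp: span_scale)
  next
    case False
    then have x: "x \<in> apos K" using x by simp
    have "x \<noteq> 0"
    proof
      assume "x = 0"
      then obtain m e where me: "0 = aff m e" "e \<in> fin_roots K"
        using x unfolding apos_def by blast
      then show False using affine_not_imag[of e m 0] fin_roots_mono[OF K] by auto
    qed
    then show ?thesis using apos_coef[OF K x] apos_U[OF K x] by (intro ht_ge_1) auto
  qed
qed

lemma refl_affine: "refl b (aff m e) = aff m (refl b e)"
  using refl_delta by (simp add: refl_simps)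

text \<open>On \<open>U\<close> the vector \<open>\<delta>\<close> is isotropic, so the reflection in \<open>\<delta> - t\<close> differs from the one in
  \<open>t\<close> by a translation.\<close>

lemma form_delta_minus:
  assumes "t \<in> U" "x \<in> U"
  shows "form (delta - t) x = - form t x" "form (delta - t) (delta - t) = form t t"
  using form_delta_left assms by simp_all

lemma refl_delta_minus:
  assumes t: "t \<in> U" "form t t \<noteq> 0" and e: "e \<in> U" and k: "2 * form t e / form t t = of_int k"
  shows "refl (delta - t) (aff m e) = aff (m + k) (refl t e)"
proof -
  have "refl (delta - t) e = e + of_int k *\<^sub>R (delta - t)"
    unfolding refl_def form_delta_minus(1)[OF t(1) e] form_delta_minus(2)[OF t(1) t(1)]
    using k by simp
  moreover have "refl t e = e - of_int k *\<^sub>R t" using k by (simp add: refl_def)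
  ultimately show ?thesis unfolding refl_affine by (simp add: scaleR_left_distrib scaleR_right_diff_distrib)
qed

context
  fixes K :: "nat set"
  assumes K: "K \<subseteq> nodes"
begin

lemma component_highest:
  assumes "C \<in> components K"
  shows "highest_root C \<in> fpos C" "highest_root C \<in> fin_roots K" "highest_root C \<in> U"
    "form (highest_root C) (highest_root C) > 0"
proof -
  note C = componentD[OF K assms]
  show "highest_root C \<in> fpos C" using highest_root_fpos[OF C(2,3)] .
  show "highest_root C \<in> fin_roots K" using highest_root_mem[OF C(2,3)] fin_roots_mono[OF C(1)] by blast
  then show "highest_root C \<in> U" "form (highest_root C) (highest_root C) > 0"
    using fin_roots_U[OF K] fin_roots_form[OF K] by blast+
qed

lemma simples_nondegenerate: "b \<in> simples K \<Longrightarrow> b \<in> U \<and> form b b \<noteq> 0"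
  unfolding simples_def
  using \<alpha>_nondegenerate K_le[OF K] component_highest delta_U form_delta_minus(2)
  by (auto simp: span_diff less_imp_neq[symmetric])

lemma simples_apos: "simples K \<subseteq> apos K"
proof
  fix b assume "b \<in> simples K"
  then consider k where "k \<in> K" "b = \<alpha> k"
    | C where "C \<in> components K" "b = delta - highest_root C"
    unfolding simples_def by blast
  then show "b \<in> apos K"
  proof cases
    case 1
    then have "b = aff 0 (\<alpha> k)" "\<alpha> k \<in> fin_roots K" "\<alpha> k \<in> fpos K"
      using fpos_simple[OF K] fin_roots_simple[OF K] by auto
    then show ?thesis unfolding apos_def by blast
  next
    case 2
    then have "b = aff 1 (- highest_root C)" "- highest_root C \<in> fin_roots K"
      using component_highest fin_roots_uminus[OF K] by auto
    then show ?thesis unfolding apos_def using zero_less_one by blast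
  qed
qed

text \<open>The level of \<open>x = m delta + e\<close> moves by the Cartan integer \<open>k\<close>
  of \<open>e\<close> against the highest root \<open>t\<close>. Only \<open>k < 0\<close> is
  delicate: then \<open>e\<close> is a negative root of the component \<open>C\<close>, so
  \<open>m > 0\<close>, and \<open>k\<close> is -1 except for \<open>e = - t\<close>.\<close>

lemma apos_perm_delta:
  assumes C: "C \<in> components K" and x: "x \<in> apos K" "x \<noteq> delta - highest_root C"
  shows "refl (delta - highest_root C) x \<in> apos K"
proof -
  let ?t = "highest_root C"
  note c = componentD[OF K C] and t = component_highest[OF C]
  obtain m e where me: "x = aff m e" "e \<in> fin_roots K" "m > 0 \<or> m = 0 \<and> e \<in> fpos K"
    using x(1) unfolding apos_def by blast
  obtain k where k: "2 * form ?t e / form ?t ?t = of_int k"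
    using pairing_integral[OF K t(2) me(2)] by (rule Ints_cases)
  have eq: "refl (delta - ?t) x = aff (m + k) (refl ?t e)"
    unfolding me(1) using refl_delta_minus[OF t(3) _ fin_roots_U[OF K me(2)] k] t(4) by simp
  have r: "refl ?t e \<in> fin_roots K" using refl_roots[OF K t(2) me(2)] .
  have y: "refl ?t e = e - of_int k *\<^sub>R ?t" by (simp add: refl_def k)
  have "m + k > 0 \<or> m + k = 0 \<and> refl ?t e \<in> fpos K"
  proof (cases "k \<ge> 0")
    case True
    then show ?thesis using me(3) y by (cases "k = 0") auto
  next
    case False
    then have neg: "form ?t e < 0" using k t(4)
      by (metis divide_nonneg_pos linorder_not_less mult_nonneg_nonneg of_int_0_le_iff zero_le_numeral)
    have eC: "e \<in> fin_roots C"
      using fin_roots_isolated[OF K c(1) _ me(2)] c(4) isolated_orthogonal[OF K c(1) _ fpos_roots[OF c(2) t(1)], of e]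
        neg by force
    have "e \<notin> fpos C" using highest_root_form_fpos[OF c(2,3), of e] neg by auto
    then have "e \<notin> fpos K" using eC by (auto simp: fpos_def)
    then have m: "m > 0" using me(3) by simp
    show ?thesis
    proof (cases "e = - ?t")
      case True
      then have "of_int k = (- 2 :: real)" using k t(4) by simp
      then have k2: "k = - 2" by linarith
      then have "refl ?t e = ?t" using y True by (simp add: scaleR_2)
      moreover have "?t \<in> fpos K" using t(1,2) by (auto simp: fpos_def)
      \<comment> \<open>Level 1 is the excluded root \<open>delta - t\<close> itself; from level 2
        on, the drop by 2 lands at a positive root.\<close>
      moreover have "m \<noteq> 1" using x(2) me(1) True by auto
      ultimately show ?thesis using k2 m by auto
    next
      case ne: False
      then have k1: "k = - 1" using highest_root_pairing[OF c(2,3) eC ne k] False by simp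
      have "coef i (refl ?t e) \<ge> 0" if "i \<le> l" for i
        using highest_root_coef_uminus[OF c(2,3) eC that] unfolding y k1 by simp
      then have "refl ?t e \<in> fpos K" using r by (simp add: fpos_def)
      then show ?thesis using k1 m by auto
    qed
  qed
  then show ?thesis unfolding eq apos_def using r by blast
qed

lemma apos_perm:
  assumes b: "b \<in> simples K" and x: "x \<in> apos K" "x \<noteq> b"
  shows "refl b x \<in> apos K"
proof -
  consider k where "k \<in> K" "b = \<alpha> k"
    | C where "C \<in> components K" "b = delta - highest_root C"
    using b unfolding simples_def by blast
  then show ?thesis
  proof cases
    case 1
    obtain m e where me: "x = aff m e" "e \<in> fin_roots K" "m > 0 \<or> m = 0 \<and> e \<in> fpos K"
      using x(1) unfolding apos_def by blast
    have "refl b x = aff m (refl (\<alpha> k) e)" by (simp add: me(1) 1 refl_affine)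
    moreover have "refl (\<alpha> k) e \<in> fin_roots K" using refl_roots[OF K fin_roots_simple[OF K 1(1)] me(2)] .
    moreover have "refl (\<alpha> k) e \<in> fpos K" if "m = 0"
      using that me x(2) 1 fpos_perm[OF K 1(1), of e] by auto
    ultimately show ?thesis unfolding apos_def using me(3) by blast
  next
    case 2
    then show ?thesis using apos_perm_delta x by blast
  qed
qed

text \<open>The hypothesis \<open>ne\<close> provides a real root to split \<open>delta\<close>
  with: for empty \<open>K\<close> only the imaginary ray is left, in which \<open>delta\<close> is
  indecomposable. Finite roots split by \<open>fpos_decompose\<close>, and \<open>delta\<close> is
  peeled off a real root whenever a positive root remains. What is left is \<open>delta - f\<close>
  with \<open>f\<close> positive and not the highest root of its component.\<close>

lemma affine_decompose:
  assumes ne: "apos K \<noteq> {}" and x: "x \<in> affpos K" "x \<notin> simples K"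
  shows "\<exists>y\<in>affpos K. \<exists>z\<in>affpos K. x = y + z"
proof -
  have delta: "delta \<in> aimag" unfolding aimag_def by (intro CollectI exI[of _ 1]) simp
  have ap: "aff m e \<in> apos K" if "e \<in> fin_roots K" "m > 0 \<or> m = 0 \<and> e \<in> fpos K" for m e
    using that unfolding apos_def by blast
  show ?thesis
  proof (cases "x \<in> aimag")
    case True
    then obtain m :: int where m: "m > 0" "x = of_int m *\<^sub>R delta" unfolding aimag_def by blast
    obtain e where "e \<in> fin_roots K" using ne unfolding apos_def by blast
    then obtain e where e: "e \<in> fpos K" using fpos_cases[OF K] by blast
    note er = fpos_roots[OF K e]
    have "aff 0 e \<in> apos K" "aff m (- e) \<in> apos K"
      using ap[OF er, of 0] ap[OF fin_roots_uminus[OF K er], of m] e m by auto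
    moreover have "x = aff 0 e + aff m (- e)" using m by simp
    ultimately show ?thesis by blast
  next
    case False
    then obtain m e where me: "x = aff m e" "e \<in> fin_roots K" "m > 0 \<or> m = 0 \<and> e \<in> fpos K"
      using x(1) unfolding apos_def by blast
    consider "m = 0" | "m > 0" "m - 1 > 0 \<or> m - 1 = 0 \<and> e \<in> fpos K" | "m = 1" "e \<notin> fpos K"
      using me(3) by force
    then show ?thesis
    proof cases
      case 1
      then have xe: "x = e" "e \<in> fpos K" using me by auto
      moreover have "e \<notin> \<alpha> ` K" using x(2) xe unfolding simples_def by blast
      ultimately obtain k where k: "k \<in> K" "e - \<alpha> k \<in> fpos K" using fpos_decompose[OF K] by blast
      have f0: "f \<in> apos K" if "f \<in> fpos K" for f using ap[OF fpos_roots[OF K that], of 0] that by simp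
      have "x = (e - \<alpha> k) + \<alpha> k" using xe by simp
      then show ?thesis using f0[OF k(2)] f0[OF fpos_simple[OF K k(1)]] by blast
    next
      case 2
      have "aff (m - 1) e \<in> apos K" using ap[OF me(2) 2(2)] .
      moreover have "x = aff (m - 1) e + delta" by (simp add: me(1) algebra_simps)
      ultimately show ?thesis using delta by blast
    next
      case 3
      define f where "f = - e"
      have f: "f \<in> fpos K" "x = delta - f" using fpos_cases[OF K me(2)] 3 me(1) by (auto simp: f_def)
      note fr = fpos_roots[OF K f(1)]
      have sup: "\<exists>C\<in>components K. f \<in> fin_roots C"
      proof -
        have "f \<noteq> 0" using fin_roots_nonzero[OF K fr] .
        then obtain i where i: "i \<le> l" "coef i f \<noteq> 0"
          using U_eqI[OF fin_roots_U[OF K fr] span_zero] by auto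
        then have "i \<in> K" using fin_roots_support[OF K fr] by blast
        then obtain C where C: "C \<in> components K" "i \<in> C" using ex_component[OF K] by blast
        note c = componentD[OF K C(1)]
        have "f \<notin> fin_roots (K - C)" using fin_roots_support[of "K - C" f i] K i C by auto
        then show ?thesis using fin_roots_isolated[OF K c(1) _ fr] c(4) C by blast
      qed
      then obtain C where C: "C \<in> components K" and fC: "f \<in> fin_roots C" by blast
      note c = componentD[OF K C] and t = component_highest[OF C]
      let ?t = "highest_root C"
      have fpC: "f \<in> fpos C" using fC f by (auto simp: fpos_def)
      have ft: "f \<noteq> ?t" using x(2) f(2) C unfolding simples_def by blast
      \<comment> \<open>If \<open>f\<close> is not dominant, it can be raised by a simple root,
        which is split off. If it is dominant, it pairs positively with the highest root
        \<open>t\<close>, and the root \<open>t - f\<close> is split off, leaving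
        \<open>delta - t\<close>.\<close>
      show ?thesis
      proof (cases "\<exists>k\<in>C. form f (\<alpha> k) < 0")
        case True
        then obtain k where k: "k \<in> C" "form f (\<alpha> k) < 0" by blast
        have kl: "k \<le> l" using k c(2) by auto
        have a: "\<alpha> k \<in> fin_roots C" using fin_roots_simple[OF c(2) k(1)] .
        have "f \<noteq> - \<alpha> k" using fpos_coef[OF c(2) fpC kl] kl by auto
        then have "f + \<alpha> k \<in> fin_roots C" using sum_root[OF c(2) fC a k(2)] by blast
        then have "- (f + \<alpha> k) \<in> fin_roots K" using fin_roots_mono[OF c(1)] fin_roots_uminus[OF K] by blast
        then have "aff 1 (- (f + \<alpha> k)) \<in> apos K" using ap[of "- (f + \<alpha> k)" 1] by simp
        moreover have "\<alpha> k \<in> apos K" using simples_apos k c(1) unfolding simples_def by blast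
        moreover have "x = aff 1 (- (f + \<alpha> k)) + \<alpha> k" using f(2) by simp
        ultimately show ?thesis by blast
      next
        case False
        have tf: "?t - f \<in> U" using t(3) fin_roots_U[OF K fr] by (rule span_diff)
        have "coef i (?t - f) * form f (\<alpha> i) \<ge> 0" if "i \<le> l" for i
        proof (cases "i \<in> C")
          case True
          then have "form f (\<alpha> i) \<ge> 0" using False by force
          then show ?thesis using highest_root_coef[OF c(2,3) fC that] by simp
        next
          case False
          then show ?thesis
            using fin_roots_support[OF c(2) fC that] fin_roots_support[OF c(2) fpos_roots[OF c(2) t(1)] that] by simp
        qed
        then have "form f (?t - f) \<ge> 0" unfolding form_expand[OF tf] by (intro sum_nonneg) auto
        then have "form ?t f > 0" using fin_roots_form[OF K fr] form_sym[OF t(3) fin_roots_U[OF K fr]] by simp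
        then have d: "?t - f \<in> fin_roots C"
          using diff_root[OF c(2) fpos_roots[OF c(2) t(1)] fC] ft by blast
        then have "?t - f \<in> fpos C" using highest_root_coef[OF c(2,3) fC] by (simp add: fpos_def)
        then have "?t - f \<in> fpos K" using fin_roots_mono[OF c(1)] by (auto simp: fpos_def)
        then have "?t - f \<in> apos K" using ap[of "?t - f" 0] fpos_roots[OF K] by simp
        moreover have "delta - ?t \<in> apos K" using simples_apos C unfolding simples_def by blast
        moreover have "x = (delta - ?t) + (?t - f)" using f(2) by simp
        ultimately show ?thesis by blast
      qed
    qed
  qed
qed

lemma affine_system: "affine_reflection_system (simples K) (apos K) refl ht aimag"
proof (intro affine_reflection_system.intro reflection_system.intro affine_reflection_system_axioms.intro)
  show "g \<circ> refl b = refl b' \<circ> g"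
    if "g \<in> gen_group (refl ` simples K)" "b \<in> simples K" "b' \<in> simples K" "g b = b'" for g b b'
    using isometry_conj[OF isometry_gen_group[OF that(1)]] simples_nondegenerate that by blast
  show "refl b (refl b v) = v" "refl b b = - b" if "b \<in> simples K" for b v
    using simples_nondegenerate[OF that] refl_refl refl_self by blast+
  show "refl b x \<in> apos K" if "b \<in> simples K" "x \<in> apos K" "x \<noteq> b" for b x
    using that apos_perm by blast
  show "ht x > 0" if "x \<in> apos K" for x
    using affine_ht_ge_1[OF K, of x] that by simp
  show "ht x \<ge> 1" if "x \<in> affpos K" for x
    using affine_ht_ge_1[OF K that] .
  show "refl b x = x" if "x \<in> aimag" for b x
    using that refl_delta by (auto simp: aimag_def refl_simps)
  show "apos K \<inter> aimag = {}"
    using affine_not_imag fin_roots_mono[OF K] unfolding apos_def aimag_def by blast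
  show "\<exists>y\<in>affpos K. \<exists>z\<in>affpos K. x = y + z"
    if "apos K \<noteq> {}" "x \<in> affpos K" "x \<notin> simples K" for x
    using affine_decompose that by blast
qed (rule refl_linear ht_linear simples_apos)+

end

lemma nodes_component: "nodes \<in> components nodes"
  using fin_indecomposable by (simp add: irreducible_components_def)

lemma \<alpha>_simples_nodes: "i \<le> l \<Longrightarrow> \<alpha> i \<in> simples nodes"
proof (cases "i = 0")
  case True
  then have "\<alpha> i = delta - highest_root nodes" by (simp add: delta_eq)
  then show ?thesis unfolding simples_def using nodes_component by blast
qed (auto simp: simples_def)

text \<open>The definite description \<open>reflection\<close> is controlled only on Weyl conjugates
  of simple roots; this puts the roots \<open>delta - highest_root C\<close> among them. Since
  \<open>x\<close> has positive norm, some simple root pairs positively with it, and reflecting in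
  that root lowers the height by at least 1.\<close>

lemma apos_conjugate_simple:
  assumes "x \<in> apos nodes"
  shows "\<exists>w\<in>weyl_group. \<exists>i\<le>l. x = w (\<alpha> i)"
proof -
  have "x \<in> apos nodes \<Longrightarrow> ht x \<le> real n \<Longrightarrow> \<exists>w\<in>weyl_group. \<exists>i\<le>l. x = w (\<alpha> i)" for n
  proof (induction n arbitrary: x)
    case 0
    then show ?case using affine_ht_ge_1[OF nodes_subset, of x] by simp
  next
    case (Suc n)
    note xU = apos_U[OF nodes_subset Suc.prems(1)]
    note xc = apos_coef[OF nodes_subset Suc.prems(1)]
    obtain m e where me: "x = aff m e" "e \<in> fin_roots nodes"
      using Suc.prems(1) unfolding apos_def by blast
    have "form x x = form e e"
      using form_delta_left[OF fin_roots_U[OF nodes_subset me(2)]] by (simp add: me(1))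
    then have "form x x > 0" using fin_roots_form[OF nodes_subset me(2)] by simp
    then have "(\<Sum>i\<in>{0..l}. coef i x * form x (\<alpha> i)) > 0"
      using form_expand[OF xU, of x] by simp
    then obtain i where i: "i \<le> l" "coef i x * form x (\<alpha> i) > 0"
      using sum_nonpos[of "{0..l}" "\<lambda>i. coef i x * form x (\<alpha> i)"] by (auto simp: not_le[symmetric])
    have "coef i x \<ge> 0" using xc[OF i(1)] by simp
    then have pos: "form x (\<alpha> i) > 0" using i(2) by (simp add: zero_less_mult_iff)
    note ai = \<alpha>_nondegenerate[OF i(1)]
    show ?case
    proof (cases "x = \<alpha> i")
      case True
      have "id \<in> weyl_group" unfolding weyl_group_def by (rule gen_id)
      moreover have "x = id (\<alpha> i)" using True by simp
      ultimately show ?thesis using i(1) by blast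
    next
      case False
      let ?y = "refl (\<alpha> i) x"
      have y: "?y \<in> apos nodes" using apos_perm[OF nodes_subset \<alpha>_simples_nodes[OF i(1)] Suc.prems(1) False] .
      have yeq: "?y = x - \<alpha>v i x *\<^sub>R \<alpha> i" using i(1) by (simp add: refl_\<alpha> simple_reflection_def)
      have "d i * \<alpha>v i x > 0" using pos form_sym[OF xU] ai form_\<alpha>[OF i(1)] by simp
      then have "\<alpha>v i x > 0" using d_pos[OF i(1)] by (simp add: zero_less_mult_iff)
      moreover have "\<alpha>v i x \<in> \<int>" unfolding \<alpha>v_expand[OF nodes_subset xU i(1)]
        using xc by (intro Ints_sum Ints_mult) auto
      ultimately have "\<alpha>v i x \<ge> 1" by (auto elim!: Ints_cases)
      moreover have "ht (\<alpha> i) = 1" using i(1) by (simp add: ht_def)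
      ultimately have "ht ?y \<le> real n"
        using Suc.prems(2) unfolding yeq by (simp add: linear_diff[OF ht_linear] linear_cmul[OF ht_linear])
      then obtain w j where w: "w \<in> weyl_group" "j \<le> l" "?y = w (\<alpha> j)" using Suc.IH[OF y] by blast
      have "refl (\<alpha> i) \<circ> w \<in> weyl_group"
        using w(1) i(1) unfolding weyl_group_eq by (intro gen_mult) auto
      moreover have "x = (refl (\<alpha> i) \<circ> w) (\<alpha> j)"
        using refl_refl[of "\<alpha> i" x] ai w(3) by simp
      ultimately show ?thesis using w(2) by blast
    qed
  qed
  then show ?thesis using assms real_arch_simple by blast
qed

lemma aff_weyl_eq:
  assumes K: "K \<subseteq> nodes"
  shows "aff_weyl K = gen_group (refl ` simples K)"
proof -
  have "(\<Union>C\<in>components K. \<alpha> ` C \<union> {delta - highest_root C}) = simples K"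
  proof (intro equalityI subsetI)
    fix b assume "b \<in> (\<Union>C\<in>components K. \<alpha> ` C \<union> {delta - highest_root C})"
    then obtain C where C: "C \<in> components K" "b \<in> \<alpha> ` C \<or> b = delta - highest_root C"
      by blast
    then show "b \<in> simples K" using componentD(1)[OF K C(1)] unfolding simples_def by blast
  next
    fix b assume "b \<in> simples K"
    then consider k where "k \<in> K" "b = \<alpha> k"
      | C where "C \<in> components K" "b = delta - highest_root C"
      unfolding simples_def by blast
    then show "b \<in> (\<Union>C\<in>components K. \<alpha> ` C \<union> {delta - highest_root C})"
    proof cases
      case 1
      then obtain C where "C \<in> components K" "k \<in> C" using ex_component[OF K] by blast
      then show ?thesis using 1 by blast
    qed blast
  qed
  moreover have "reflection b = refl b" if "b \<in> simples K" for b
  proof -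
    have "b \<in> apos nodes" using simples_apos[OF K] apos_mono[OF K] that by blast
    then obtain w i where "w \<in> weyl_group" "i \<le> l" "b = w (\<alpha> i)" using apos_conjugate_simple by blast
    then show ?thesis using reflection_eq by simp
  qed
  then have "reflection ` simples K = refl ` simples K" by (intro image_cong) auto
  ultimately show ?thesis unfolding aff_weyl_def by simp
qed

section \<open>Parabolic subsets\<close>

context
  fixes J :: "nat set"
  assumes J: "J \<subseteq> nodes"
begin

lemma closed_contains_fpos:
  assumes closed: "\<And>x y. x \<in> T \<Longrightarrow> y \<in> T \<Longrightarrow> x + y \<in> fin_roots J \<Longrightarrow> x + y \<in> T"
    and g: "g \<in> fin_weyl J" and K: "K \<subseteq> J" and simple: "\<And>k. k \<in> K \<Longrightarrow> g (\<alpha> k) \<in> T"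
    and x: "x \<in> fpos K"
  shows "g x \<in> T"
proof -
  have K': "K \<subseteq> nodes" using K J by blast
  from x show ?thesis
  proof (induction rule: fpos_induct[OF K', consumes 1, case_names simple add])
    case (simple k)
    then show ?case by (rule assms(4))
  next
    case (add x k)
    have "x + \<alpha> k \<in> fin_roots J" using fpos_roots[OF K' add(3)] fin_roots_mono[OF K] by blast
    then have "g (x + \<alpha> k) \<in> fin_roots J" using fin_weyl_roots[OF J g] by blast
    then show ?case using closed[OF add(4) simple[OF add(2)]]
      by (simp add: linear_add[OF fin_weyl_linear[OF J g]])
  qed
qed

text \<open>Among all group elements take \<open>u\<close> with the fewest positive roots sent
  outside \<open>T\<close>. If \<open>\<alpha> j\<close> were sent outside, totality would put
  \<open>- u (\<alpha> j)\<close> into \<open>T\<close>, and composing with the reflection in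
  \<open>\<alpha> j\<close> would lower the count.\<close>

lemma ex_positive_system:
  assumes closed: "\<And>x y. x \<in> T \<Longrightarrow> y \<in> T \<Longrightarrow> x + y \<in> fin_roots J \<Longrightarrow> x + y \<in> T"
    and total: "\<And>x. x \<in> fin_roots J \<Longrightarrow> x \<in> T \<or> - x \<in> T"
  shows "\<exists>u\<in>fin_weyl J. \<forall>x\<in>fpos J. u x \<in> T"
proof -
  define S where "S u = {x \<in> fpos J. u x \<notin> T}" for u
  have fin: "finite (S u)" for u
    using finite_fin_roots[OF J] fpos_roots[OF J] by (auto simp: S_def intro: finite_subset)
  from ex_has_least_nat[of "\<lambda>u. u \<in> fin_weyl J", OF fin_weyl_id[OF J], of "\<lambda>u. card (S u)"]
  obtain u where u: "u \<in> fin_weyl J" and min: "\<And>v. v \<in> fin_weyl J \<Longrightarrow> card (S u) \<le> card (S v)" by blast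
  note lin = fin_weyl_linear[OF J u]
  have "u (\<alpha> j) \<in> T" if j: "j \<in> J" for j
  proof (rule ccontr)
    assume n: "u (\<alpha> j) \<notin> T"
    let ?s = "refl (\<alpha> j)"
    note a = fin_roots_simple[OF J j] and jl = K_le[OF J j]
    note nd = \<alpha>_nondegenerate[OF jl]
    have "u (\<alpha> j) \<in> fin_roots J" using fin_weyl_roots[OF J u a] .
    then have m: "- u (\<alpha> j) \<in> T" using total n by blast
    have s: "?s (\<alpha> j) = - \<alpha> j" using refl_self nd by blast
    have "S (u \<circ> ?s) \<subseteq> ?s ` (S u - {\<alpha> j})"
    proof
      fix x assume x: "x \<in> S (u \<circ> ?s)"
      then have "x \<noteq> \<alpha> j" using m s lin by (auto simp: S_def linear_neg)
      then have y: "?s x \<in> fpos J" using fpos_perm[OF J j] x by (simp add: S_def)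
      have xx: "?s (?s x) = x" using refl_refl nd by blast
      have "?s x \<noteq> \<alpha> j"
      proof
        assume "?s x = \<alpha> j"
        then have "x = - \<alpha> j" using xx s by simp
        then show False using x fpos_uminus[OF J fpos_simple[OF J j]] by (simp add: S_def)
      qed
      then have "?s x \<in> S u - {\<alpha> j}" using x y by (simp add: S_def)
      then show "x \<in> ?s ` (S u - {\<alpha> j})" using xx by (metis imageI)
    qed
    then have "card (S (u \<circ> ?s)) \<le> card (?s ` (S u - {\<alpha> j}))" using fin by (intro card_mono) auto
    also have "\<dots> \<le> card (S u - {\<alpha> j})" using fin by (intro card_image_le) auto
    also have "\<dots> < card (S u)" using fin n fpos_simple[OF J j] by (intro card_Diff1_less) (auto simp: S_def)
    finally show False using min[OF fin_weyl_comp[OF J u fin_weyl_simple[OF J j]]] by simp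
  qed
  then show ?thesis using closed_contains_fpos[OF closed u order.refl] u by blast
qed

lemma fpos_sum: "x \<in> fpos J \<Longrightarrow> y \<in> fpos J \<Longrightarrow> x + y \<in> fin_roots J \<Longrightarrow> x + y \<in> fpos J"
  by (simp add: fpos_def)

lemma minimal_rep_fpos:
  assumes u: "u \<in> fin_weyl J" and K: "K \<subseteq> J" and pos: "\<forall>k\<in>K. u (\<alpha> k) \<in> fpos J"
    and x: "x \<in> fpos K"
  shows "u x \<in> fpos J"
  using closed_contains_fpos[OF fpos_sum u K _ x] pos by blast

text \<open>The roots \<open>x\<close> of \<open>F\<close> with \<open>- x \<notin> F\<close>, together with the positive roots of the Levi part
  \<open>F \<inter> - F\<close>, form a positive system; this choice yields the minimal coset representative.\<close>

definition positive_part :: "'v set \<Rightarrow> 'v set" where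
  "positive_part F = {x \<in> F. - x \<notin> F \<or> x \<in> fpos J}"

text \<open>For \<open>u\<close> carrying the positive roots into \<open>positive_part F\<close>,
  the preimage of \<open>F\<close> contains all positive roots, and \<open>K\<close> collects the
  simple roots whose negatives it contains too. By the choice of \<open>positive_part\<close> their
  images under \<open>u\<close> are positive, which is minimality of the representative.\<close>

lemma parabolic_exists:
  assumes F: "F \<subseteq> fin_roots J"
    and closed: "\<And>x y. x \<in> F \<Longrightarrow> y \<in> F \<Longrightarrow> x + y \<in> fin_roots J \<Longrightarrow> x + y \<in> F"
    and total: "\<And>x. x \<in> fin_roots J \<Longrightarrow> x \<in> F \<or> - x \<in> F"
  shows "\<exists>K u. K \<subseteq> J \<and> u \<in> fin_weyl J \<and> (\<forall>k\<in>K. u (\<alpha> k) \<in> fpos J) \<and> F = u ` (fpos J \<union> fin_roots K)"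
proof -
  let ?T = "positive_part F"
  have "\<exists>u\<in>fin_weyl J. \<forall>x\<in>fpos J. u x \<in> ?T"
  proof (rule ex_positive_system)
    fix x y assume x: "x \<in> ?T" and y: "y \<in> ?T" and xy: "x + y \<in> fin_roots J"
    have F: "x \<in> F" "y \<in> F" "x + y \<in> F" using x y xy closed by (auto simp: positive_part_def)
    \<comment> \<open>If \<open>- (x + y)\<close> lies in \<open>F\<close>, adding \<open>x\<close>
      or \<open>y\<close> back puts both negatives into \<open>F\<close>; then both roots are
      positive, and so is their sum.\<close>
    show "x + y \<in> ?T"
    proof (cases "- (x + y) \<in> F")
      case True
      have "- (x + y) + y = - x" "- (x + y) + x = - y" by simp_all
      moreover have "- x \<in> fin_roots J" "- y \<in> fin_roots J"
        using F assms(1) fin_roots_uminus[OF J] by auto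
      ultimately have "- x \<in> F" "- y \<in> F" using closed[OF True F(2)] closed[OF True F(1)] by simp_all
      then have "x \<in> fpos J" "y \<in> fpos J" using x y by (auto simp: positive_part_def)
      then have "x + y \<in> fpos J" using fpos_sum xy by blast
      then show ?thesis using F by (simp add: positive_part_def)
    qed (use F in \<open>simp add: positive_part_def\<close>)
  next
    fix x assume "x \<in> fin_roots J"
    then show "x \<in> ?T \<or> - x \<in> ?T" using total[of x] fpos_cases[OF J, of x] by (auto simp: positive_part_def)
  qed
  then obtain u where u: "u \<in> fin_weyl J" and uT: "\<And>x. x \<in> fpos J \<Longrightarrow> u x \<in> ?T" by blast
  note lin = fin_weyl_linear[OF J u]
  have uF: "u x \<in> F" if "x \<in> fpos J" for x using uT[OF that] by (simp add: positive_part_def)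
  define K where "K = {k \<in> J. - u (\<alpha> k) \<in> F}"
  have K: "K \<subseteq> J" and K': "K \<subseteq> nodes" using J by (auto simp: K_def)
  have KJ: "fpos K \<subseteq> fpos J" using fin_roots_mono[OF K] by (auto simp: fpos_def)
  have pos: "u (\<alpha> k) \<in> fpos J" if "k \<in> K" for k
    using uT[OF fpos_simple[OF J, of k]] that by (auto simp: positive_part_def K_def)
  have "F = u ` (fpos J \<union> fin_roots K)"
  proof (intro equalityI subsetI)
    fix y assume y: "y \<in> F"
    define x where "x = inv u y"
    have ux: "u x = y" unfolding x_def using fin_weyl_inv_right[OF J u] .
    have x: "x \<in> fin_roots J" unfolding x_def using fin_weyl_roots[OF J fin_weyl_inv[OF J u]] F y by blast
    \<comment> \<open>Adding \<open>u (\<alpha> k)\<close> or \<open>u z\<close>, both in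
      \<open>F\<close>, to \<open>- u (z + \<alpha> k)\<close> leaves the negative of the other
      summand in \<open>F\<close>. Inductively the whole support lies in \<open>K\<close>.\<close>
    have *: "- u z \<in> F \<Longrightarrow> z \<in> fin_roots K" if "z \<in> fpos J" for z
      using that
    proof (induction rule: fpos_induct[OF J, consumes 1, case_names simple add])
      case (simple k)
      then show ?case using fin_roots_simple[OF K'] by (simp add: K_def)
    next
      case (add z k)
      have a: "\<alpha> k \<in> fpos J" using fpos_simple[OF J add(2)] .
      have eq: "- u (z + \<alpha> k) = - u z + - u (\<alpha> k)" using lin by (simp add: linear_add)
      have r: "- u z \<in> fin_roots J" "- u (\<alpha> k) \<in> fin_roots J"
        using fin_roots_uminus[OF J] fin_weyl_roots[OF J u] fpos_roots[OF J] add(1) a by blast+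
      have "- u z = - u (z + \<alpha> k) + u (\<alpha> k)" "- u (\<alpha> k) = - u (z + \<alpha> k) + u z" unfolding eq by simp_all
      then have F': "- u z \<in> F" "- u (\<alpha> k) \<in> F"
        using closed[OF add.prems uF[OF a]] closed[OF add.prems uF[OF add(1)]] r by simp_all
      then have z: "z \<in> fin_roots K" and "k \<in> K" using add by (auto simp: K_def)
      then have "\<alpha> k \<in> fin_roots K" using fin_roots_simple[OF K'] by blast
      then have "coef i (z + \<alpha> k) = 0" if "i \<le> l" "i \<notin> K" for i
        using fin_roots_support[OF K' z that] fin_roots_support[OF K' _ that, of "\<alpha> k"] by simp
      then show ?case using fin_roots_of_support[OF J K fpos_roots[OF J add(3)]] by blast
    qed
    have "x \<in> fpos J \<union> fin_roots K"
    proof (cases "x \<in> fpos J")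
      case False
      then have "- x \<in> fpos J" using fpos_cases[OF J x] by blast
      moreover have "- u (- x) \<in> F" using ux y lin by (simp add: linear_neg)
      ultimately have "- x \<in> fin_roots K" using * by blast
      then show ?thesis using fin_roots_uminus[OF K', of "- x"] by simp
    qed simp
    then show "y \<in> u ` (fpos J \<union> fin_roots K)" using ux by blast
  next
    fix y assume "y \<in> u ` (fpos J \<union> fin_roots K)"
    then obtain x where x: "y = u x" "x \<in> fpos J \<or> x \<in> fin_roots K" by blast
    have *: "- u z \<in> F" if "z \<in> fpos K" for z
      using that
    proof (induction rule: fpos_induct[OF K', consumes 1, case_names simple add])
      case (simple k)
      then show ?case by (simp add: K_def)
    next
      case (add z k)
      have "z + \<alpha> k \<in> fin_roots J" using fpos_roots[OF K' add(3)] fin_roots_mono[OF K] by blast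
      then have "- u (z + \<alpha> k) \<in> fin_roots J" using fin_roots_uminus[OF J] fin_weyl_roots[OF J u] by blast
      moreover have "- u (z + \<alpha> k) = - u z + - u (\<alpha> k)" using lin by (simp add: linear_add)
      ultimately show ?case using closed[OF add(4), of "- u (\<alpha> k)"] add(2) by (simp add: K_def)
    qed
    from x(2) show "y \<in> F"
    proof
      assume "x \<in> fin_roots K"
      from fpos_cases[OF K' this] show ?thesis
      proof
        assume "- x \<in> fpos K"
        then show ?thesis using *[of "- x"] x(1) lin by (simp add: linear_neg)
      qed (use KJ uF x in blast)
    qed (use uF x in blast)
  qed
  then show ?thesis using K u pos by blast
qed

text \<open>Minimality of \<open>u\<close> identifies the positive roots of the Levi part with the
  image of \<open>fpos K\<close>. So the image of \<open>fpos J\<close> under \<open>u\<close>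
  depends on the parabolic subset alone, which is what uniqueness rests on.\<close>

lemma positive_part_parabolic:
  assumes u: "u \<in> fin_weyl J" and K: "K \<subseteq> J" and pos: "\<forall>k\<in>K. u (\<alpha> k) \<in> fpos J"
  shows "positive_part (u ` (fpos J \<union> fin_roots K)) = u ` fpos J"
proof -
  note lin = fin_weyl_linear[OF J u]
  have K': "K \<subseteq> nodes" using K J by blast
  let ?F = "u ` (fpos J \<union> fin_roots K)"
  have inj: "x = y" if "u x = u y" for x y
    using fin_weyl_inv_left[OF J u] that by metis
  note rep = minimal_rep_fpos[OF u K pos]
  show ?thesis
  proof (intro equalityI subsetI)
    fix y assume y: "y \<in> positive_part ?F"
    then obtain x where x: "y = u x" "x \<in> fpos J \<or> x \<in> fin_roots K" by (auto simp: positive_part_def)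
    show "y \<in> u ` fpos J"
    proof (cases "x \<in> fpos J")
      case False
      then have xK: "x \<in> fin_roots K" using x by blast
      have "x \<notin> fpos K" using False fin_roots_mono[OF K] by (auto simp: fpos_def)
      then have "- x \<in> fpos K" using fpos_cases[OF K' xK] by blast
      then have "- y \<in> fpos J" using rep[of "- x"] x(1) lin by (simp add: linear_neg)
      moreover have "- y = u (- x)" using x(1) lin by (simp add: linear_neg)
      then have "- y \<in> ?F" using fin_roots_uminus[OF K' xK] by blast
      ultimately show ?thesis using y fpos_uminus[OF J, of "- y"] by (auto simp: positive_part_def)
    qed (use x in blast)
  next
    fix y assume "y \<in> u ` fpos J"
    then obtain x where x: "y = u x" "x \<in> fpos J" by blast
    have "y \<in> fpos J" if m: "- y \<in> ?F"
    proof -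
      obtain z where z: "- y = u z" "z \<in> fpos J \<union> fin_roots K" using m by blast
      have "u (- x) = u z" using z(1) x(1) lin by (simp add: linear_neg)
      then have "- x \<in> fpos J \<union> fin_roots K" using inj z(2) by blast
      then have "- x \<in> fin_roots K" using fpos_uminus[OF J x(2)] by blast
      then have "x \<in> fin_roots K" using fin_roots_uminus[OF K', of "- x"] by simp
      then have "x \<in> fpos K" using x(2) by (simp add: fpos_def)
      then show ?thesis using rep x(1) by blast
    qed
    then show "y \<in> positive_part ?F" using x unfolding positive_part_def by blast
  qed
qed

text \<open>Equal images of the positive system make \<open>inv u' \<circ> u\<close> keep simple
  roots positive, hence trivial. Afterwards \<open>K\<close> is read off from the negative simple
  roots in the set.\<close>

lemma parabolic_unique:
  assumes u: "u \<in> fin_weyl J" "K \<subseteq> J" "\<forall>k\<in>K. u (\<alpha> k) \<in> fpos J"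
    and u': "u' \<in> fin_weyl J" "K' \<subseteq> J" "\<forall>k\<in>K'. u' (\<alpha> k) \<in> fpos J"
    and eq: "u ` (fpos J \<union> fin_roots K) = u' ` (fpos J \<union> fin_roots K')"
  shows "u = u'" "K = K'"
proof -
  interpret fin: reflection_system "\<alpha> ` J" "fpos J" refl ht
    using fin_reflection_system[OF J] .
  have "u ` fpos J = u' ` fpos J"
    using positive_part_parabolic[OF u] positive_part_parabolic[OF u'] eq by simp
  have "(inv u' \<circ> u) b \<in> fpos J" if "b \<in> \<alpha> ` J" for b
  proof -
    have "u b \<in> u' ` fpos J" using that fpos_simple[OF J] \<open>u ` fpos J = u' ` fpos J\<close> by blast
    then show ?thesis using fin_weyl_inv_left[OF J u'(1)] by auto
  qed
  then have "inv u' \<circ> u = id"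
    using fin.W_faithful[of "inv u' \<circ> u"] fin_weyl_comp[OF J fin_weyl_inv[OF J u'(1)] u(1)] fin_weyl_eq[OF J]
    by blast
  then have id: "inv u' (u x) = x" for x by (metis comp_apply id_apply)
  then show uu: "u = u'" using fin_weyl_inv_right[OF J u'(1)] by (metis ext)
  have inj: "inj u" using bij_is_inj fin_weyl_bij[OF J u(1)] by blast
  have eq': "fpos J \<union> fin_roots K = fpos J \<union> fin_roots K'"
    using eq unfolding uu[symmetric] inj_image_eq_iff[OF inj] .
  have sub: "L \<subseteq> L'" if L: "L \<subseteq> J" "L' \<subseteq> J" and e: "fpos J \<union> fin_roots L = fpos J \<union> fin_roots L'" for L L'
  proof
    fix k assume k: "k \<in> L"
    have Ln: "L \<subseteq> nodes" "L' \<subseteq> nodes" using L J by auto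
    have "- \<alpha> k \<in> fin_roots L" using fin_roots_uminus[OF Ln(1) fin_roots_simple[OF Ln(1) k]] .
    moreover have "- \<alpha> k \<notin> fpos J" using fpos_uminus[OF J fpos_simple[OF J]] k L by blast
    ultimately have r: "- \<alpha> k \<in> fin_roots L'" using e by blast
    have "k \<le> l" using K_le[OF Ln(1) k] .
    then show "k \<in> L'" using fin_roots_support[OF Ln(2) r, of k] by auto
  qed
  show "K = K'" using sub[OF u(2) u'(2) eq'] sub[OF u'(2) u(2) eq'[symmetric]] by blast
qed

end

section \<open>Biconvex sets\<close>

text \<open>The coefficients of the finite part \<open>e\<close> of \<open>m \<delta> + e\<close>.\<close>

definition fc :: "nat \<Rightarrow> 'v \<Rightarrow> real" where
  "fc i v = coef i v - coef 0 v * coef i delta"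

lemma fc_add: "fc i (v + w) = fc i v + fc i w"
  by (simp add: fc_def algebra_simps)

lemma fc_affine: "e \<in> fin_roots nodes \<Longrightarrow> fc i (aff m e) = coef i e"
  using fin_roots_coef_0[OF nodes_subset] by (simp add: fc_def delta_coef_0)

lemma fc_imag: "x \<in> aimag \<Longrightarrow> fc i x = 0"
  by (auto simp: fc_def delta_coef_0 aimag_def)

section \<open>The defining notions in explicit form\<close>

lemma biconvex_iff:
  assumes J: "J \<subseteq> nodes"
  shows "biconvex J B \<longleftrightarrow> B \<subseteq> affpos J \<and>
    (\<forall>x\<in>B. \<forall>y\<in>B. x + y \<in> affpos J \<longrightarrow> x + y \<in> B) \<and>
    (\<forall>x\<in>affpos J - B. \<forall>y\<in>affpos J - B. x + y \<in> affpos J \<longrightarrow> x + y \<notin> B)"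
proof -
  have *: "(\<forall>C\<in>{B, R - B}. Q C) \<longleftrightarrow> Q B \<and> Q (R - B)" for Q and R :: "'v set" by simp
  show ?thesis
    unfolding biconvex_def pos_roots_sub_eq[OF J] * by (intro conj_cong ball_cong refl) auto
qed

lemma real_root_roots: "e \<in> fin_roots nodes \<Longrightarrow> aff m e \<in> roots"
  unfolding roots_def real_roots_def by blast

lemma fin_weyl_rel_eq:
  assumes J: "J \<subseteq> nodes" and K: "K \<subseteq> J"
  shows "fin_weyl_rel J K = {u \<in> fin_weyl J. \<forall>k\<in>K. u (\<alpha> k) \<in> fpos J}"
proof -
  have "u (\<alpha> k) \<in> pos_roots \<longleftrightarrow> u (\<alpha> k) \<in> fpos J" if "u \<in> fin_weyl J" "k \<in> K" for u k
  proof -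
    have r: "u (\<alpha> k) \<in> fin_roots J" using fin_weyl_roots[OF J that(1)] fin_roots_simple[OF J] that K by blast
    have "J \<subseteq> {0..l}" using J by auto
    then have "u (\<alpha> k) \<in> Qplus {0..l} \<longleftrightarrow> u (\<alpha> k) \<in> fpos J" using fpos_Qplus[OF J r] by blast
    moreover have "u (\<alpha> k) \<in> roots" using real_root_roots[of "u (\<alpha> k)" 0] r fin_roots_mono[OF J] by auto
    ultimately show ?thesis unfolding pos_roots_def by blast
  qed
  then show ?thesis unfolding fin_weyl_rel_def by blast
qed

lemma fin_neg_roots_eq: "fin_neg_roots = {e \<in> fin_roots nodes. - e \<in> fpos nodes}"
proof -
  have "e \<in> neg_roots \<longleftrightarrow> - e \<in> fpos nodes" if e: "e \<in> fin_roots nodes" for e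
  proof -
    have "e \<in> roots" using real_root_roots[OF e, of 0] by simp
    then have "e \<in> neg_roots \<longleftrightarrow> e \<in> uminus ` Qplus {0..l}" unfolding neg_roots_def by blast
    also have "\<dots> \<longleftrightarrow> - e \<in> Qplus {0..l}" by force
    also have "\<dots> \<longleftrightarrow> - e \<in> fpos nodes"
      using fpos_Qplus[OF nodes_subset fin_roots_uminus[OF nodes_subset e], of "{0..l}"] by auto
    finally show ?thesis .
  qed
  then show ?thesis unfolding fin_neg_roots_def by blast
qed

lemma neg_rel_eq:
  assumes J: "J \<subseteq> nodes" and K: "K \<subseteq> J"
  shows "fin_neg_roots_rel J K = {e \<in> fin_roots J. \<exists>i\<le>l. i \<notin> K \<and> coef i e < 0}"
    and "fin_neg_roots_rel J K = fin_roots J - (fpos J \<union> fin_roots K)"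
proof -
  have Kn: "K \<subseteq> nodes" using J K by blast
  have neg: "e \<in> fin_neg_roots \<longleftrightarrow> e \<notin> fpos J" if e: "e \<in> fin_roots J" for e
  proof -
    have "e \<in> fin_neg_roots \<longleftrightarrow> - e \<in> fpos J"
      using that fin_roots_mono[OF J] fin_roots_uminus[OF J] unfolding fin_neg_roots_eq by (auto simp: fpos_def)
    also have "\<dots> \<longleftrightarrow> e \<notin> fpos J" using fpos_cases[OF J e] fpos_uminus[OF J] by auto
    finally show ?thesis .
  qed
  then show eq: "fin_neg_roots_rel J K = fin_roots J - (fpos J \<union> fin_roots K)"
    unfolding fin_neg_roots_rel_def by blast
  have "e \<notin> fpos J \<union> fin_roots K \<longleftrightarrow> (\<exists>i\<le>l. i \<notin> K \<and> coef i e < 0)" if e: "e \<in> fin_roots J" for e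
  proof
    assume n: "e \<notin> fpos J \<union> fin_roots K"
    then obtain i where i: "i \<le> l" "i \<notin> K" "coef i e \<noteq> 0"
      using fin_roots_of_support[OF J K e] by blast
    have "- e \<in> fpos J" using fpos_cases[OF J e] n by blast
    then have "coef i e \<le> 0" using fpos_coef[OF J _ i(1), of "- e"] by simp
    then show "\<exists>i\<le>l. i \<notin> K \<and> coef i e < 0" using i by force
  next
    assume "\<exists>i\<le>l. i \<notin> K \<and> coef i e < 0"
    then obtain i where i: "i \<le> l" "i \<notin> K" "coef i e < 0" by blast
    then show "e \<notin> fpos J \<union> fin_roots K"
      using fin_roots_support[OF Kn _ i(1,2), of e] fpos_coef[OF J _ i(1), of e] by auto
  qed
  then show "fin_neg_roots_rel J K = {e \<in> fin_roots J. \<exists>i\<le>l. i \<notin> K \<and> coef i e < 0}"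
    unfolding eq by blast
qed

text \<open>The group fixes imaginary roots, so these never become negative; for a real root,
  negativity of the image means that its opposite lies in \<open>apos K\<close>.\<close>

lemma Phi_eq:
  assumes K: "K \<subseteq> nodes" and y: "y \<in> aff_weyl K"
  shows "Phi K y = reflection_system.inversions (apos K) y"
proof -
  interpret aff: affine_reflection_system "simples K" "apos K" refl ht aimag
    using affine_system[OF K] .
  have y: "y \<in> aff.W" using y aff_weyl_eq[OF K] by simp
  note lin = aff.W_linear[OF aff.W_inv[OF y]]
  have imag: "v x = x" if "v \<in> aff.W" "x \<in> aimag" for v x
    using that by (induction rule: aff.W_induct) (auto simp: aff.s_imag)
  have Q: "x \<in> Qplus {0..l}" if "x \<in> apos K" for x
    using apos_coef[OF K that] apos_U[OF K that] by (simp add: Qplus_iff)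
  have ht_Q: "ht x \<ge> 0" if "x \<in> Qplus {0..l}" for x
    using that unfolding ht_def by (auto simp: Qplus_iff intro!: sum_nonneg)
  have not_neg: "x \<notin> neg_roots" if "ht x > 0" for x
    using that ht_Q linear_neg[OF ht_linear] unfolding neg_roots_def by fastforce
  have real: "x \<in> roots" if "x \<in> apos K" for x
    using that real_root_roots fin_roots_mono[OF K] unfolding apos_def by blast
  have neg_real: "- x \<in> roots" if x: "x \<in> apos K" for x
  proof -
    obtain m e where me: "x = aff m e" "e \<in> fin_roots K" using x unfolding apos_def by blast
    then have "- x = aff (- m) (- e)" by simp
    then show ?thesis using real_root_roots[of "- e" "- m"] fin_roots_uminus[OF K me(2)] fin_roots_mono[OF K] by auto
  qed
  have "x \<in> affpos K \<and> inv y x \<in> neg_roots \<longleftrightarrow> x \<in> apos K \<and> - inv y x \<in> apos K" for x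
  proof (cases "x \<in> apos K")
    case True
    then have R: "inv y x \<in> aff.R" using aff.W_R[OF aff.W_inv[OF y]] by (simp add: aff.R_def)
    show ?thesis
    proof (cases "inv y x \<in> apos K")
      case p: True
      then show ?thesis using not_neg[OF aff.ht_pos[OF p]] aff.uminus_notin[OF p] by blast
    next
      case False
      then have n: "- inv y x \<in> apos K" using aff.R_cases[OF R] by blast
      then have "inv y x \<in> roots" "inv y x \<in> uminus ` Qplus {0..l}"
        using neg_real[OF n] Q[OF n] by force+
      then show ?thesis using True n unfolding neg_roots_def by blast
    qed
  next
    case False
    have "inv y x \<notin> neg_roots" if "x \<in> aimag"
      using imag[OF aff.W_inv[OF y] that] not_neg[of x] aff.ht_ge_1[of x] that by simp
    then show ?thesis using False by blast
  qed
  then show ?thesis unfolding Phi_def aff.inversions_def pos_roots_sub_eq[OF K] by blast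
qed

section \<open>The sets attached to a fixed pair \<open>K\<close>, \<open>u\<close>\<close>

context
  fixes J K :: "nat set" and u :: "'v \<Rightarrow> 'v"
  assumes J: "J \<subseteq> nodes" and K: "K \<subseteq> J" and u: "u \<in> fin_weyl J"
    and pos: "\<forall>k\<in>K. u (\<alpha> k) \<in> fpos J"
begin

lemma K_nodes: "K \<subseteq> nodes"
  using K J by blast

lemma u_affine: "u (aff m e) = aff m (u e)"
  using fin_weyl_linear[OF J u] fin_weyl_delta[OF J u] by (simp add: linear_add linear_cmul)

lemma u_imag: "x \<in> aimag \<Longrightarrow> u x = x"
  using fin_weyl_linear[OF J u] fin_weyl_delta[OF J u] by (auto simp: aimag_def linear_cmul)

lemma inv_u_imag: "x \<in> aimag \<Longrightarrow> inv u x = x"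
  using u_imag fin_weyl_inv_left[OF J u, of x] by simp

lemma inv_u_affine: "inv u (aff m (u e)) = aff m e"
  using u_affine fin_weyl_inv_left[OF J u] by metis

lemma u_apos:
  assumes "x \<in> apos K" shows "u x \<in> apos J"
proof -
  obtain m e where x: "x = aff m e" "e \<in> fin_roots K" "m > 0 \<or> m = 0 \<and> e \<in> fpos K"
    using assms unfolding apos_def by blast
  have "u e \<in> fin_roots J" using x(2) fin_roots_mono[OF K] fin_weyl_roots[OF J u] by blast
  moreover have "u e \<in> fpos J" if "e \<in> fpos K" using minimal_rep_fpos[OF J u K pos that] .
  ultimately show ?thesis unfolding x(1) u_affine apos_def using x(3) by blast
qed

lemma apos_u_cases:
  assumes "x \<in> apos J"
  shows "\<exists>m e. e \<in> fin_roots J \<and> x = aff m (u e) \<and> inv u x = aff m e \<and>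
    (m > 0 \<or> m = 0 \<and> u e \<in> fpos J) \<and> (\<forall>i. fc i (inv u x) = coef i e)"
proof -
  obtain m f where x: "x = aff m f" "f \<in> fin_roots J" "m > 0 \<or> m = 0 \<and> f \<in> fpos J"
    using assms unfolding apos_def by blast
  define e where "e = inv u f"
  have f: "f = u e" unfolding e_def using fin_weyl_inv_right[OF J u] by simp
  have e: "e \<in> fin_roots J" unfolding e_def using fin_weyl_roots[OF J fin_weyl_inv[OF J u] x(2)] .
  have i: "inv u x = aff m e" unfolding x(1) f by (rule inv_u_affine)
  moreover have "fc i (inv u x) = coef i e" for i
    unfolding i using fc_affine e fin_roots_mono[OF J] by blast
  ultimately show ?thesis using e x f by blast
qed

lemma fc_sign:
  assumes "x \<in> affpos J"
  shows "(\<forall>i\<le>l. fc i (inv u x) \<ge> 0) \<or> (\<forall>i\<le>l. fc i (inv u x) \<le> 0)"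
proof (cases "x \<in> aimag")
  case True
  then show ?thesis using fc_imag inv_u_imag by simp
next
  case False
  then have "x \<in> apos J" using assms by blast
  then obtain m e where e: "e \<in> fin_roots J" and eq: "\<And>i. fc i (inv u x) = coef i e"
    using apos_u_cases by blast
  show ?thesis unfolding eq using fin_roots_sign[OF J e] .
qed

text \<open>Vanishing coordinates outside \<open>K\<close> put the finite part into
  \<open>fin_roots K\<close>. At level 0 positivity has to be pulled back through \<open>u\<close>,
  which works because \<open>u\<close> keeps the positive roots of \<open>K\<close>
  positive.\<close>

lemma Levi_iff:
  assumes "x \<in> affpos J"
  shows "inv u x \<in> affpos K \<longleftrightarrow> (\<forall>i\<le>l. i \<notin> K \<longrightarrow> fc i (inv u x) = 0)"
proof (cases "x \<in> aimag")
  case True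
  then show ?thesis using fc_imag inv_u_imag by simp
next
  case False
  then have "x \<in> apos J" using assms by blast
  then obtain m e where e: "e \<in> fin_roots J" and "x = aff m (u e)"
    and x: "inv u x = aff m e"
    and m: "m > 0 \<or> m = 0 \<and> u e \<in> fpos J" and eq: "\<And>i. fc i (inv u x) = coef i e"
    using apos_u_cases by blast
  show ?thesis
  proof
    assume a: "inv u x \<in> affpos K"
    have en: "e \<in> fin_roots nodes" using e fin_roots_mono[OF J] by blast
    then have "inv u x \<notin> aimag" using affine_not_imag unfolding x aimag_def by blast
    then obtain n f where f: "inv u x = aff n f" "f \<in> fin_roots K"
      using a unfolding apos_def by blast
    then have "e = f" using affine_unique(2)[OF en, of f m n] x fin_roots_mono[OF K_nodes] by auto
    then show "\<forall>i\<le>l. i \<notin> K \<longrightarrow> fc i (inv u x) = 0"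
      unfolding eq using fin_roots_support[OF K_nodes f(2)] by simp
  next
    assume "\<forall>i\<le>l. i \<notin> K \<longrightarrow> fc i (inv u x) = 0"
    then have eK: "e \<in> fin_roots K" unfolding eq using fin_roots_of_support[OF J K e] by blast
    have "e \<in> fpos K" if "u e \<in> fpos J"
    proof (rule ccontr)
      assume "e \<notin> fpos K"
      then have "- e \<in> fpos K" using fpos_cases[OF K_nodes eK] by blast
      then have "u (- e) \<in> fpos J" using minimal_rep_fpos[OF J u K pos] by blast
      then show False using fpos_uminus[OF J that] fin_weyl_linear[OF J u] by (simp add: linear_neg)
    qed
    then show "inv u x \<in> affpos K" unfolding x apos_def using eK m by blast
  qed
qed

lemma image_neg_rel: "u ` fin_neg_roots_rel J K \<subseteq> fin_roots nodes"
proof -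
  have "u ` fin_neg_roots_rel J K \<subseteq> fin_roots J"
    using fin_weyl_roots[OF J u] unfolding fin_neg_roots_rel_def by blast
  then show ?thesis using fin_roots_mono[OF J] by blast
qed

lemma Delta_minus_iff:
  "x \<in> Delta_minus J K u \<longleftrightarrow> x \<in> affpos J \<and> (\<exists>i\<le>l. i \<notin> K \<and> fc i (inv u x) < 0)"
proof
  assume "x \<in> Delta_minus J K u"
  then obtain m e where x: "x = aff m (u e)" and e: "e \<in> fin_neg_roots_rel J K"
    and m: "m > 0 \<or> m = 0 \<and> u e \<in> fpos nodes"
    unfolding Delta_minus_def affinize_eq[OF image_neg_rel] by blast
  have eJ: "e \<in> fin_roots J" and neg: "\<exists>i\<le>l. i \<notin> K \<and> coef i e < 0" using e unfolding neg_rel_eq(1)[OF J K] by blast+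
  have ue: "u e \<in> fin_roots J" using fin_weyl_roots[OF J u eJ] .
  have "x \<in> apos J" unfolding x apos_def using ue m fpos_inter[OF J] by blast
  moreover have "inv u x = aff m e" unfolding x by (rule inv_u_affine)
  then have "fc i (inv u x) = coef i e" for i using fc_affine eJ fin_roots_mono[OF J] by auto
  ultimately show "x \<in> affpos J \<and> (\<exists>i\<le>l. i \<notin> K \<and> fc i (inv u x) < 0)" using neg by simp
next
  assume x: "x \<in> affpos J \<and> (\<exists>i\<le>l. i \<notin> K \<and> fc i (inv u x) < 0)"
  then have "x \<notin> aimag" using fc_imag inv_u_imag by auto
  then have "x \<in> apos J" using x by blast
  then obtain m e where e: "e \<in> fin_roots J" "x = aff m (u e)"
    and "inv u x = aff m e" and m: "m > 0 \<or> m = 0 \<and> u e \<in> fpos J" and eq: "\<And>i. fc i (inv u x) = coef i e"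
    using apos_u_cases by blast
  have "e \<in> fin_neg_roots_rel J K" unfolding neg_rel_eq(1)[OF J K] using e x unfolding eq by blast
  then show "x \<in> Delta_minus J K u"
    unfolding Delta_minus_def affinize_eq[OF image_neg_rel] using e(2) m fpos_inter[OF J] by blast
qed

lemma image_iff_inv: "x \<in> u ` X \<longleftrightarrow> inv u x \<in> X"
  using fin_weyl_inv_left[OF J u] fin_weyl_inv_right[OF J u] by (metis imageE imageI)

lemma u_apos_imag: "x \<in> affpos K \<Longrightarrow> u x \<in> affpos J"
  using u_apos u_imag by fastforce

lemma nabla_disjoint:
  assumes "X \<subseteq> apos K"
  shows "Delta_minus J K u \<inter> u ` X = {}"
proof -
  have False if x: "x \<in> Delta_minus J K u" "inv u x \<in> X" for x
  proof -
    have a: "x \<in> affpos J" and neg: "\<exists>i\<le>l. i \<notin> K \<and> fc i (inv u x) < 0"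
      using x(1) Delta_minus_iff by blast+
    have "inv u x \<in> affpos K" using x(2) assms by blast
    then have "\<forall>i\<le>l. i \<notin> K \<longrightarrow> fc i (inv u x) = 0" using Levi_iff[OF a] by blast
    then show False using neg by force
  qed
  then show ?thesis using image_iff_inv by blast
qed

lemma nabla_iff:
  assumes "X \<subseteq> apos K"
  shows "x \<in> Delta_minus J K u \<union> u ` X \<longleftrightarrow>
    x \<in> affpos J \<and> ((\<exists>i\<le>l. i \<notin> K \<and> fc i (inv u x) < 0) \<or> inv u x \<in> X)"
proof -
  have "x \<in> affpos J" if "inv u x \<in> X"
    using u_apos_imag[of "inv u x"] that assms fin_weyl_inv_right[OF J u] by auto
  then show ?thesis using Delta_minus_iff image_iff_inv by blast
qed

lemma nabla_real:
  assumes "X \<subseteq> apos K"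
  shows "Delta_minus J K u \<union> u ` X \<subseteq> apos J"
proof
  fix x assume "x \<in> Delta_minus J K u \<union> u ` X"
  then show "x \<in> apos J"
  proof
    assume x: "x \<in> Delta_minus J K u"
    then have "x \<notin> aimag" using fc_imag inv_u_imag Delta_minus_iff by fastforce
    then show ?thesis using x Delta_minus_iff by blast
  qed (use assms u_apos in blast)
qed

text \<open>\<open>u\<^sup>-\<^sup>1\<close> of a positive root has finite part in the nilradical, the Levi part or the opposite
  nilradical, according to the sign of its coefficients outside \<open>K\<close>; these signs add up.\<close>

lemma biconvex_nabla:
  assumes X: "affine_reflection_system.biconvex_real (apos K) aimag X"
  shows "biconvex J (Delta_minus J K u \<union> u ` X)"
proof -
  interpret aff: affine_reflection_system "simples K" "apos K" refl ht aimag
    using affine_system[OF K_nodes] .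
  have sub: "X \<subseteq> apos K" using X unfolding aff.biconvex_real_def by blast
  note iff = nabla_iff[OF sub]
  have add: "inv u (x + y) = inv u x + inv u y" for x y
    using linear_add[OF fin_weyl_linear[OF J fin_weyl_inv[OF J u]]] .
  have Levi: "inv u x \<in> affpos K" if "x \<in> affpos J" "\<And>i. i \<le> l \<Longrightarrow> i \<notin> K \<Longrightarrow> fc i (inv u x) = 0" for x
    using Levi_iff[OF that(1)] that(2) by blast
  have X0: "fc i (inv u x) = 0" if "x \<in> affpos J" "inv u x \<in> X" "i \<le> l" "i \<notin> K" for x i
    using Levi_iff[OF that(1)] that sub by blast
  have closed: "x + y \<in> Delta_minus J K u \<union> u ` X"
    if x: "x \<in> Delta_minus J K u \<union> u ` X" and y: "y \<in> Delta_minus J K u \<union> u ` X"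
      and xy: "x + y \<in> affpos J" for x y
  proof -
    have xR: "x \<in> affpos J" "y \<in> affpos J" using x y iff by blast+
    \<comment> \<open>One strictly negative coordinate makes all of them nonpositive by
      \<open>fc_sign\<close>; on the Levi part those outside \<open>K\<close> vanish.\<close>
    have le: "fc i (inv u z) \<le> 0" if "z \<in> Delta_minus J K u \<union> u ` X" "i \<le> l" "i \<notin> K" for z i
    proof -
      have z: "z \<in> affpos J" "(\<exists>i\<le>l. i \<notin> K \<and> fc i (inv u z) < 0) \<or> inv u z \<in> X"
        using iff that by blast+
      from z(2) show ?thesis
      proof
        assume "\<exists>i\<le>l. i \<notin> K \<and> fc i (inv u z) < 0"
        then have "\<not> (\<forall>i\<le>l. fc i (inv u z) \<ge> 0)" by (meson not_le)
        then show ?thesis using fc_sign[OF z(1)] that(2) by blast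
      next
        assume "inv u z \<in> X"
        then show ?thesis using X0[OF z(1) _ that(2,3)] by simp
      qed
    qed
    show ?thesis
    proof (cases "\<exists>i\<le>l. i \<notin> K \<and> (fc i (inv u x) < 0 \<or> fc i (inv u y) < 0)")
      case True
      then obtain i where i: "i \<le> l" "i \<notin> K" "fc i (inv u x) < 0 \<or> fc i (inv u y) < 0" by blast
      have "fc i (inv u (x + y)) < 0" unfolding add fc_add using le[OF x i(1,2)] le[OF y i(1,2)] i(3) by linarith
      then show ?thesis using iff xy i by blast
    next
      case False
      then have X': "inv u x \<in> X" "inv u y \<in> X" using x y iff by blast+
      have "fc i (inv u (x + y)) = 0" if "i \<le> l" "i \<notin> K" for i
        unfolding add fc_add using X0 X' xR that by simp
      then have "inv u x + inv u y \<in> affpos K" using Levi[OF xy] unfolding add by blast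
      then have "inv u (x + y) \<in> X" unfolding add using X X' unfolding aff.biconvex_real_def by blast
      then show ?thesis using iff xy by blast
    qed
  qed
  have coclosed: False
    if x: "x \<in> affpos J - (Delta_minus J K u \<union> u ` X)"
      and y: "y \<in> affpos J - (Delta_minus J K u \<union> u ` X)"
      and xy: "x + y \<in> Delta_minus J K u \<union> u ` X" for x y
  proof -
    have xR: "x \<in> affpos J" "y \<in> affpos J" "x + y \<in> affpos J" using x y xy iff by blast+
    have ge: "fc i (inv u z) \<ge> 0" if "z \<in> affpos J - (Delta_minus J K u \<union> u ` X)" "i \<le> l" "i \<notin> K" for z i
      using that iff by (meson DiffD1 DiffD2 not_le)
    have "\<not> fc i (inv u (x + y)) < 0" if "i \<le> l" "i \<notin> K" for i
      unfolding add fc_add using ge[OF x that] ge[OF y that] by linarith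
    then have xyX: "inv u (x + y) \<in> X" using xy iff by blast
    \<comment> \<open>Nonnegative coordinates with sum zero vanish, so both roots lie in the Levi
      part, where the biconvexity of \<open>X\<close> decides.\<close>
    have zero: "fc i (inv u x) = 0 \<and> fc i (inv u y) = 0" if "i \<le> l" "i \<notin> K" for i
      using X0[OF xR(3) xyX that] ge[OF x that] ge[OF y that] unfolding add fc_add by linarith
    have "inv u x \<in> affpos K - X" "inv u y \<in> affpos K - X"
      using Levi[OF xR(1)] Levi[OF xR(2)] zero x y iff by blast+
    then show False using X xyX unfolding aff.biconvex_real_def add by blast
  qed
  show ?thesis unfolding biconvex_iff[OF J] using closed coclosed nabla_real[OF sub] by blast
qed

end

lemma params_all_iff:
  assumes J: "J \<subseteq> nodes"
  shows "(K, u, y) \<in> params_all J \<longleftrightarrow>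
    K \<subseteq> J \<and> u \<in> fin_weyl J \<and> (\<forall>k\<in>K. u (\<alpha> k) \<in> fpos J) \<and> y \<in> aff_weyl K"
  unfolding params_all_def using fin_weyl_rel_eq[OF J] by blast

lemma inversions_params:
  assumes K: "K \<subseteq> nodes" and y: "y \<in> aff_weyl K"
  shows "finite (Phi K y)" "Phi K y \<subseteq> apos K" "affine_reflection_system.biconvex_real (apos K) aimag (Phi K y)"
proof -
  interpret aff: affine_reflection_system "simples K" "apos K" refl ht aimag
    using affine_system[OF K] .
  have y': "y \<in> aff.W" using y aff_weyl_eq[OF K] by simp
  show "finite (Phi K y)" "Phi K y \<subseteq> apos K" "aff.biconvex_real (Phi K y)"
    unfolding Phi_eq[OF K y] using aff.finite_inversions[OF y'] aff.biconvex_real_inversions[OF y']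
    by (auto simp: aff.inversions_def)
qed

lemma Phi_inj:
  assumes K: "K \<subseteq> nodes" and "y \<in> aff_weyl K" "y' \<in> aff_weyl K" "Phi K y = Phi K y'"
  shows "y = y'"
proof -
  interpret aff: affine_reflection_system "simples K" "apos K" refl ht aimag
    using affine_system[OF K] .
  show ?thesis using aff.inversions_inj[of y y'] assms Phi_eq[OF K] aff_weyl_eq[OF K] by simp
qed

lemma Phi_surj:
  assumes K: "K \<subseteq> nodes" and "finite X" "affine_reflection_system.biconvex_real (apos K) aimag X"
  shows "\<exists>y\<in>aff_weyl K. X = Phi K y"
proof -
  interpret aff: affine_reflection_system "simples K" "apos K" refl ht aimag
    using affine_system[OF K] .
  obtain y where "y \<in> aff.W" "X = aff.inversions y" using aff.finite_biconvex_inversions assms(2,3) by blast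
  then show ?thesis using Phi_eq[OF K] aff_weyl_eq[OF K] by auto
qed

text \<open>For a biconvex set of real roots, imaginary roots are missing, so once a positive level
  of a ray is missing, all higher levels are; hence the name. The condition \<open>m > 0\<close>
  avoids level 0, where \<open>e\<close> may fail to be positive and would be missing for trivial
  reasons.\<close>

definition cofinite_part :: "nat set \<Rightarrow> 'v set \<Rightarrow> 'v set" where
  "cofinite_part J B = {e \<in> fin_roots J. \<exists>m>0. aff m e \<notin> B}"

context
  fixes J K :: "nat set" and u :: "'v \<Rightarrow> 'v"
  assumes J: "J \<subseteq> nodes" and K: "K \<subseteq> J" and u: "u \<in> fin_weyl J"
    and pos: "\<forall>k\<in>K. u (\<alpha> k) \<in> fpos J"
begin

lemma nabla_affine_iff:
  assumes X: "X \<subseteq> apos K" and f: "f \<in> fin_roots J" and m: "m > 0"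
  shows "aff m (u f) \<in> Delta_minus J K u \<union> u ` X \<longleftrightarrow>
    f \<in> fin_neg_roots_rel J K \<or> aff m f \<in> X"
proof -
  let ?x = "aff m (u f)"
  have x: "?x \<in> apos J" unfolding apos_def using m fin_weyl_roots[OF J u f] by blast
  have inv: "inv u ?x = aff m f" by (rule inv_u_affine[OF J K u pos])
  have fc: "fc i (aff m f) = coef i f" for i
    using fc_affine f fin_roots_mono[OF J] by blast
  have "f \<in> fin_neg_roots_rel J K \<longleftrightarrow> (\<exists>i\<le>l. i \<notin> K \<and> coef i f < 0)"
    unfolding neg_rel_eq(1)[OF J K] using f by blast
  then show ?thesis using nabla_iff[OF J K u pos X, of ?x, unfolded inv fc] x by blast
qed

text \<open>Rays over the image of \<open>fin_neg_roots_rel J K\<close> are in the set at all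
  positive levels; any other ray meets it only in the image of the finite set \<open>X\<close> and
  is missed at some level.\<close>

lemma cofinite_part_nabla:
  assumes X: "X \<subseteq> apos K" and fin: "finite X"
  shows "cofinite_part J (Delta_minus J K u \<union> u ` X) = u ` (fpos J \<union> fin_roots K)"
proof -
  have *: "(\<exists>m>0. aff m (u f) \<notin> Delta_minus J K u \<union> u ` X) \<longleftrightarrow> f \<notin> fin_neg_roots_rel J K"
    if f: "f \<in> fin_roots J" for f
  proof
    assume "\<exists>m>0. aff m (u f) \<notin> Delta_minus J K u \<union> u ` X"
    then show "f \<notin> fin_neg_roots_rel J K" using nabla_affine_iff[OF X f] by blast
  next
    assume n: "f \<notin> fin_neg_roots_rel J K"
    have "inj_on (\<lambda>m. aff m f) {0<..}"
      using affine_unique(1) f fin_roots_mono[OF J] by (meson inj_onI subsetD)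
    then have "infinite ((\<lambda>m. aff m f) ` {0<..})"
      using finite_imageD infinite_Ioi by blast
    then have "\<not> (\<lambda>m. aff m f) ` {0<..} \<subseteq> X" using fin finite_subset by blast
    then show "\<exists>m>0. aff m (u f) \<notin> Delta_minus J K u \<union> u ` X"
      using nabla_affine_iff[OF X f] n by auto
  qed
  have sub: "fpos J \<union> fin_roots K \<subseteq> fin_roots J"
    using fpos_roots[OF J] fin_roots_mono[OF K] by blast
  show ?thesis
  proof (intro equalityI subsetI)
    fix e assume e: "e \<in> cofinite_part J (Delta_minus J K u \<union> u ` X)"
    define f where "f = inv u e"
    have uf: "e = u f" unfolding f_def using fin_weyl_inv_right[OF J u] by simp
    have f: "f \<in> fin_roots J" unfolding f_def
      using fin_weyl_roots[OF J fin_weyl_inv[OF J u]] e unfolding cofinite_part_def by blast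
    then have "f \<notin> fin_neg_roots_rel J K" using *[OF f] e unfolding uf cofinite_part_def by blast
    then show "e \<in> u ` (fpos J \<union> fin_roots K)" unfolding neg_rel_eq(2)[OF J K] uf using f by blast
  next
    fix e assume "e \<in> u ` (fpos J \<union> fin_roots K)"
    then obtain f where f: "e = u f" "f \<in> fpos J \<union> fin_roots K" by blast
    then have fr: "f \<in> fin_roots J" using sub by blast
    have "f \<notin> fin_neg_roots_rel J K" unfolding neg_rel_eq(2)[OF J K] using f by blast
    then show "e \<in> cofinite_part J (Delta_minus J K u \<union> u ` X)"
      using *[OF fr] fin_weyl_roots[OF J u fr] unfolding f(1) cofinite_part_def by blast
  qed
qed

end

section \<open>Bijectivity of the parametrization\<close>

context
  fixes J :: "nat set"
  assumes J: "J \<subseteq> nodes"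
begin

lemma J_K_nodes: "K \<subseteq> J \<Longrightarrow> K \<subseteq> nodes"
  using J by blast

lemma nabla_params:
  assumes p: "(K, u, y) \<in> params_all J"
  shows "biconvex J (nabla J (K, u, y))" "nabla J (K, u, y) \<subseteq> apos J"
    "Delta_minus J K u \<inter> u ` Phi K y = {}"
    "cofinite_part J (nabla J (K, u, y)) = u ` (fpos J \<union> fin_roots K)"
proof -
  have K: "K \<subseteq> J" and u: "u \<in> fin_weyl J" and pos: "\<forall>k\<in>K. u (\<alpha> k) \<in> fpos J"
    and y: "y \<in> aff_weyl K"
    using p unfolding params_all_iff[OF J] by blast+
  note P = inversions_params[OF J_K_nodes[OF K] y]
  have n: "nabla J (K, u, y) = Delta_minus J K u \<union> u ` Phi K y" by (simp add: nabla_def)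
  show "biconvex J (nabla J (K, u, y))" unfolding n using biconvex_nabla[OF J K u pos P(3)] .
  show "nabla J (K, u, y) \<subseteq> apos J" unfolding n using nabla_real[OF J K u pos P(2)] .
  show "Delta_minus J K u \<inter> u ` Phi K y = {}" using nabla_disjoint[OF J K u pos P(2)] .
  show "cofinite_part J (nabla J (K, u, y)) = u ` (fpos J \<union> fin_roots K)"
    unfolding n using cofinite_part_nabla[OF J K u pos P(2,1)] .
qed

text \<open>\<open>cofinite_part\<close> recovers \<open>u\<close> and \<open>K\<close>; removing
  the disjoint part \<open>Delta_minus\<close> leaves the image of \<open>Phi K y\<close>, which
  determines \<open>y\<close>.\<close>

lemma nabla_inj: "inj_on (nabla J) (params_all J)"
proof (rule inj_onI)
  fix a b assume ab: "a \<in> params_all J" "b \<in> params_all J" "nabla J a = nabla J b"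
  obtain K u y where a: "a = (K, u, y)" by (cases a) blast
  obtain K' u' y' where b: "b = (K', u', y')" by (cases b) blast
  note p = ab(1)[unfolded a] and p' = ab(2)[unfolded b]
  have K: "K \<subseteq> J" and u: "u \<in> fin_weyl J" and pos: "\<forall>k\<in>K. u (\<alpha> k) \<in> fpos J"
    and y: "y \<in> aff_weyl K"
    using p unfolding params_all_iff[OF J] by blast+
  have K': "K' \<subseteq> J" and u': "u' \<in> fin_weyl J" and pos': "\<forall>k\<in>K'. u' (\<alpha> k) \<in> fpos J"
    and y': "y' \<in> aff_weyl K'"
    using p' unfolding params_all_iff[OF J] by blast+
  have "u ` (fpos J \<union> fin_roots K) = u' ` (fpos J \<union> fin_roots K')"
    using nabla_params(4)[OF p] nabla_params(4)[OF p'] ab(3) unfolding a b by simp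
  then have eq: "u = u'" "K = K'" using parabolic_unique[OF J u K pos u' K' pos'] by blast+
  have d: "Delta_minus J K u \<inter> u ` Phi K y = {}" "Delta_minus J K u \<inter> u ` Phi K y' = {}"
    using nabla_params(3)[OF p] nabla_params(3)[OF p'] eq by simp_all
  have "Delta_minus J K u \<union> u ` Phi K y = Delta_minus J K u \<union> u ` Phi K y'"
    using ab(3) eq unfolding a b by (simp add: nabla_def)
  then have "u ` Phi K y = u ` Phi K y'" using d by blast
  moreover have "inj u" using bij_is_inj fin_weyl_bij[OF J u] by blast
  ultimately have "Phi K y = Phi K y'" using inj_image_eq_iff by blast
  then show "a = b" using Phi_inj[OF J_K_nodes[OF K] y] y' eq unfolding a b by simp
qed

lemma nabla_surj:
  assumes B: "biconvex J B" and real: "B \<subseteq> apos J"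
  shows "\<exists>p\<in>params_all J. B = nabla J p"
proof -
  have closed: "x + y \<in> B" if "x \<in> B" "y \<in> B" "x + y \<in> affpos J" for x y
    using B that unfolding biconvex_iff[OF J] by blast
  have coclosed: "x + y \<notin> B" if "x \<in> affpos J" "x \<notin> B" "y \<in> affpos J" "y \<notin> B" for x y
    using B that real unfolding biconvex_iff[OF J] by blast
  have disjoint: "apos J \<inter> aimag = {}"
    using affine_not_imag fin_roots_mono[OF J] unfolding apos_def aimag_def by blast
  then have imag: "x \<notin> B" if "x \<in> aimag" for x using real that by blast
  have d: "of_int m *\<^sub>R delta \<in> aimag" if "m > 0" for m using that unfolding aimag_def by blast
  have ap: "aff m e \<in> apos J" if "e \<in> fin_roots J" "m > 0" for m e
    using that unfolding apos_def by blast
  have up: "aff n e \<notin> B"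
    if "aff m e \<in> apos J" "aff m e \<notin> B" "m \<le> n" for m n e
  proof (cases "m = n")
    case False
    then have "of_int (n - m) *\<^sub>R delta \<in> aimag" using that by (intro d) simp
    then have "aff m e + of_int (n - m) *\<^sub>R delta \<notin> B"
      using coclosed[of "aff m e"] that imag by blast
    moreover have "aff m e + of_int (n - m) *\<^sub>R delta = aff n e"
      by (simp add: scaleR_left_diff_distrib)
    ultimately show ?thesis by (simp only: not_False_eq_True)
  qed (use that in simp)
  \<comment> \<open>Otherwise the two roots would add up to an imaginary root in
    \<open>B\<close>.\<close>
  have opp: "aff n (- e) \<notin> B"
    if "aff m e \<in> B" "m + n > 0" for m n e
  proof
    assume "aff n (- e) \<in> B"
    moreover have "aff m e + (aff n (- e)) = of_int (m + n) *\<^sub>R delta"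
      by (simp add: scaleR_left_distrib)
    ultimately have "of_int (m + n) *\<^sub>R delta \<in> B" using closed[OF that(1)] d[OF that(2)] by fastforce
    then show False using imag d[OF that(2)] by blast
  qed
  define F where "F = cofinite_part J B"
  have "\<exists>K u. K \<subseteq> J \<and> u \<in> fin_weyl J \<and> (\<forall>k\<in>K. u (\<alpha> k) \<in> fpos J) \<and> F = u ` (fpos J \<union> fin_roots K)"
  proof (rule parabolic_exists[OF J])
    show "F \<subseteq> fin_roots J" unfolding F_def cofinite_part_def by blast
  next
    fix x y assume xy: "x \<in> F" "y \<in> F" "x + y \<in> fin_roots J"
    then obtain m n where mn: "m > 0" "aff m x \<notin> B" "n > 0" "aff n y \<notin> B"
      and r: "x \<in> fin_roots J" "y \<in> fin_roots J"
      unfolding F_def cofinite_part_def by blast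
    have "aff m x + aff n y \<notin> B"
      using coclosed ap[OF r(1) mn(1)] ap[OF r(2) mn(3)] mn by blast
    moreover have "aff m x + aff n y = aff (m + n) (x + y)"
      by (simp add: scaleR_left_distrib)
    moreover have "m + n > 0" using mn by simp
    ultimately show "x + y \<in> F" using xy(3) unfolding F_def cofinite_part_def by auto
  next
    fix x assume x: "x \<in> fin_roots J"
    show "x \<in> F \<or> - x \<in> F"
    proof (cases "x \<in> F")
      case False
      then have "aff 1 x \<in> B"
        using x zero_less_one unfolding F_def cofinite_part_def by blast
      then have "aff 1 (- x) \<notin> B" by (rule opp) simp
      then have "\<exists>m>0. aff m (- x) \<notin> B" using zero_less_one by blast
      then show ?thesis using fin_roots_uminus[OF J x] unfolding F_def cofinite_part_def by blast
    qed simp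
  qed
  then obtain K u where K: "K \<subseteq> J" and u: "u \<in> fin_weyl J" and pos: "\<forall>k\<in>K. u (\<alpha> k) \<in> fpos J"
    and F: "F = u ` (fpos J \<union> fin_roots K)" by blast
  note Kn = J_K_nodes[OF K]
  interpret aff: affine_reflection_system "simples K" "apos K" refl ht aimag
    using affine_system[OF Kn] .
  define X where "X = {v \<in> apos K. u v \<in> B}"
  have u_add: "u (x + y) = u x + u y" for x y using linear_add[OF fin_weyl_linear[OF J u]] .
  note u_imag = u_imag[OF J K u pos] and u_apos_imag = u_apos_imag[OF J K u pos]
  have uX: "u v \<in> B \<longleftrightarrow> v \<in> X" if "v \<in> affpos K" for v
    using that imag u_imag[of v] aff.disjoint unfolding X_def by auto
  have "aff.biconvex_real X"
  proof (rule aff.biconvex_realI)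
    show "X \<subseteq> apos K" unfolding X_def by blast
    show "x + y \<in> X" if "x \<in> X" "y \<in> X" "x + y \<in> affpos K" for x y
    proof -
      have "u x + u y \<in> B" using closed that u_apos_imag[OF that(3)] unfolding u_add X_def by blast
      then show ?thesis using uX[OF that(3)] by (simp add: u_add)
    qed
    show False if "x \<in> affpos K - X" "y \<in> affpos K - X" "x + y \<in> X" for x y
    proof -
      have "u x + u y \<notin> B" using coclosed u_apos_imag uX that by blast
      then show False using that(3) by (simp add: X_def u_add)
    qed
  qed
  moreover have "finite X"
  proof -
    \<comment> \<open>Rays of the Levi part are carried into directions of \<open>F\<close>, so from
      some level on they miss \<open>B\<close> for good; positivity bounds the levels from
      below.\<close>
    have "finite {m :: int. aff m e \<in> X}" if e: "e \<in> fin_roots K" for e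
    proof -
      have ueJ: "u e \<in> fin_roots J" using fin_weyl_roots[OF J u] fin_roots_mono[OF K] e by blast
      have "u e \<in> F" unfolding F using e by blast
      then obtain m where m: "m > 0" "aff m (u e) \<notin> B"
        unfolding F_def cofinite_part_def by blast
      have "n \<in> {0..<m}" if n: "aff n e \<in> X" for n
      proof -
        have "aff n (u e) \<in> B" using n u_affine[OF J K u pos] by (simp add: X_def)
        then have "\<not> m \<le> n" using up[OF ap[OF ueJ m(1)] m(2)] by blast
        moreover obtain k f where kf: "aff n e = aff k f" "f \<in> fin_roots K" "k \<ge> 0"
          using n unfolding X_def apos_def by force
        have "n = k" using affine_unique(1)[OF _ _ kf(1)] kf(2) e fin_roots_mono[OF Kn] by blast
        ultimately show ?thesis using kf(3) by simp
      qed
      then have "{n :: int. aff n e \<in> X} \<subseteq> {0..<m}" by blast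
      then show ?thesis by (rule finite_subset) simp
    qed
    then have "finite (\<Union>e\<in>fin_roots K. (\<lambda>m. aff m e) ` {m :: int. aff m e \<in> X})"
      using finite_fin_roots[OF Kn] by blast
    moreover have "X \<subseteq> (\<Union>e\<in>fin_roots K. (\<lambda>m. aff m e) ` {m :: int. aff m e \<in> X})"
      unfolding X_def apos_def by blast
    ultimately show ?thesis by (rule rev_finite_subset)
  qed
  ultimately obtain y where y: "y \<in> aff_weyl K" "X = Phi K y" using Phi_surj[OF Kn] by blast
  have sub: "X \<subseteq> apos K" unfolding X_def by blast
  have "x \<in> B \<longleftrightarrow> x \<in> Delta_minus J K u \<union> u ` X" if x: "x \<in> apos J" for x
  proof -
    obtain m e where e: "e \<in> fin_roots J" and xe: "x = aff m (u e)"
      and iu: "inv u x = aff m e" and m: "m > 0 \<or> m = 0 \<and> u e \<in> fpos J"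
      and fc: "\<forall>i. fc i (inv u x) = coef i e"
      using apos_u_cases[OF J K u pos x] by blast
    have m0: "m \<ge> 0" using m by auto
    have ue: "u e \<in> fin_roots J" using fin_weyl_roots[OF J u e] .
    have F_iff: "u f \<in> F \<longleftrightarrow> f \<in> fpos J \<union> fin_roots K" for f
      unfolding F image_iff_inv[OF J K u pos] using fin_weyl_inv_left[OF J u] by simp
    have iff: "x \<in> Delta_minus J K u \<union> u ` X \<longleftrightarrow> e \<in> fin_neg_roots_rel J K \<or> inv u x \<in> X"
      unfolding nabla_iff[OF J K u pos sub] neg_rel_eq(1)[OF J K] using x fc e by auto
    consider "e \<in> fin_neg_roots_rel J K" | "e \<in> fin_roots K"
      | "e \<in> fpos J" "e \<notin> fin_roots K" using e unfolding neg_rel_eq(2)[OF J K] by blast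
    then show ?thesis
    proof cases
      case 1
      then have "u e \<notin> F" unfolding F_iff neg_rel_eq(2)[OF J K] by blast
      then have all: "aff n (u e) \<in> B" if "n > 0" for n
        using that ue unfolding F_def cofinite_part_def by blast
      have "x \<in> B"
      proof (rule ccontr)
        assume "x \<notin> B"
        \<comment> \<open>The level \<open>m\<close> may be 0, which \<open>all\<close> does not
          cover; raising it by one does.\<close>
        then have "aff (m + 1) (u e) \<notin> B" using up[of m "u e" "m + 1"] x unfolding xe by simp
        then show False using all[of "m + 1"] m0 by simp
      qed
      then show ?thesis using iff 1 by blast
    next
      case 2
      then have "inv u x \<in> affpos K"
        using Levi_iff[OF J K u pos, of x] x fc fin_roots_support[OF Kn 2] by simp
      then have "x \<in> B \<longleftrightarrow> inv u x \<in> X" using uX[of "inv u x"] fin_weyl_inv_right[OF J u] by simp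
      moreover have "e \<notin> fin_neg_roots_rel J K" unfolding neg_rel_eq(2)[OF J K] using 2 by blast
      ultimately show ?thesis using iff by blast
    next
      case 3
      have me: "- e \<in> fin_roots J" using fin_roots_uminus[OF J e] .
      have "- e \<notin> fin_roots K" using 3(2) fin_roots_uminus[OF Kn, of "- e"] by auto
      then have "u (- e) \<notin> F" unfolding F_iff using fpos_uminus[OF J 3(1)] by blast
      then have "aff 1 (u (- e)) \<in> B"
        using fin_weyl_roots[OF J u me] zero_less_one unfolding F_def cofinite_part_def by blast
      \<comment> \<open>The opposite root at level 1 lies in \<open>B\<close>. Level 1 makes the sum
        of the levels positive even for \<open>m = 0\<close>.\<close>
      then have "aff m (- u (- e)) \<notin> B" using opp[of 1 "u (- e)" m] m0 by simp
      then have "x \<notin> B" unfolding xe using fin_weyl_linear[OF J u] by (simp add: linear_neg)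
      moreover have "inv u x \<notin> X"
      proof
        assume "inv u x \<in> X"
        then have "u (inv u x) \<in> B" by (simp add: X_def)
        then show False using \<open>x \<notin> B\<close> fin_weyl_inv_right[OF J u] by simp
      qed
      moreover have "e \<notin> fin_neg_roots_rel J K" unfolding neg_rel_eq(2)[OF J K] using 3 by blast
      ultimately show ?thesis using iff by blast
    qed
  qed
  then have "B = Delta_minus J K u \<union> u ` X" using real nabla_real[OF J K u pos sub] by blast
  then have "B = nabla J (K, u, y)" by (simp add: nabla_def y(2))
  moreover have "(K, u, y) \<in> params_all J" unfolding params_all_iff[OF J] using K u pos y(1) by blast
  ultimately show ?thesis by blast
qed

text \<open>An imaginary root \<open>x\<close> in \<open>B\<close> splits as
  \<open>\<alpha> j\<close> plus a real root, so one of these two lies in \<open>B\<close>; adding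
  \<open>x\<close> over and over then yields infinitely many members.\<close>

lemma finite_biconvex_is_real:
  assumes "J \<noteq> {}" and B: "biconvex J B" and fin: "finite B"
  shows "B \<subseteq> apos J"
proof
  fix x assume x: "x \<in> B"
  show "x \<in> apos J"
  proof (rule ccontr)
    assume "x \<notin> apos J"
    moreover have sub: "B \<subseteq> affpos J" using B unfolding biconvex_iff[OF J] by blast
    ultimately have "x \<in> aimag" using x by blast
    then obtain m :: int where m: "m > 0" "x = of_int m *\<^sub>R delta" unfolding aimag_def by blast
    obtain j where j: "j \<in> J" using assms(1) by blast
    note a = fpos_simple[OF J j] and ar = fin_roots_simple[OF J j]
    have ma: "- \<alpha> j \<in> fin_roots J" using fin_roots_uminus[OF J ar] .
    have 1: "aff 0 (\<alpha> j) \<in> apos J" unfolding apos_def using a ar by blast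
    have 2: "aff m (- \<alpha> j) \<in> apos J" unfolding apos_def using m ma by blast
    have "x = aff 0 (\<alpha> j) + aff m (- \<alpha> j)" using m by simp
    then have "aff 0 (\<alpha> j) \<in> B \<or> aff m (- \<alpha> j) \<in> B"
      using B x sub 1 2 unfolding biconvex_iff[OF J] by blast
    then obtain n e where e: "e \<in> fin_roots J" "n \<ge> 0" "aff n e \<in> B"
      using m ar ma by (metis less_imp_le order.refl)
    have "aff (n + int k * m) e \<in> B" for k
    proof (induction k)
      case (Suc k)
      have "n + int (Suc k) * m > 0" using e(2) m(1) by (simp add: add_nonneg_pos)
      then have "of_int (n + int (Suc k) * m) *\<^sub>R delta + e \<in> apos J" unfolding apos_def using e(1) by blast
      moreover have "of_int (n + int (Suc k) * m) *\<^sub>R delta + e = aff (n + int k * m) e + x"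
        unfolding m(2) by (simp add: algebra_simps)
      ultimately show ?case using B Suc x unfolding biconvex_iff[OF J] by (metis UnI1)
    qed (use e in simp)
    moreover have "inj (\<lambda>k. aff (n + int k * m) e)"
    proof (rule injI)
      fix k k' assume "aff (n + int k * m) e = aff (n + int k' * m) e"
      then have "n + int k * m = n + int k' * m"
        using affine_unique(1)[of e e] e(1) fin_roots_mono[OF J] by blast
      then show "k = k'" using m by simp
    qed
    ultimately have "infinite B" using fin range_inj_infinite by (metis (no_types, lifting) finite_subset image_subsetI)
    then show False using fin by simp
  qed
qed

text \<open>For \<open>j\<close> in \<open>J\<close> outside \<open>K\<close> the set contains all
  positive levels of the ray over \<open>u (- \<alpha> j)\<close>; for \<open>K = J\<close> only the
  finite part from \<open>Phi\<close> is left.\<close>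

lemma finite_nabla_iff:
  assumes p: "(K, u, y) \<in> params_all J"
  shows "finite (nabla J (K, u, y)) \<longleftrightarrow> K = J"
proof -
  have K: "K \<subseteq> J" and u: "u \<in> fin_weyl J" and pos: "\<forall>k\<in>K. u (\<alpha> k) \<in> fpos J"
    and y: "y \<in> aff_weyl K"
    using p unfolding params_all_iff[OF J] by blast+
  note P = inversions_params[OF J_K_nodes[OF K] y]
  have n: "nabla J (K, u, y) = Delta_minus J K u \<union> u ` Phi K y" by (simp add: nabla_def)
  show ?thesis
  proof
    assume "K = J"
    then have "fin_neg_roots_rel J K = {}" by (simp add: fin_neg_roots_rel_def)
    then have "Delta_minus J K u = {}" by (simp add: Delta_minus_def affinize_def)
    then show "finite (nabla J (K, u, y))" unfolding n using P(1) by simp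
  next
    assume fin: "finite (nabla J (K, u, y))"
    show "K = J"
    proof (rule ccontr)
      assume "K \<noteq> J"
      then obtain j where j: "j \<in> J" "j \<notin> K" using K by blast
      have jl: "j \<le> l" using K_le[OF J j(1)] .
      have r: "- \<alpha> j \<in> fin_roots J" using fin_roots_uminus[OF J fin_roots_simple[OF J j(1)]] .
      have "- \<alpha> j \<in> fin_neg_roots_rel J K" unfolding neg_rel_eq(1)[OF J K] using r j(2) jl by auto
      then have "aff m (u (- \<alpha> j)) \<in> nabla J (K, u, y)" if "m > 0" for m
        unfolding n using nabla_affine_iff[OF J K u pos P(2) r that] by blast
      then have "(\<lambda>m. aff m (u (- \<alpha> j))) ` {0<..} \<subseteq> nabla J (K, u, y)" by blast
      then have "finite ((\<lambda>m. aff m (u (- \<alpha> j))) ` {0<..})" using fin finite_subset by blast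
      moreover have "inj_on (\<lambda>m. aff m (u (- \<alpha> j))) {0<..}"
        using affine_unique(1) fin_weyl_roots[OF J u r] fin_roots_mono[OF J] by (meson inj_onI subsetD)
      ultimately show False using finite_imageD infinite_Ioi by blast
    qed
  qed
qed

text \<open>Finite biconvex sets consist of real roots, so the two families together are exactly the
  biconvex sets of real roots, and finiteness of the value amounts to \<open>K = J\<close>.\<close>

theorem nabla_bijective:
  assumes ne: "J \<noteq> {}"
  shows "bij_betw (nabla J) (params_all J) (fin_biconvex_sets J \<union> inf_biconvex_sets J)"
    and "nabla J ` params J = inf_biconvex_sets J"
proof -
  have real: "pos_real_roots = apos nodes" using real_pos_iff by blast
  have inf_eq: "inf_biconvex_sets J = {B. biconvex J B \<and> infinite B \<and> B \<subseteq> apos J}"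
  proof -
    have "B \<subseteq> pos_real_roots \<longleftrightarrow> B \<subseteq> apos J" if "biconvex J B" for B
    proof -
      have "B \<subseteq> affpos J" using that unfolding biconvex_iff[OF J] by blast
      moreover have "apos nodes \<inter> aimag = {}"
        using affine_not_imag unfolding apos_def aimag_def by blast
      moreover have "apos J \<subseteq> apos nodes" using apos_mono[OF J] .
      ultimately show ?thesis unfolding real by blast
    qed
    then show ?thesis unfolding inf_biconvex_sets_def by blast
  qed
  have fin_eq: "fin_biconvex_sets J = {B. biconvex J B \<and> finite B \<and> B \<subseteq> apos J}"
    using finite_biconvex_is_real[OF ne] unfolding fin_biconvex_sets_def by blast
  have img: "nabla J ` params_all J = {B. biconvex J B \<and> B \<subseteq> apos J}"
  proof (intro equalityI subsetI)
    fix B assume "B \<in> nabla J ` params_all J"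
    then obtain K u y where "(K, u, y) \<in> params_all J" "B = nabla J (K, u, y)" by auto
    then show "B \<in> {B. biconvex J B \<and> B \<subseteq> apos J}" using nabla_params(1,2) by blast
  next
    fix B assume "B \<in> {B. biconvex J B \<and> B \<subseteq> apos J}"
    then show "B \<in> nabla J ` params_all J" using nabla_surj[of B] by blast
  qed
  have "{B. biconvex J B \<and> B \<subseteq> apos J} = fin_biconvex_sets J \<union> inf_biconvex_sets J"
    unfolding inf_eq fin_eq by blast
  then show "bij_betw (nabla J) (params_all J) (fin_biconvex_sets J \<union> inf_biconvex_sets J)"
    unfolding bij_betw_def using nabla_inj img by simp
  show "nabla J ` params J = inf_biconvex_sets J"
  proof (intro equalityI subsetI)
    fix B assume "B \<in> nabla J ` params J"
    then obtain K u y where p: "(K, u, y) \<in> params_all J" "K \<subset> J" "B = nabla J (K, u, y)"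
      unfolding params_def by auto
    then have "infinite B" using finite_nabla_iff[OF p(1)] by blast
    then show "B \<in> inf_biconvex_sets J" unfolding inf_eq using nabla_params(1,2)[OF p(1)] p(3) by blast
  next
    fix B assume "B \<in> inf_biconvex_sets J"
    then have B: "B \<in> nabla J ` params_all J" "infinite B" unfolding img inf_eq by blast+
    then obtain K u y where p: "(K, u, y) \<in> params_all J" "B = nabla J (K, u, y)" by auto
    then have "K \<noteq> J" using B(2) finite_nabla_iff[OF p(1)] by blast
    moreover have "K \<subseteq> J" using p(1) unfolding params_all_iff[OF J] by blast
    ultimately have "(K, u, y) \<in> params J" unfolding params_def using p(1) by blast
    then show "B \<in> nabla J ` params J" using p(2) by blast
  qed
qed

end

end

theorem theorem6p7:
  fixes l :: nat
    and A :: "nat \<Rightarrow> nat \<Rightarrow> int"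
    and \<alpha> :: "nat \<Rightarrow> 'v::real_vector"
    and \<alpha>v :: "nat \<Rightarrow> 'v \<Rightarrow> real"
    and J :: "nat set"
  assumes "untwisted_affine l A \<alpha> \<alpha>v"
    and "J \<noteq> {}" and "J \<subseteq> {1..l}"
  shows "(\<forall>(K, u, y) \<in> untwisted_affine.params_all l A \<alpha> \<alpha>v J.
            untwisted_affine.Delta_minus l \<alpha> \<alpha>v J K u
              \<inter> u ` untwisted_affine.Phi l \<alpha> \<alpha>v K y = {})
       \<and> bij_betw (untwisted_affine.nabla l \<alpha> \<alpha>v J)
            (untwisted_affine.params_all l A \<alpha> \<alpha>v J)
            (untwisted_affine.fin_biconvex_sets l \<alpha> \<alpha>v J
               \<union> untwisted_affine.inf_biconvex_sets l \<alpha> \<alpha>v J)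
       \<and> untwisted_affine.nabla l \<alpha> \<alpha>v J ` untwisted_affine.params l A \<alpha> \<alpha>v J
            = untwisted_affine.inf_biconvex_sets l \<alpha> \<alpha>v J"
proof -
  interpret untwisted_affine l A \<alpha> \<alpha>v by (rule assms(1))
  show ?thesis
    using nabla_params(3)[OF assms(3)] nabla_bijective[OF assms(3,2)] by blast
qed

end
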